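(* Fix a conjugacy class of $S_n$, consisting of all permutations of $\{1,\dots,n\}$ whose representations as products of disjoint cycles (including 1-cycles) consist of an $L_1$-cycle, an $L_2$-cycle, $\dots$, and an $L_q$-cycle, where $L_1+\cdots+L_q=n$. Then the permutations of maximum multiplicity $N$ in this class are exactly those permutations in the class each of whose cycles, of length $L$ say, is of the form $(\Sigma+L\ \ \Sigma+L-1\ \cdots\ \Sigma+1)$ for some integer $\Sigma$ (depending on the cycle). Furthermore, the multiplicity of these permutations of maximum multiplicity is $$\sum_{\chi}\ \prod_{i:\ \chi(i)=i}C_{L_i}\ \prod_{i<j:\ \chi(i)=j}G_{L_iL_j},$$ where the sum is over all involutions $\chi$ of $\{1,\dots,q\}$.
   Context: Permutations are composed from right to left; $(i\ j)$ denotes the transposition exchanging $i$ and $j$, and $(i\ i)$ denotes the identity. The multiplicity $N(\pi)$ of a permutation $\pi$ of $\{1,\dots,n\}$ is the number of sequences $(a_1,\dots,a_n)\in\{1,\dots,n\}^n$ with $\pi=(n\ a_n)\cdots(2\ a_2)(1\ a_1)$. The cycle $(x_1\ x_2\ \cdots\ x_r)$ sends $x_1\mapsto x_2\mapsto\cdots\mapsto x_r\mapsto x_1$. An involution of a set is a self-map $\chi$ with $\chi\circ\chi=\mathrm{id}$ (the identity is included). $C_n=\frac1{n+1}\binom{2n}{n}$ is the $n$th Catalan number, and for positive integers $m,p$ $$G_{mp}=\frac{\binom{2m}{m}\binom{2p}{p}(m+p+4mp)-(m+p)\binom{2m+2p}{m+p}}{2(m+p)(m+p+1)}.$$ *)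

theory Defs
  imports Complex_Main "HOL-Library.FuncSet" "HOL-Combinatorics.Cycles"
begin

text \<open>\<open>swap_product a n\<close> is \<open>(n a\<^sub>n) \<cdots> (2 a\<^sub>2) (1 a\<^sub>1)\<close>, composed from right to left.\<close>

primrec swap_product :: "(nat \<Rightarrow> nat) \<Rightarrow> nat \<Rightarrow> nat \<Rightarrow> nat" where
  "swap_product a 0 = id"
| "swap_product a (Suc k) = transpose (Suc k) (a (Suc k)) \<circ> swap_product a k"

definition multiplicity :: "nat \<Rightarrow> (nat \<Rightarrow> nat) \<Rightarrow> nat" where
  "multiplicity n \<pi> = card {a \<in> {1..n} \<rightarrow>\<^sub>E {1..n}. \<pi> = swap_product a n}"

text \<open>
  The list \<open>[x\<^sub>1, \<dots>, x\<^sub>r]\<close> stands for the cycle \<open>x\<^sub>1 \<mapsto> x\<^sub>2 \<mapsto> \<cdots> \<mapsto> x\<^sub>r \<mapsto> x\<^sub>1\<close>. Since fixed points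
  are listed as 1-cycles, the cycles of a representation cover all of \<open>{1..n}\<close>.
\<close>

definition disjoint_cycle_rep :: "nat \<Rightarrow> (nat \<Rightarrow> nat) \<Rightarrow> nat list list \<Rightarrow> bool" where
  "disjoint_cycle_rep n \<pi> cs \<longleftrightarrow>
     [] \<notin> set cs \<and> distinct (concat cs) \<and> set (concat cs) = {1..n} \<and>
     \<pi> = foldr (\<circ>) (map cycle_of_list cs) id"

text \<open>The order of the cycles in a representation is free, as disjoint cycles commute.\<close>

definition cycle_type_class :: "nat \<Rightarrow> nat list \<Rightarrow> (nat \<Rightarrow> nat) set" where
  "cycle_type_class n Ls =
     {\<pi>. \<pi> permutes {1..n} \<and> (\<exists>cs. disjoint_cycle_rep n \<pi> cs \<and> map length cs = Ls)}"

text \<open>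
  A cycle determines its list only up to rotation, so that every cycle of \<open>\<pi>\<close> has the form
  \<open>(s+L  s+L-1  \<cdots>  s+1)\<close> iff some representation of \<open>\<pi>\<close> consists of lists of that form.
\<close>

definition descending_interval_cycles :: "nat \<Rightarrow> (nat \<Rightarrow> nat) \<Rightarrow> bool" where
  "descending_interval_cycles n \<pi> \<longleftrightarrow>
     (\<exists>cs. disjoint_cycle_rep n \<pi> cs \<and>
           (\<forall>c \<in> set cs. \<exists>s. c = rev [s + 1..<s + length c + 1]))"

definition catalan :: "nat \<Rightarrow> real" where
  "catalan n = 1 / (real n + 1) * real ((2 * n) choose n)"

definition G :: "nat \<Rightarrow> nat \<Rightarrow> real" where
  "G m p =
     (real ((2 * m) choose m) * real ((2 * p) choose p) * (real m + real p + 4 * real m * real p)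
        - (real m + real p) * real ((2 * m + 2 * p) choose (m + p)))
     / (2 * (real m + real p) * (real m + real p + 1))"

text \<open>Self-maps of \<open>A\<close> are taken extensional, so that each of them is counted once.\<close>

definition involutions :: "'a set \<Rightarrow> ('a \<Rightarrow> 'a) set" where
  "involutions A = {\<chi> \<in> A \<rightarrow>\<^sub>E A. \<forall>x \<in> A. \<chi> (\<chi> x) = x}"

end

theory Submission
  imports "HOL-Computational_Algebra.Formal_Power_Series" Defs
begin

text \<open>
  Draw the sequence \<open>(a\<^sub>1, \<dots>, a\<^sub>n)\<close> as a graph with an edge from every \<open>k\<close> to \<open>a\<^sub>k\<close>. A component has
  as many edges as vertices, so it is a tree with one additional edge, which may be a loop. The
  product of the transpositions along a tree is a single cycle, and the additional edge either is a
  loop or cuts this cycle in two. Hence every component carries one cycle of \<open>\<pi>\<close> or two, and the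
  multiplicity of \<open>\<pi>\<close> is a sum over the involutions \<open>\<chi>\<close> of its set of cycles: a cycle fixed by \<open>\<chi>\<close>
  contributes the number \<open>cycle_count\<close> of its own factorizations, a pair exchanged by \<open>\<chi>\<close> the number
  \<open>pair_count\<close> of factorizations that link its two cycles. This is \<open>factorization_count_eq\<close>.

  It is proved by removing the last transposition \<open>(n a\<^sub>n)\<close>, which cuts the cycle containing \<open>n\<close> or
  merges it with another one. Afterwards \<open>n\<close> has no transposition of its own any more; call it
  inactive. A cycle with two inactive elements has no factorization at all
  (\<open>factorization_count_eq_0\<close>), and in a cycle with exactly one inactive element \<open>r\<close> the number of
  factorizations, \<open>rooted_count\<close>, depends only on the word read after \<open>r\<close>. So removing the
  transpositions one after the other yields recursions for \<open>rooted_count\<close>, \<open>cycle_count\<close> and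
  \<open>pair_count\<close>, in which always the largest element is split off.

  Every one of these recursions is a sum over the ways of cutting a word, and bounding the pieces by
  induction bounds the whole. For words and single cycles the bound is the Catalan recursion, and
  equality forces the word, or a rotation of the cycle, to be descending. For two cycles one has to
  sum \<open>rooted_count\<close> over all rotations of one of them (\<open>attach_count\<close>). Here the recursion at the
  largest element does not compare well with the extremal case, but \<open>rooted_count\<close> also satisfies a
  mirrored recursion at its smallest element (\<open>rooted_count_at_min\<close>), and with it the induction goes
  through (\<open>attach_count_bound\<close>). Equality for a pair means that both cycles are descending up to
  rotation and that all elements of one of them exceed all elements of the other. The bounds are
  attained simultaneously exactly if this holds for all pairs, that is, if every cycle is a
  descending interval.

  The extremal value for a pair of cycles of lengths \<open>p\<close> and \<open>m\<close> has the generating function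
  \<open>u v / (1 - u - v)\<^sup>2\<close>, where \<open>u = x c(x)\<close>, \<open>v = y c(y)\<close> and \<open>c\<close> is the Catalan series. As
  \<open>x - y = (u - v) (1 - u - v)\<close>, its product with \<open>(x - y)\<^sup>2\<close> is \<open>u v (u - v)\<^sup>2\<close>, a polynomial in two
  one-variable series. This determines the second differences of the extremal values along the
  antidiagonals, and \<open>G\<close> has the same second differences (\<open>pair_max_eq_G\<close>).
\<close>

section \<open>Catalan numbers\<close>

fun cat :: "nat \<Rightarrow> nat" where
  "cat 0 = 1"
| "cat (Suc n) = (\<Sum>i\<in>{..n}. cat i * cat (n - i))"

lemma cat_pos [simp]: "cat n > 0"
proof (induction n rule: less_induct)
  case (less n)
  show ?case
  proof (cases n)
    case (Suc m)
    have "0 < cat 0 * cat m" using less[of m] Suc by simp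
    also have "\<dots> \<le> (\<Sum>i\<in>{..m}. cat i * cat (m - i))"
      using member_le_sum[of 0 "{..m}" "\<lambda>i. cat i * cat (m - i)"] by simp
    finally show ?thesis using Suc by simp
  qed simp
qed

lemma central_binomial_Suc:
  "(real n + 1) * real ((2 * Suc n) choose Suc n) = 2 * (2 * real n + 1) * real ((2 * n) choose n)"
proof -
  have central: "real ((2 * k) choose k) = fact (2 * k) / (fact k * fact k)" for k
    using binomial_fact[of k "2 * k", where ?'a = real] by simp
  have "(fact (2 * Suc n) :: real) = (2 * real n + 2) * ((2 * real n + 1) * fact (2 * n))"
    by (simp add: algebra_simps)
  moreover have "(fact (Suc n) :: real) = (real n + 1) * fact n"
    by (simp add: algebra_simps)
  ultimately have "real ((2 * Suc n) choose Suc n)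
      = (2 * real n + 2) * ((2 * real n + 1) * fact (2 * n)) / (((real n + 1) * fact n) * ((real n + 1) * fact n))"
    unfolding central by (simp only:)
  moreover have "N * ((2 * N) * (r * A) / ((N * f) * (N * f))) = 2 * r * (A / (f * f))"
    if "N \<noteq> 0" "f \<noteq> 0" for N r A f :: real
    using that by (simp add: field_simps)
  from this[of "real n + 1" "fact n" "2 * real n + 1" "fact (2 * n)"]
  have "(real n + 1) * ((2 * real n + 2) * ((2 * real n + 1) * fact (2 * n)) / (((real n + 1) * fact n) * ((real n + 1) * fact n)))
      = 2 * (2 * real n + 1) * (fact (2 * n) / (fact n * fact n))"
    by (simp add: distrib_left)
  ultimately show ?thesis unfolding central by (simp only:)
qed

lemma catalan_Suc: "(real n + 2) * catalan (Suc n) = 2 * (2 * real n + 1) * catalan n"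
proof -
  define a b where "a = real ((2 * Suc n) choose Suc n)" and "b = real ((2 * n) choose n)"
  have "(real n + 1) * a = 2 * (2 * real n + 1) * b"
    unfolding a_def b_def by (rule central_binomial_Suc)
  moreover have "catalan (Suc n) = 1 / (real n + 2) * a" "catalan n = 1 / (real n + 1) * b"
    by (simp_all only: catalan_def a_def b_def of_nat_Suc) (simp_all add: add_ac)
  ultimately have "(real n + 1) * ((real n + 2) * catalan (Suc n))
      = (real n + 1) * (2 * (2 * real n + 1) * catalan n)"
    by simp
  then show ?thesis by (subst (asm) mult_cancel_left) auto
qed

text \<open>
  The closed form and the recursion of the Catalan numbers are matched by a differential equation:
  for the series \<open>d\<close> of the closed form, \<open>s = 1 - 2 x d\<close> satisfies \<open>(1 - 4 x) s' = - 2 s\<close>, so that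
  \<open>s\<^sup>2\<close> and \<open>1 - 4 x\<close> solve the same first-order equation. Their equality is the functional equation
  \<open>d = 1 + x d\<^sup>2\<close>.
\<close>

lemma catalan_fps: includes fps_syntax shows "Abs_fps catalan = 1 + fps_X * Abs_fps catalan ^ 2"
proof -
  define d where "d = Abs_fps catalan"
  define s where "s = 1 - 2 * (fps_X * d)"
  define q where "q = s ^ 2"
  have s0: "s $ 0 = 1" by (simp add: s_def)
  have sS: "s $ Suc n = - 2 * catalan n" for n
    by (simp add: s_def d_def fps_numeral_fps_const)
  have rec: "(real n + 1) * s $ Suc n = (4 * real n - 2) * s $ n" for n
  proof (cases n)
    case 0
    then show ?thesis by (simp add: s0 sS catalan_def)
  next
    case (Suc m)
    then show ?thesis using catalan_Suc[of m] by (simp add: sS algebra_simps)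
  qed
  have ode: "fps_deriv s * (1 - 4 * fps_X) = - 2 * s"
  proof (rule fps_ext)
    fix n
    have "(fps_deriv s * (1 - 4 * fps_X)) $ n
        = (fps_deriv s - 4 * (fps_X * fps_deriv s)) $ n" by (simp add: algebra_simps)
    also have "\<dots> = (real n + 1) * s $ Suc n - 4 * (real n * s $ n)"
      by (cases n) (simp_all add: fps_numeral_fps_const)
    also have "\<dots> = (- 2 * s) $ n"
      using rec[of n] by (simp add: fps_numeral_fps_const algebra_simps)
    finally show "(fps_deriv s * (1 - 4 * fps_X)) $ n = (- 2 * s) $ n" .
  qed
  have "fps_deriv q * (1 - 4 * fps_X) = 2 * s * (fps_deriv s * (1 - 4 * fps_X))"
    by (simp add: q_def power2_eq_square algebra_simps)
  also have "\<dots> = - 4 * q" by (simp add: ode q_def power2_eq_square)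
  finally have qode: "fps_deriv q * (1 - 4 * fps_X) = - 4 * q" .
  have qrec: "(real n + 1) * q $ Suc n = (4 * real n - 4) * q $ n" for n
  proof -
    have "(fps_deriv q * (1 - 4 * fps_X)) $ n
        = (fps_deriv q - 4 * (fps_X * fps_deriv q)) $ n" by (simp add: algebra_simps)
    also have "\<dots> = (real n + 1) * q $ Suc n - 4 * (real n * q $ n)"
      by (cases n) (simp_all add: fps_numeral_fps_const)
    finally show ?thesis unfolding qode by (simp add: fps_numeral_fps_const algebra_simps)
  qed
  have q0: "q $ 0 = 1" by (simp add: q_def s0 power2_eq_square)
  have q1: "q $ Suc 0 = - 4" using qrec[of 0] q0 by simp
  have q2: "q $ Suc (Suc n) = 0" for n
  proof (induction n)
    case 0
    show ?case using qrec[of 1] by simp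
  next
    case (Suc n)
    show ?case using qrec[of "Suc (Suc n)"] Suc by simp
  qed
  have "q = 1 - 4 * fps_X"
  proof (rule fps_ext)
    fix n show "q $ n = (1 - 4 * fps_X) $ n"
      by (cases n rule: cat.cases; cases "n - 1")
         (auto simp: q0 q1 q2 fps_numeral_fps_const)
  qed
  then have "4 * fps_X * (d - (1 + fps_X * d ^ 2)) = 0"
    by (simp add: q_def s_def power2_eq_square algebra_simps)
  then show ?thesis by (simp add: d_def)
qed

lemma catalan_conv_sum: includes fps_syntax shows "catalan (Suc n) = (\<Sum>i\<le>n. catalan i * catalan (n - i))"
proof -
  have "Abs_fps catalan $ Suc n = (1 + fps_X * Abs_fps catalan ^ 2) $ Suc n"
    using catalan_fps by simp
  then have "catalan (Suc n) = (Abs_fps catalan * Abs_fps catalan) $ n"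
    by (simp add: power2_eq_square)
  then show ?thesis by (simp add: fps_mult_nth atLeast0AtMost)
qed

lemma cat_eq_catalan: "real (cat n) = catalan n"
proof (induction n rule: less_induct)
  case (less n)
  show ?case
  proof (cases n)
    case 0
    then show ?thesis by (simp add: catalan_def)
  next
    case (Suc m)
    have "real (cat n) = (\<Sum>i\<le>m. real (cat i) * real (cat (m - i)))" using Suc by simp
    also have "\<dots> = (\<Sum>i\<le>m. catalan i * catalan (m - i))"
      by (intro sum.cong refl) (simp add: less Suc)
    finally show ?thesis using Suc by (simp add: catalan_conv_sum)
  qed
qed

text \<open>
  Multiplication by the Catalan series \<open>c\<close> is the same as division by \<open>1 - x c\<close>; every sequence that
  is defined below as a convolution with Catalan numbers is used through the resulting recursion.
\<close>

lemma cat_convolution_Suc: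
  includes fps_syntax
  fixes h :: "nat \<Rightarrow> nat"
  assumes H: "\<And>n. H n = (\<Sum>j\<le>n. cat j * h (n - j))"
  shows "H (Suc n) = h (Suc n) + (\<Sum>i\<le>n. cat i * H (n - i))"
proof -
  let ?c = "Abs_fps cat" and ?h = "Abs_fps h"
  have c: "?c = 1 + fps_X * (?c * ?c)"
  proof (rule fps_ext)
    fix n show "?c $ n = (1 + fps_X * (?c * ?c)) $ n"
      by (cases n) (simp_all, simp add: fps_mult_nth atLeast0AtMost)
  qed
  have Hf: "Abs_fps H = ?c * ?h"
    by (rule fps_ext) (simp add: H fps_mult_nth atLeast0AtMost)
  have "Abs_fps H = ?h + fps_X * (?c * Abs_fps H)"
    unfolding Hf by (subst c) (simp add: algebra_simps)
  then have "Abs_fps H $ Suc n = (?h + fps_X * (?c * Abs_fps H)) $ Suc n" by simp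
  then have "H (Suc n) = h (Suc n) + (?c * Abs_fps H) $ n" by simp
  then show ?thesis by (simp add: fps_mult_nth atLeast0AtMost)
qed

section \<open>The extremal values for two linked cycles\<close>

text \<open>
  With \<open>D(x, y) = \<Sum> C\<^bsub>i+j\<^esub> x\<^sup>i y\<^sup>j\<close>, the generating function of \<open>cat_rect\<close> is \<open>x y D\<^sup>2\<close>; that of
  \<open>attach_max\<close> has the additional factor \<open>c(y)\<close>, that of \<open>pair_max\<close> the factor \<open>c(x) c(y)\<close>.
  \<open>attach_max (k + 1) m\<close> will be the largest value of \<open>attach_count\<close> for a word of length \<open>k\<close> and a
  cycle of length \<open>m\<close>, and \<open>pair_max p m\<close> the largest value of \<open>pair_count\<close> for cycles of lengths
  \<open>p\<close> and \<open>m\<close>.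
\<close>

definition cat_rect :: "nat \<Rightarrow> nat \<Rightarrow> nat" where
  "cat_rect K m = (\<Sum>i<K. \<Sum>l<m. cat (i + l) * cat (K + m - 2 - (i + l)))"

definition attach_max :: "nat \<Rightarrow> nat \<Rightarrow> nat" where
  "attach_max K m = (\<Sum>j\<le>m. cat j * cat_rect K (m - j))"

definition pair_max :: "nat \<Rightarrow> nat \<Rightarrow> nat" where
  "pair_max p m = (\<Sum>i\<le>p. cat i * attach_max (p - i) m)"

lemma cat_rect_0 [simp]: "cat_rect 0 m = 0" "cat_rect K 0 = 0"
  by (simp_all add: cat_rect_def)

lemma attach_max_0 [simp]: "attach_max 0 m = 0" "attach_max K 0 = 0"
  by (simp_all add: attach_max_def)

lemma pair_max_0 [simp]: "pair_max 0 m = 0"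
  by (simp add: pair_max_def)

lemma attach_max_Suc:
  "attach_max K (Suc m) = cat_rect K (Suc m) + (\<Sum>t\<le>m. cat t * attach_max K (m - t))"
  by (rule cat_convolution_Suc) (rule attach_max_def)

lemma pair_max_Suc:
  "pair_max (Suc p) m = attach_max (Suc p) m + (\<Sum>i<p. cat i * pair_max (p - i) m)"
  using cat_convolution_Suc[of "\<lambda>p. pair_max p m" "\<lambda>p. attach_max p m" p]
  by (simp add: pair_max_def lessThan_Suc_atMost[symmetric])

lemma cat_rect_commute: "cat_rect K m = cat_rect m K"
  unfolding cat_rect_def by (subst sum.swap) (simp add: add.commute)

lemma pair_max_eq_double_sum:
  "pair_max p m = (\<Sum>i\<le>p. \<Sum>j\<le>m. cat i * cat j * cat_rect (p - i) (m - j))"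
  by (simp add: pair_max_def attach_max_def sum_distrib_left mult.assoc)

lemma pair_max_commute: "pair_max p m = pair_max m p"
  unfolding pair_max_eq_double_sum
  by (subst sum.swap) (simp add: cat_rect_commute mult.commute)

text \<open>
  Expand the second Catalan factor of every summand of \<open>cat_rect (k + 1) m\<close> by the Catalan recursion
  and drop some terms: what remains is the convolution on the left, and the row \<open>i = k\<close> is lost.
  This slack is what excludes that the smallest element lies in the word when a cycle is attached to
  a word in the optimal way.
\<close>

lemma cat_rect_strict:
  assumes "m > 0"
  shows "(\<Sum>i<k. cat i * cat_rect (k - i) m) < cat_rect (Suc k) m"
proof -
  have "(\<Sum>i<k. cat i * cat_rect (k - i) m)
      = (\<Sum>i<k. \<Sum>j<k-i. \<Sum>l<m. cat (j + l) * (cat i * cat (k - i + m - 2 - (j + l))))"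
    by (simp add: cat_rect_def sum_distrib_left mult_ac)
  also have "\<dots> = (\<Sum>(i,j)\<in>(SIGMA i:{..<k}. {..<k-i}). \<Sum>l<m. cat (j + l) * (cat i * cat (k - i + m - 2 - (j + l))))"
    by (rule sum.Sigma) auto
  also have "\<dots> = (\<Sum>(j,i)\<in>(SIGMA j:{..<k}. {..<k-j}). \<Sum>l<m. cat (j + l) * (cat i * cat (k - i + m - 2 - (j + l))))"
    by (rule sum.reindex_bij_witness[of _ "\<lambda>(i,j). (j,i)" "\<lambda>(i,j). (j,i)"]) auto
  also have "\<dots> = (\<Sum>j<k. \<Sum>i<k-j. \<Sum>l<m. cat (j + l) * (cat i * cat (k - i + m - 2 - (j + l))))"
    by (rule sum.Sigma[symmetric]) auto
  also have "\<dots> = (\<Sum>j<k. \<Sum>l<m. cat (j + l) * (\<Sum>i<k-j. cat i * cat (k - i + m - 2 - (j + l))))"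
    by (rule sum.cong[OF refl], subst sum.swap) (simp add: sum_distrib_left)
  also have "\<dots> \<le> (\<Sum>j<k. \<Sum>l<m. cat (j + l) * cat (Suc k + m - 2 - (j + l)))"
  proof (intro sum_mono mult_left_mono)
    fix j l assume jl: "j \<in> {..<k}" "l \<in> {..<m}"
    define r where "r = k + m - 2 - (j + l)"
    have r: "Suc k + m - 2 - (j + l) = Suc r" using jl by (auto simp: r_def)
    have "(\<Sum>i<k-j. cat i * cat (k - i + m - 2 - (j + l))) = (\<Sum>i<k-j. cat i * cat (r - i))"
      using jl by (intro sum.cong refl) (auto simp: r_def algebra_simps)
    also have "\<dots> \<le> (\<Sum>i\<le>r. cat i * cat (r - i))"
      using jl by (intro sum_mono2) (auto simp: r_def)
    finally show "(\<Sum>i<k-j. cat i * cat (k - i + m - 2 - (j + l))) \<le> cat (Suc k + m - 2 - (j + l))"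
      unfolding r by (simp only: cat.simps)
  qed simp
  also have "\<dots> < (\<Sum>j<Suc k. \<Sum>l<m. cat (j + l) * cat (Suc k + m - 2 - (j + l)))"
    using assms by (auto intro!: sum_pos)
  finally show ?thesis by (simp only: cat_rect_def)
qed

lemma attach_max_strict:
  assumes "m > 0"
  shows "(\<Sum>i<k. cat i * attach_max (k - i) m) < attach_max (Suc k) m"
proof -
  have "(\<Sum>i<k. cat i * attach_max (k - i) m)
      = (\<Sum>j\<le>m. cat j * (\<Sum>i<k. cat i * cat_rect (k - i) (m - j)))"
    unfolding attach_max_def sum_distrib_left by (subst sum.swap) (simp add: mult_ac)
  also have "\<dots> < (\<Sum>j\<le>m. cat j * cat_rect (Suc k) (m - j))"
  proof (rule sum_strict_mono_ex1)
    show "\<forall>j\<in>{..m}. cat j * (\<Sum>i<k. cat i * cat_rect (k - i) (m - j)) \<le> cat j * cat_rect (Suc k) (m - j)"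
    proof
      fix j
      show "cat j * (\<Sum>i<k. cat i * cat_rect (k - i) (m - j)) \<le> cat j * cat_rect (Suc k) (m - j)"
        using cat_rect_strict[of "m - j" k] by (cases "m - j = 0") auto
    qed
    show "\<exists>j\<in>{..m}. cat j * (\<Sum>i<k. cat i * cat_rect (k - i) (m - j)) < cat j * cat_rect (Suc k) (m - j)"
      using cat_rect_strict[OF assms, of k] by (intro bexI[of _ 0]) auto
  qed simp
  finally show ?thesis by (simp only: attach_max_def)
qed

section \<open>The closed form of the extremal values\<close>

text \<open>
  Series in two variables are power series in \<open>Y\<close> whose coefficients are power series in \<open>X\<close>. The
  identity is the coefficient of \<open>x\<^bsup>p+2\<^esup> y\<^bsup>m+2\<^esup>\<close> in \<open>(x - y)\<^sup>2 P = u\<^sup>3 v + u v\<^sup>3 - 2 u\<^sup>2 v\<^sup>2\<close>, where \<open>P\<close> is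
  the series of \<open>pair_max\<close>; powers of \<open>u = x c(x)\<close> are reduced by \<open>u = x + u\<^sup>2\<close>.
\<close>

lemma pair_max_second_difference:
  includes fps_syntax
  shows "real (pair_max p (Suc (Suc m))) + real (pair_max (Suc (Suc p)) m) - 2 * real (pair_max (Suc p) (Suc m)) =
     (real (cat (Suc p)) - real (cat p)) * real (cat (Suc m))
     + real (cat (Suc p)) * (real (cat (Suc m)) - real (cat m))
     - 2 * real (cat (Suc p)) * real (cat (Suc m))"
  (is "?lhs = ?rhs")
proof -
  define c :: "real fps" where "c = Abs_fps (\<lambda>n. real (cat n))"
  define lift :: "real fps \<Rightarrow> real fps fps" where "lift f = Abs_fps (\<lambda>m. fps_const (f $ m))" for f
  define X Y :: "real fps fps" where "X = fps_const fps_X" and "Y = fps_X"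
  define u where "u = fps_X * c"
  define D :: "real fps fps" where "D = Abs_fps (\<lambda>m. Abs_fps (\<lambda>p. real (cat (p + m))))"
  define U V where "U = fps_const u" and "V = lift u"
  define P where "P = fps_const c * (lift c * (X * (Y * (D * D))))"
  have lift_mult: "lift (f * g) = lift f * lift g" for f g
  proof -
    have "fps_const (sum h A) = (\<Sum>i\<in>A. fps_const (h i))" for h :: "nat \<Rightarrow> real" and A
      by (rule fps_ext) (simp add: fps_sum_nth)
    then show ?thesis by (intro fps_ext) (simp add: lift_def fps_mult_nth[of f g] fps_mult_nth[of "Abs_fps _"])
  qed
  have lift_X: "lift fps_X = Y"
    by (rule fps_ext) (simp add: lift_def Y_def)
  have c: "c = 1 + u * c"
  proof (rule fps_ext)
    fix n show "c $ n = (1 + u * c) $ n"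
      by (cases n) (simp_all add: c_def u_def mult.assoc, simp add: fps_mult_nth atLeast0AtMost)
  qed
  have XYD: "(X - Y) * D = U - V"
  proof (intro fps_ext)
    fix m p show "((X - Y) * D) $ m $ p = (U - V) $ m $ p"
      by (cases m; cases p) (simp_all add: X_def Y_def D_def U_def V_def lift_def u_def c_def left_diff_distrib)
  qed
  have DD: "(D * D) $ m $ p = real (cat_rect (Suc p) (Suc m))" for m p
    by (simp add: fps_mult_nth D_def fps_sum_nth cat_rect_def lessThan_Suc_atMost atLeast0AtMost)
       (rule sum.swap)
  have E: "(X * (Y * (D * D))) $ m $ p = real (cat_rect p m)" for m p
    by (cases m; cases p) (simp_all add: X_def Y_def DD)
  have P: "P $ m $ p = real (pair_max p m)" for m p
  proof -
    have 1: "(lift c * (X * (Y * (D * D)))) $ m $ p = real (attach_max p m)" for m p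
      by (subst fps_mult_nth)
         (simp add: fps_sum_nth lift_def E c_def attach_max_def atLeast0AtMost)
    show ?thesis
      unfolding P_def fps_mult_left_const_nth by (subst fps_mult_nth[of c], simp only: 1, simp add: c_def pair_max_def atLeast0AtMost)
  qed
  have U: "U = X * fps_const c" and V: "V = Y * lift c"
    by (simp_all add: U_def V_def u_def X_def lift_mult lift_X)
  have "(X - Y) * ((X - Y) * P) = (fps_const c * X) * (lift c * Y) * (((X - Y) * D) * ((X - Y) * D))"
    unfolding P_def by (simp only: mult_ac)
  also have "\<dots> = U * V * ((U - V) * (U - V))"
    unfolding XYD by (simp only: U V mult_ac)
  also have "\<dots> = (U * (U * U)) * V + U * (V * (V * V)) - 2 * ((U * U) * (V * V))"
    by (simp add: algebra_simps)
  also have "\<dots> = fps_const (u * (u * u)) * lift u + fps_const u * lift (u * (u * u))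
                   - 2 * (fps_const (u * u) * lift (u * u))"
    by (simp add: U_def V_def lift_mult)
  finally have *: "(X - Y) * ((X - Y) * P) = \<dots>" .
  have u_eq: "u = fps_X + u * u"
  proof -
    have "u = fps_X * (1 + u * c)" unfolding u_def using c by (simp add: u_def)
    also have "\<dots> = fps_X + u * (fps_X * c)" by (simp add: algebra_simps)
    also have "fps_X * c = u" by (simp add: u_def)
    finally show ?thesis .
  qed
  have uu: "(u * u) $ Suc (Suc n) = real (cat (Suc n))" for n
  proof -
    have "u $ Suc (Suc n) = (fps_X + u * u) $ Suc (Suc n)" using u_eq by simp
    then show ?thesis by (simp add: u_def c_def)
  qed
  have uuu: "(u * (u * u)) $ Suc (Suc n) = real (cat (Suc n)) - real (cat n)" for n
  proof -
    have "u * u = fps_X * u + u * (u * u)"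
      using arg_cong[OF u_eq, of "\<lambda>f. f * u"] by (simp add: distrib_right mult.assoc)
    then have "(u * u) $ Suc (Suc n) = (fps_X * u + u * (u * u)) $ Suc (Suc n)" by simp
    then show ?thesis unfolding uu by (simp add: u_def c_def)
  qed
  have u1: "u $ Suc n = real (cat n)" for n by (simp add: u_def c_def)
  have "(X - Y) * ((X - Y) * P) = X * (X * P) - 2 * (X * (Y * P)) + Y * (Y * P)"
    by (simp add: algebra_simps)
  then have "?lhs = ((X - Y) * ((X - Y) * P)) $ Suc (Suc m) $ Suc (Suc p)"
    by (simp add: X_def Y_def P fps_numeral_fps_const mult.assoc)
  also have "\<dots> = ?rhs"
    unfolding * by (simp add: lift_def uu uuu u1 fps_numeral_fps_const)
  finally show ?thesis .
qed


text \<open>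
  All three values of \<open>G\<close> lie on one antidiagonal, so their terms with the binomial coefficient of
  \<open>2 m + 2 p\<close> cancel. The other binomial coefficients and the Catalan numbers become polynomial
  multiples of \<open>\<alpha>\<close> and \<open>\<beta>\<close>, which leaves a polynomial identity.
\<close>

lemma G_second_difference:
  "G p (Suc (Suc m)) + G (Suc (Suc p)) m - 2 * G (Suc p) (Suc m) =
     (catalan (Suc p) - catalan p) * catalan (Suc m)
     + catalan (Suc p) * (catalan (Suc m) - catalan m)
     - 2 * catalan (Suc p) * catalan (Suc m)"
proof -
  define b where "b k = real ((2 * k) choose k)" for k
  have b_Suc: "(real k + 1) * b (Suc k) = 2 * (2 * real k + 1) * b k" for k
    unfolding b_def by (rule central_binomial_Suc)
  have G_b: "G i j = (b i * b j * (real i + real j + 4 * real i * real j) - (real i + real j) * b (i + j))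
      / (2 * (real i + real j) * (real i + real j + 1))" for i j
    by (simp add: G_def b_def)
  have polynomial: "\<exists>\<alpha>. b k = (real k + 1) * (real k + 2) * \<alpha> \<and> b (Suc k) = 2 * (2 * real k + 1) * (real k + 2) * \<alpha>
      \<and> b (Suc (Suc k)) = 4 * (2 * real k + 1) * (2 * real k + 3) * \<alpha>
      \<and> catalan k = (real k + 2) * \<alpha> \<and> catalan (Suc k) = 2 * (2 * real k + 1) * \<alpha>" for k
  proof -
    \<comment> \<open>With \<open>b k\<close> written as a multiple of \<open>(k + 1) (k + 2)\<close>, the two recursion steps that follow divide without remainder.\<close>
    define \<alpha> where "\<alpha> = b k / ((real k + 1) * (real k + 2))"
    have nz: "real k + 1 \<noteq> 0" "real k + 2 \<noteq> 0" by linarith+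
    have 0: "b k = (real k + 1) * (real k + 2) * \<alpha>" using nz by (simp add: \<alpha>_def)
    have "(real k + 1) * b (Suc k) = (real k + 1) * (2 * (2 * real k + 1) * (real k + 2) * \<alpha>)"
      unfolding b_Suc 0 by (simp only: mult_ac)
    then have 1: "b (Suc k) = 2 * (2 * real k + 1) * (real k + 2) * \<alpha>" using nz by simp
    have "(real k + 2) * b (Suc (Suc k)) = (real k + 2) * (4 * (2 * real k + 1) * (2 * real k + 3) * \<alpha>)"
      using b_Suc[of "Suc k"] unfolding 1 by (simp add: algebra_simps)
    then have 2: "b (Suc (Suc k)) = 4 * (2 * real k + 1) * (2 * real k + 3) * \<alpha>" using nz by simp
    have 3: "catalan k = (real k + 2) * \<alpha>"
      using nz unfolding catalan_def b_def[symmetric] 0 by simp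
    have "(real k + 2) * catalan (Suc k) = (real k + 2) * (2 * (2 * real k + 1) * \<alpha>)"
      unfolding catalan_Suc 3 by (simp only: mult_ac)
    then have "catalan (Suc k) = 2 * (2 * real k + 1) * \<alpha>" using nz by simp
    with 0 1 2 3 show ?thesis by blast
  qed
  obtain \<alpha> where \<alpha>: "b p = (real p + 1) * (real p + 2) * \<alpha>" "b (Suc p) = 2 * (2 * real p + 1) * (real p + 2) * \<alpha>"
      "b (Suc (Suc p)) = 4 * (2 * real p + 1) * (2 * real p + 3) * \<alpha>"
      "catalan p = (real p + 2) * \<alpha>" "catalan (Suc p) = 2 * (2 * real p + 1) * \<alpha>"
    using polynomial[of p] by blast
  obtain \<beta> where \<beta>: "b m = (real m + 1) * (real m + 2) * \<beta>" "b (Suc m) = 2 * (2 * real m + 1) * (real m + 2) * \<beta>"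
      "b (Suc (Suc m)) = 4 * (2 * real m + 1) * (2 * real m + 3) * \<beta>"
      "catalan m = (real m + 2) * \<beta>" "catalan (Suc m) = 2 * (2 * real m + 1) * \<beta>"
    using polynomial[of m] by blast
  define s where "s = real p + real m + 2"
  define B where "B = b (Suc (Suc (p + m)))"
  have s: "s \<noteq> 0" "s + 1 \<noteq> 0" unfolding s_def by linarith+
  \<comment> \<open>The numerators of the three values of \<open>G\<close>, without their common term \<open>s * B\<close>.\<close>
  define x y z where "x = b p * b (Suc (Suc m)) * (s + 4 * real p * (real m + 2))"
    and "y = b (Suc (Suc p)) * b m * (s + 4 * (real p + 2) * real m)"
    and "z = b (Suc p) * b (Suc m) * (s + 4 * (real p + 1) * (real m + 1))"
  have "G p (Suc (Suc m)) = (x - s * B) / (2 * s * (s + 1))"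
    unfolding G_b x_def s_def B_def by (simp add: algebra_simps)
  moreover have "G (Suc (Suc p)) m = (y - s * B) / (2 * s * (s + 1))"
    unfolding G_b y_def s_def B_def by (simp add: algebra_simps)
  moreover have "G (Suc p) (Suc m) = (z - s * B) / (2 * s * (s + 1))"
    unfolding G_b z_def s_def B_def by (simp add: algebra_simps)
  ultimately have "G p (Suc (Suc m)) + G (Suc (Suc p)) m - 2 * G (Suc p) (Suc m)
      = (x + y - 2 * z) / (2 * s * (s + 1))"
    by (simp add: diff_divide_distrib add_divide_distrib)
  moreover have "x + y - 2 * z = (2 * s * (s + 1)) * ((catalan (Suc p) - catalan p) * catalan (Suc m)
     + catalan (Suc p) * (catalan (Suc m) - catalan m)
     - 2 * catalan (Suc p) * catalan (Suc m))"
    unfolding x_def y_def z_def \<alpha> \<beta> s_def by algebra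
  ultimately show ?thesis using s by simp
qed

lemma pair_max_1: "real (pair_max 1 m) = catalan (Suc m) - catalan m"
proof -
  have rect: "cat_rect 1 (Suc t) = cat (Suc t)" for t
    by (simp add: cat_rect_def lessThan_Suc_atMost)
  have "pair_max 1 m = attach_max 1 m"
    using pair_max_Suc[of 0 m] by simp
  also have "attach_max 1 m + cat m = (\<Sum>j<m. cat j * cat_rect 1 (m - j)) + cat m"
    by (simp add: attach_max_def flip: lessThan_Suc_atMost)
  also have "(\<Sum>j<m. cat j * cat_rect 1 (m - j)) = (\<Sum>j<m. cat j * cat (m - j))"
    by (intro sum.cong refl) (metis Suc_diff_Suc lessThan_iff rect)
  also have "\<dots> + cat m = cat (Suc m)"
    by (simp flip: lessThan_Suc_atMost)
  finally have "real (pair_max 1 m) + real (cat m) = real (cat (Suc m))" by linarith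
  then show ?thesis by (simp only: cat_eq_catalan)
qed

lemma G_1: "G 1 m = catalan (Suc m) - catalan m"
proof -
  define b where "b = real ((2 * m) choose m)"
  define b' where "b' = real ((2 * Suc m) choose Suc m)"
  have nz: "real m + 1 \<noteq> 0" "real m + 2 \<noteq> 0" by linarith+
  have b': "b' = 2 * (2 * real m + 1) * (b / (real m + 1))"
    using central_binomial_Suc[of m] nz unfolding b_def b'_def by (simp add: field_simps)
  define \<beta> where "\<beta> = b / (real m + 1)"
  have b: "b = \<beta> * (real m + 1)" using nz by (simp add: \<beta>_def)
  have "G 1 m = (2 * b * (1 + real m + 4 * real m) - (1 + real m) * b') / (2 * (1 + real m) * (1 + real m + 1))"
    by (simp add: G_def b_def b'_def)
  also have "2 * b * (1 + real m + 4 * real m) - (1 + real m) * b' = (2 * (1 + real m)) * (3 * real m * \<beta>)"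
    unfolding b' \<beta>_def[symmetric] unfolding b by algebra
  also have "\<dots> / (2 * (1 + real m) * (1 + real m + 1)) = 3 * real m * \<beta> / (real m + 2)"
    using nz by (simp add: add_ac)
  also have "\<dots> = 2 * (2 * real m + 1) * \<beta> / (real m + 2) - \<beta>"
    using nz by (simp add: field_simps)
  also have "2 * (2 * real m + 1) * \<beta> / (real m + 2) = catalan (Suc m)"
    using b' by (simp add: catalan_def b'_def[simplified] \<beta>_def add_ac)
  also have "\<beta> = catalan m" by (simp add: catalan_def b_def \<beta>_def)
  finally show ?thesis .
qed

text \<open>
  Both sides agree for \<open>p = 0\<close> and \<open>p = 1\<close> and have the same second differences along the
  antidiagonal \<open>p + m = s\<close>.
\<close>

lemma pair_max_eq_G: "real (pair_max p m) = G p m"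
proof -
  have "p \<le> s \<longrightarrow> real (pair_max p (s - p)) = G p (s - p)" for p s
  proof (induction p rule: induct_nat_012)
    case 0
    show ?case by (simp add: G_def)
  next
    case 1
    show ?case using pair_max_1[of "s - 1"] G_1[of "s - 1"] by simp
  next
    case (ge2 p)
    show ?case
    proof
      assume "Suc (Suc p) \<le> s"
      then obtain m where "s = Suc (Suc (p + m))" by (metis add_Suc_shift le_Suc_ex add_Suc)
      then have s: "s - p = Suc (Suc m)" "s - Suc p = Suc m" "s - Suc (Suc p) = m" "p \<le> s" "Suc p \<le> s"
        by auto
      show "real (pair_max (Suc (Suc p)) (s - Suc (Suc p))) = G (Suc (Suc p)) (s - Suc (Suc p))"
        using ge2 pair_max_second_difference[of p m] G_second_difference[of p m]
        unfolding s cat_eq_catalan by (simp add: s)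
    qed
  qed
  from this[of p "p + m"] show ?thesis by simp
qed

section \<open>Sums over the splittings of a list\<close>

text \<open>
  Cutting a cycle at a position splits the word that represents it, so all recursions below are sums
  over splittings \<open>A @ B\<close> of a word; the proper ones have \<open>B \<noteq> []\<close>.
\<close>

definition split_sum :: "('a list \<Rightarrow> 'a list \<Rightarrow> nat) \<Rightarrow> 'a list \<Rightarrow> nat" where
  "split_sum f xs = (\<Sum>i\<in>{..length xs}. f (take i xs) (drop i xs))"

definition proper_split_sum :: "('a list \<Rightarrow> 'a list \<Rightarrow> nat) \<Rightarrow> 'a list \<Rightarrow> nat" where
  "proper_split_sum f xs = (\<Sum>i<length xs. f (take i xs) (drop i xs))"

lemma split_sum_Nil [simp]: "split_sum f [] = f [] []"
  by (simp add: split_sum_def)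

lemma split_sum_Cons [simp]: "split_sum f (x # xs) = f [] (x # xs) + split_sum (\<lambda>A B. f (x # A) B) xs"
  unfolding split_sum_def by (simp add: sum.atMost_Suc_shift del: sum.atMost_Suc)

lemma proper_split_sum_Nil [simp]: "proper_split_sum f [] = 0"
  by (simp add: proper_split_sum_def)

lemma proper_split_sum_Cons [simp]:
  "proper_split_sum f (x # xs) = f [] (x # xs) + proper_split_sum (\<lambda>A B. f (x # A) B) xs"
  unfolding proper_split_sum_def by (simp add: sum.lessThan_Suc_shift del: sum.lessThan_Suc)

lemma split_sum_eq_proper: "split_sum f xs = proper_split_sum f xs + f xs []"
  by (simp add: split_sum_def proper_split_sum_def flip: lessThan_Suc_atMost)

lemma split_sum_cong:
  assumes "\<And>A B. A @ B = xs \<Longrightarrow> f A B = g A B"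
  shows "split_sum f xs = split_sum g xs"
  unfolding split_sum_def by (intro sum.cong refl assms) simp

lemma split_sum_mono:
  assumes "\<And>A B. A @ B = xs \<Longrightarrow> f A B \<le> g A B"
  shows "split_sum f xs \<le> split_sum g xs"
  unfolding split_sum_def by (intro sum_mono assms) simp

lemma proper_split_sum_cong:
  assumes "\<And>A B. A @ B = xs \<Longrightarrow> B \<noteq> [] \<Longrightarrow> f A B = g A B"
  shows "proper_split_sum f xs = proper_split_sum g xs"
  unfolding proper_split_sum_def by (intro sum.cong refl assms) auto

lemma proper_split_sum_mono:
  assumes "\<And>A B. A @ B = xs \<Longrightarrow> B \<noteq> [] \<Longrightarrow> f A B \<le> g A B"
  shows "proper_split_sum f xs \<le> proper_split_sum g xs"
  unfolding proper_split_sum_def by (intro sum_mono assms) auto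

lemma split_sum_strict_mono:
  assumes "\<And>A B. A @ B = xs \<Longrightarrow> f A B \<le> g A B" and "f xs [] < g xs []"
  shows "split_sum f xs < split_sum g xs"
  using proper_split_sum_mono[of xs f g] assms by (simp add: split_sum_eq_proper add_le_less_mono)

lemma split_sum_add: "split_sum (\<lambda>A B. f A B + g A B) xs = split_sum f xs + split_sum g xs"
  by (simp add: split_sum_def sum.distrib)

lemma split_sum_mult_left: "split_sum (\<lambda>A B. c * f A B) xs = c * split_sum f xs"
  by (simp add: split_sum_def sum_distrib_left)

lemma split_sum_mult_right: "split_sum (\<lambda>A B. f A B * c) xs = split_sum f xs * c"
  by (simp add: split_sum_def sum_distrib_right)

lemma split_sum_swap:
  "split_sum (\<lambda>A B. split_sum (\<lambda>C D. f A B C D) ys) xs = split_sum (\<lambda>C D. split_sum (\<lambda>A B. f A B C D) xs) ys"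
  unfolding split_sum_def by (rule sum.swap)

lemma split_sum_assoc:
  "split_sum (\<lambda>A B. split_sum (\<lambda>A1 A2. f A1 A2 B) A) xs = split_sum (\<lambda>A B. split_sum (\<lambda>B1 B2. f A B1 B2) B) xs"
  by (induction xs arbitrary: f) (simp_all add: split_sum_add)

lemma split_sum_append_Cons:
  "split_sum f (P @ y # Q) = split_sum (\<lambda>A B. f A (B @ y # Q)) P + split_sum (\<lambda>A B. f (P @ y # A) B) Q"
  by (induction P arbitrary: f) simp_all

lemma split_sum_append:
  "split_sum f (P @ Q) = proper_split_sum (\<lambda>A B. f A (B @ Q)) P + split_sum (\<lambda>A B. f (P @ A) B) Q"
  by (induction P arbitrary: f) simp_all

text \<open>
  The splitting at the junction is counted by both sums on the right.
\<close>

lemma split_sum_append':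
  "split_sum f (P @ Q) + f P Q = split_sum (\<lambda>A B. f A (B @ Q)) P + split_sum (\<lambda>A B. f (P @ A) B) Q"
  using split_sum_append[of f P Q] split_sum_eq_proper[of "\<lambda>A B. f A (B @ Q)" P] by simp

lemma split_sum_length: "split_sum (\<lambda>A B. g (length A) (length B)) xs = (\<Sum>i\<le>length xs. g i (length xs - i))"
  unfolding split_sum_def by (intro sum.cong) auto

lemma proper_split_sum_length:
  "proper_split_sum (\<lambda>A B. g (length A) (length B)) xs = (\<Sum>i<length xs. g i (length xs - i))"
  unfolding proper_split_sum_def by (intro sum.cong) auto

section \<open>Cycles with one inactive element\<close>

definition left_of_max :: "nat list \<Rightarrow> nat list" where
  "left_of_max w = takeWhile (\<lambda>x. x \<noteq> Max (set w)) w"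

definition right_of_max :: "nat list \<Rightarrow> nat list" where
  "right_of_max w = tl (dropWhile (\<lambda>x. x \<noteq> Max (set w)) w)"

lemma max_split:
  assumes "w \<noteq> []"
  shows "w = left_of_max w @ Max (set w) # right_of_max w"
proof -
  have "Max (set w) \<in> set w" using assms by simp
  then have "dropWhile (\<lambda>x. x \<noteq> Max (set w)) w \<noteq> []" by auto
  then have "dropWhile (\<lambda>x. x \<noteq> Max (set w)) w = Max (set w) # right_of_max w"
    unfolding right_of_max_def using hd_dropWhile by (metis (mono_tags, lifting) list.collapse)
  then show ?thesis unfolding left_of_max_def by (metis takeWhile_dropWhile_id)
qed

lemma max_split_unique:
  assumes "\<forall>x\<in>set Y \<union> set X. x < n"
  shows "Max (set (Y @ n # X)) = n" "left_of_max (Y @ n # X) = Y" "right_of_max (Y @ n # X) = X"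
proof -
  show M: "Max (set (Y @ n # X)) = n"
    by (rule Max_eqI) (use assms in \<open>auto intro: less_imp_le\<close>)
  have "\<forall>x\<in>set Y. x \<noteq> n" using assms by auto
  then show "left_of_max (Y @ n # X) = Y" "right_of_max (Y @ n # X) = X"
    unfolding left_of_max_def right_of_max_def M
    by (simp_all add: takeWhile_append2 dropWhile_append2)
qed

lemma length_max_split: "w \<noteq> [] \<Longrightarrow> Suc (length (left_of_max w) + length (right_of_max w)) = length w"
  using arg_cong[OF max_split[of w], of length] by simp

text \<open>
  \<open>rooted_count w\<close> is the number of ways to write the cycle \<open>(r w\<^sub>1 \<dots> w\<^sub>k)\<close> as a product of
  transpositions \<open>(x a\<^sub>x)\<close> of its elements, one for every \<open>x\<close> in \<open>w\<close>, with increasing \<open>x\<close> from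
  right to left. Let \<open>w = Y @ n # X\<close> with \<open>n\<close> the largest element. The last factor \<open>(n a\<^sub>n)\<close> has to separate \<open>n\<close> from
  \<open>r\<close>, so it cuts \<open>X\<close> into \<open>A @ B\<close> and leaves the cycles \<open>(n A)\<close> and \<open>(r Y B)\<close>. Unfolding the
  recursion, \<open>rooted_count w\<close> is the number of noncrossing partitions of the positions of \<open>w\<close> such
  that \<open>w\<close> is descending on every block.
\<close>

function rooted_count :: "nat list \<Rightarrow> nat" where
  "rooted_count w = (if w = [] then 1 else
     (\<Sum>i\<in>{..length (right_of_max w)}.
        rooted_count (take i (right_of_max w)) * rooted_count (left_of_max w @ drop i (right_of_max w))))"
  by auto
termination
  by (relation "measure length") (use length_max_split in \<open>fastforce+\<close>)

declare rooted_count.simps [simp del]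

lemma rooted_count_Nil [simp]: "rooted_count [] = 1"
  by (simp add: rooted_count.simps)

lemma rooted_count_at_max:
  assumes "\<forall>x\<in>set Y \<union> set X. x < n"
  shows "rooted_count (Y @ n # X) = split_sum (\<lambda>A B. rooted_count A * rooted_count (Y @ B)) X"
  by (subst rooted_count.simps) (simp add: max_split_unique[OF assms] split_sum_def)

text \<open>
  The recursion at the smallest element is the mirror image of the one at the largest. To derive one
  from the other, expand both sides at the largest element \<open>n\<close> and apply the induction hypothesis. If
  \<open>n\<close> lies to the right of \<open>m\<close>, the two cuts are independent. Otherwise \<open>P = Y @ n # Z\<close>, and the
  splittings of a concatenation have to be sorted by the part that is cut; counting the junction
  twice on both sides (\<open>common\<close>) makes the three groups of terms \<open>t1\<close>, \<open>t2\<close>, \<open>t3\<close> agree.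
\<close>

lemma rooted_count_at_min:
  assumes "distinct (P @ m # Q)" "\<forall>x\<in>set P \<union> set Q. m < x"
  shows "rooted_count (P @ m # Q) = split_sum (\<lambda>A B. rooted_count B * rooted_count (A @ Q)) P"
  using assms
proof (induction "length (P @ Q)" arbitrary: P Q rule: less_induct)
  case less
  let ?T = rooted_count
  show ?case
  proof (cases "P @ Q = []")
    case True
    then show ?thesis using rooted_count_at_max[of "[]" "[]" m] by simp
  next
    case False
    define n where "n = Max (set (P @ Q))"
    have n: "n \<in> set (P @ Q)" "\<forall>x\<in>set (P @ Q). x \<le> n"
      unfolding n_def using False by (auto simp del: set_append intro: Max_in)
    then have mn: "m < n" using less.prems by auto
    show ?thesis
    proof (cases "n \<in> set Q")
      case True
      then obtain Z X where Q: "Q = Z @ n # X" by (meson split_list)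
      have lt: "\<forall>x\<in>set P \<union> set Z \<union> set X. x < n"
        using n less.prems unfolding Q by (auto simp: order.strict_iff_order)
      have "?T (P @ m # Q) = ?T ((P @ m # Z) @ n # X)" by (simp add: Q)
      also have "\<dots> = split_sum (\<lambda>A B. ?T A * ?T (P @ m # (Z @ B))) X"
        by (subst rooted_count_at_max) (use lt mn in auto)
      also have "\<dots> = split_sum (\<lambda>A B. ?T A * split_sum (\<lambda>C D. ?T D * ?T (C @ Z @ B)) P) X"
      proof (rule split_sum_cong)
        fix A B assume "A @ B = X"
        then have "?T (P @ m # (Z @ B)) = split_sum (\<lambda>C D. ?T D * ?T (C @ Z @ B)) P"
          by (intro less.hyps) (use less.prems in \<open>auto simp: Q\<close>)
        then show "?T A * ?T (P @ m # (Z @ B)) = ?T A * split_sum (\<lambda>C D. ?T D * ?T (C @ Z @ B)) P" by simp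
      qed
      also have "\<dots> = split_sum (\<lambda>C D. ?T D * split_sum (\<lambda>A B. ?T A * ?T ((C @ Z) @ B)) X) P"
        unfolding split_sum_mult_left[symmetric]
        by (subst split_sum_swap) (simp add: mult_ac)
      also have "\<dots> = split_sum (\<lambda>C D. ?T D * ?T (C @ Q)) P"
      proof (rule split_sum_cong)
        fix C D assume CD: "C @ D = P"
        have "?T (C @ Q) = ?T ((C @ Z) @ n # X)" by (simp add: Q)
        also have "\<dots> = split_sum (\<lambda>A B. ?T A * ?T ((C @ Z) @ B)) X"
          by (rule rooted_count_at_max) (use lt CD in auto)
        finally show "?T D * split_sum (\<lambda>A B. ?T A * ?T ((C @ Z) @ B)) X = ?T D * ?T (C @ Q)" by simp
      qed
      finally show ?thesis .
    next
      case False
      then have "n \<in> set P" using n by auto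
      then obtain Y Z where P: "P = Y @ n # Z" by (meson split_list)
      have lt: "\<forall>x\<in>set Y \<union> set Z \<union> set Q. x < n"
        using n less.prems unfolding P by (auto simp: order.strict_iff_order)
      define common where "common = split_sum (\<lambda>A B. ?T A * (?T B * ?T (Y @ Q))) Z"
      define t1 where "t1 = split_sum (\<lambda>A B. split_sum (\<lambda>C D. ?T A * (?T (D @ B) * ?T (C @ Q))) Y) Z"
      define t2 where "t2 = split_sum (\<lambda>A B. split_sum (\<lambda>C D. ?T A * (?T D * ?T (Y @ C @ Q))) B) Z"
      define t3 where "t3 = split_sum (\<lambda>A B. split_sum (\<lambda>C D. ?T B * (?T (A @ C) * ?T (Y @ D))) Q) Z"
      have cut_Y: "split_sum (\<lambda>C D. ?T D * ?T (C @ Q)) (Y @ B) + ?T B * ?T (Y @ Q)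
          = split_sum (\<lambda>C D. ?T (D @ B) * ?T (C @ Q)) Y + split_sum (\<lambda>C D. ?T D * ?T (Y @ C @ Q)) B" for B
        using split_sum_append'[of "\<lambda>C D. ?T D * ?T (C @ Q)" Y B] by simp
      have cut_Q: "split_sum (\<lambda>C D. ?T C * ?T (Y @ D)) (A @ Q) + ?T A * ?T (Y @ Q)
          = split_sum (\<lambda>C D. ?T C * ?T (Y @ D @ Q)) A + split_sum (\<lambda>C D. ?T (A @ C) * ?T (Y @ D)) Q" for A
        using split_sum_append'[of "\<lambda>C D. ?T C * ?T (Y @ D)" A Q] by simp
      have "?T (P @ m # Q) = ?T (Y @ n # (Z @ m # Q))" by (simp add: P)
      also have "\<dots> = split_sum (\<lambda>A B. ?T A * ?T (Y @ B)) (Z @ m # Q)"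
        by (rule rooted_count_at_max) (use lt mn in auto)
      also have "\<dots> = split_sum (\<lambda>A B. ?T A * ?T ((Y @ B) @ m # Q)) Z
                     + split_sum (\<lambda>C D. ?T (Z @ m # C) * ?T (Y @ D)) Q"
        by (simp add: split_sum_append_Cons)
      also have "split_sum (\<lambda>C D. ?T (Z @ m # C) * ?T (Y @ D)) Q
          = split_sum (\<lambda>C D. split_sum (\<lambda>A B. ?T B * ?T (A @ C)) Z * ?T (Y @ D)) Q"
      proof (rule split_sum_cong)
        fix C D assume CD: "C @ D = Q"
        have "?T (Z @ m # C) = split_sum (\<lambda>A B. ?T B * ?T (A @ C)) Z"
          by (rule less.hyps) (use less.prems CD in \<open>auto simp: P\<close>)
        then show "?T (Z @ m # C) * ?T (Y @ D) = split_sum (\<lambda>A B. ?T B * ?T (A @ C)) Z * ?T (Y @ D)" by simp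
      qed
      also have "\<dots> = t3"
        unfolding split_sum_mult_right[symmetric] t3_def
        by (subst split_sum_swap) (simp add: mult_ac)
      also have "split_sum (\<lambda>A B. ?T A * ?T ((Y @ B) @ m # Q)) Z
          = split_sum (\<lambda>A B. ?T A * split_sum (\<lambda>C D. ?T D * ?T (C @ Q)) (Y @ B)) Z"
      proof (rule split_sum_cong)
        fix A B assume AB: "A @ B = Z"
        have "?T ((Y @ B) @ m # Q) = split_sum (\<lambda>C D. ?T D * ?T (C @ Q)) (Y @ B)"
          by (rule less.hyps) (use less.prems AB in \<open>auto simp: P\<close>)
        then show "?T A * ?T ((Y @ B) @ m # Q) = ?T A * split_sum (\<lambda>C D. ?T D * ?T (C @ Q)) (Y @ B)" by simp
      qed
      finally have "?T (P @ m # Q) + common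
          = split_sum (\<lambda>A B. ?T A * (split_sum (\<lambda>C D. ?T D * ?T (C @ Q)) (Y @ B) + ?T B * ?T (Y @ Q))) Z + t3"
        by (simp add: common_def split_sum_add distrib_left)
      also have "\<dots> = t1 + t2 + t3"
        unfolding cut_Y unfolding t1_def t2_def distrib_left split_sum_add split_sum_mult_left[symmetric]
        by (simp add: mult_ac)
      finally have lhs: "?T (P @ m # Q) + common = t1 + t2 + t3" .
      have "split_sum (\<lambda>A B. ?T B * ?T (A @ Q)) P
          = split_sum (\<lambda>C D. ?T (D @ n # Z) * ?T (C @ Q)) Y + split_sum (\<lambda>A B. ?T B * ?T (Y @ n # (A @ Q))) Z"
        by (simp add: P split_sum_append_Cons)
      also have "split_sum (\<lambda>C D. ?T (D @ n # Z) * ?T (C @ Q)) Y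
          = split_sum (\<lambda>C D. split_sum (\<lambda>A B. ?T A * ?T (D @ B)) Z * ?T (C @ Q)) Y"
      proof (rule split_sum_cong)
        fix C D assume "C @ D = Y"
        then have "?T (D @ n # Z) = split_sum (\<lambda>A B. ?T A * ?T (D @ B)) Z"
          by (intro rooted_count_at_max) (use lt in auto)
        then show "?T (D @ n # Z) * ?T (C @ Q) = split_sum (\<lambda>A B. ?T A * ?T (D @ B)) Z * ?T (C @ Q)" by simp
      qed
      also have "\<dots> = t1"
        unfolding split_sum_mult_right[symmetric] t1_def
        by (subst split_sum_swap) (simp add: mult_ac)
      also have "split_sum (\<lambda>A B. ?T B * ?T (Y @ n # (A @ Q))) Z
          = split_sum (\<lambda>A B. ?T B * split_sum (\<lambda>C D. ?T C * ?T (Y @ D)) (A @ Q)) Z"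
      proof (rule split_sum_cong)
        fix A B assume "A @ B = Z"
        then have "?T (Y @ n # (A @ Q)) = split_sum (\<lambda>C D. ?T C * ?T (Y @ D)) (A @ Q)"
          by (intro rooted_count_at_max) (use lt in auto)
        then show "?T B * ?T (Y @ n # (A @ Q)) = ?T B * split_sum (\<lambda>C D. ?T C * ?T (Y @ D)) (A @ Q)" by simp
      qed
      finally have "split_sum (\<lambda>A B. ?T B * ?T (A @ Q)) P + common
          = t1 + split_sum (\<lambda>A B. ?T B * (split_sum (\<lambda>C D. ?T C * ?T (Y @ D)) (A @ Q) + ?T A * ?T (Y @ Q))) Z"
        by (simp add: common_def split_sum_add distrib_left mult_ac)
      also have "\<dots> = t1 + (split_sum (\<lambda>A B. split_sum (\<lambda>C D. ?T C * (?T B * ?T (Y @ D @ Q))) A) Z + t3)"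
        unfolding cut_Q unfolding t3_def distrib_left split_sum_add split_sum_mult_left[symmetric]
        by (simp add: mult_ac)
      also have "\<dots> = t1 + t2 + t3"
        unfolding split_sum_assoc[of "\<lambda>C D B. ?T C * (?T B * ?T (Y @ D @ Q))"] t2_def by simp
      finally show ?thesis using lhs by simp
    qed
  qed
qed

abbreviation descending :: "nat list \<Rightarrow> bool" where
  "descending \<equiv> sorted_wrt (>)"

text \<open>
  Bounding the factors of the recursion by Catalan numbers gives a part of the Catalan recursion, and
  the whole of it only if nothing precedes the largest element.
\<close>

lemma rooted_count_bound:
  assumes "distinct w"
  shows "rooted_count w \<le> cat (length w) \<and> (rooted_count w = cat (length w) \<longleftrightarrow> descending w)"
  using assms
proof (induction "length w" arbitrary: w rule: less_induct)
  case less
  let ?T = rooted_count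
  show ?case
  proof (cases "w = []")
    case False
    define Y n X where "Y = left_of_max w" and "n = Max (set w)" and "X = right_of_max w"
    have w: "w = Y @ n # X" unfolding Y_def n_def X_def by (rule max_split[OF False])
    have "\<forall>x\<in>set w. x \<le> n" by (simp add: n_def)
    then have lt: "\<forall>x\<in>set Y \<union> set X. x < n" using less.prems unfolding w by (auto simp: order.strict_iff_order)
    have IH: "?T v \<le> cat (length v)" "?T v = cat (length v) \<longleftrightarrow> descending v"
      if "length v < length w" "distinct v" for v using less.hyps[OF that] by auto
    have rec: "?T w = split_sum (\<lambda>A B. ?T A * ?T (Y @ B)) X"
      unfolding w by (rule rooted_count_at_max[OF lt])
    have le: "?T A * ?T (Y @ B) \<le> cat (length A) * cat (length Y + length B)" if "A @ B = X" for A B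
    proof (rule mult_le_mono)
      show "?T A \<le> cat (length A)" by (rule IH) (use that less.prems in \<open>auto simp: w\<close>)
      show "?T (Y @ B) \<le> cat (length Y + length B)"
        using IH(1)[of "Y @ B"] that less.prems by (auto simp: w Int_Un_distrib)
    qed
    let ?bound = "split_sum (\<lambda>A B. cat (length A) * cat (length Y + length B)) X"
    have bound: "?bound = (\<Sum>i\<le>length X. cat i * cat (length Y + (length X - i)))"
      by (rule split_sum_length)
    have all: "cat (length w) = (\<Sum>i\<le>length Y + length X. cat i * cat (length Y + length X - i))"
      by (simp add: w)
    have "(\<Sum>i\<le>length X. cat i * cat (length Y + (length X - i)))
        = (\<Sum>i\<le>length X. cat i * cat (length Y + length X - i))"
      by (intro sum.cong refl) simp
    also have "\<dots> \<le> (\<Sum>i\<le>length Y + length X. cat i * cat (length Y + length X - i))"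
      by (rule sum_mono2) auto
    finally have bound_le: "?bound \<le> cat (length w)" unfolding bound all .
    have Tle: "?T w \<le> ?bound" unfolding rec by (rule split_sum_mono[OF le])
    have "descending w" if eq: "?T w = cat (length w)"
    proof -
      have Y: "Y = []"
      proof (rule ccontr)
        assume "Y \<noteq> []"
        then have "(\<Sum>i\<le>length X. cat i * cat (length Y + length X - i)) < cat (length w)"
          unfolding all by (intro sum_strict_mono2[where b = "length Y + length X"]) auto
        moreover have "?bound = (\<Sum>i\<le>length X. cat i * cat (length Y + length X - i))"
          unfolding bound by (intro sum.cong refl) simp
        ultimately show False using Tle eq by simp
      qed
      have "descending X"
      proof (rule ccontr)
        assume "\<not> descending X"
        then have "?T X < cat (length X)" using IH[of X] less.prems by (auto simp: w)
        then have "?T w < ?bound" unfolding rec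
          by (intro split_sum_strict_mono le) (simp_all add: Y)
        then show False using bound_le eq by simp
      qed
      then show ?thesis using lt by (simp add: w Y)
    qed
    moreover have "?T w = cat (length w)" if "descending w"
    proof -
      have Y: "Y = []" using that lt unfolding w
        by (cases Y) (auto simp: sorted_wrt_append)
      have X: "descending X" using that by (simp add: w sorted_wrt_append)
      have "?T w = ?bound" unfolding rec
      proof (rule split_sum_cong)
        fix A B assume AB: "A @ B = X"
        then have "?T A = cat (length A)" "?T B = cat (length B)"
          using IH(2)[of A] IH(2)[of B] X less.prems by (auto simp: w sorted_wrt_append)
        then show "?T A * ?T (Y @ B) = cat (length A) * cat (length Y + length B)" by (simp add: Y)
      qed
      then have "?T w = (\<Sum>i\<le>length X. cat i * cat (length Y + (length X - i)))" by (simp only: bound)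
      then show ?thesis by (simp add: all Y)
    qed
    ultimately show ?thesis using Tle bound_le by linarith
  qed simp
qed

lemma rooted_count_le: "distinct w \<Longrightarrow> rooted_count w \<le> cat (length w)"
  and rooted_count_eq_iff: "distinct w \<Longrightarrow> rooted_count w = cat (length w) \<longleftrightarrow> descending w"
  using rooted_count_bound by auto

section \<open>Joining a cycle to a rooted word\<close>

text \<open>
  If the last transposition \<open>(n a\<^sub>n)\<close> merges the cycle \<open>(n X)\<close> with the cycle \<open>c\<close>, the result is the
  cycle \<open>(n X c')\<close> with \<open>n\<close> inactive, where \<open>c'\<close> is the rotation of \<open>c\<close> that starts at \<open>a\<^sub>n\<close>.
  \<open>attach_count X c\<close> counts the factorizations that arise in this way.
\<close>

definition attach_count :: "nat list \<Rightarrow> nat list \<Rightarrow> nat" where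
  "attach_count X c = (\<Sum>l<length c. rooted_count (X @ rotate l c))"

lemma attach_count_Nil [simp]: "attach_count X [] = 0"
  by (simp add: attach_count_def)

lemma attach_count_rotate1: "attach_count X (rotate1 c) = attach_count X c"
proof -
  let ?g = "\<lambda>l. rooted_count (X @ rotate l c)"
  have "attach_count X (rotate1 c) = (\<Sum>l<length c. ?g (Suc l))"
    by (simp add: attach_count_def rotate1_rotate_swap)
  moreover have "(\<Sum>l<Suc (length c). ?g l) = (\<Sum>l<length c. ?g l) + ?g 0" by simp
  moreover have "(\<Sum>l<Suc (length c). ?g l) = ?g 0 + (\<Sum>l<length c. ?g (Suc l))"
    by (rule sum.lessThan_Suc_shift)
  ultimately show ?thesis by (simp add: attach_count_def)
qed

lemma attach_count_rotate [simp]: "attach_count X (rotate k c) = attach_count X c"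
  by (induction k) (simp_all add: attach_count_rotate1)

text \<open>
  The rotations of \<open>c\<close> are the words \<open>B @ A\<close> with \<open>A @ B = c\<close>; the splittings at both ends give \<open>c\<close>
  itself.
\<close>

lemma attach_count_plus: "attach_count X c + rooted_count (X @ c) = split_sum (\<lambda>A B. rooted_count (X @ B @ A)) c"
  unfolding split_sum_eq_proper attach_count_def proper_split_sum_def
  by (simp add: rotate_drop_take)

lemma attach_count_Cons: "attach_count X (b # Z) = split_sum (\<lambda>Q Y. rooted_count (X @ Y @ b # Q)) Z"
  using attach_count_plus[of X "b # Z"] by simp

text \<open>
  Apply the recursion at the smallest element \<open>m\<close> to every rotation of the cycle. If the cut falls
  into the part of the cycle in front of \<open>m\<close>, collecting the rotations with the same removed part \<open>D\<close>
  reproduces \<open>attach_count\<close> for the remaining part \<open>W\<close> of the cycle, with one rotation counted twice.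
\<close>

lemma attach_count_at_min:
  assumes "distinct (X @ m # Z)" "\<forall>x\<in>set X \<union> set Z. m < x"
  shows "attach_count X (m # Z) =
    split_sum (\<lambda>W D. rooted_count D * (attach_count X W + rooted_count (X @ W))) Z +
    split_sum (\<lambda>Q Y. proper_split_sum (\<lambda>A B. rooted_count (B @ Y) * rooted_count (A @ Q)) X) Z"
proof -
  let ?T = rooted_count
  have "attach_count X (m # Z) = split_sum (\<lambda>Q Y. proper_split_sum (\<lambda>A B. ?T (B @ Y) * ?T (A @ Q)) X
      + split_sum (\<lambda>C D. ?T D * ?T (X @ C @ Q)) Y) Z"
    unfolding attach_count_Cons
  proof (rule split_sum_cong)
    fix Q Y assume QY: "Q @ Y = Z"
    have "?T (X @ Y @ m # Q) = ?T ((X @ Y) @ m # Q)" by simp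
    also have "\<dots> = split_sum (\<lambda>A B. ?T B * ?T (A @ Q)) (X @ Y)"
      by (rule rooted_count_at_min) (use assms QY in auto)
    finally show "?T (X @ Y @ m # Q) = proper_split_sum (\<lambda>A B. ?T (B @ Y) * ?T (A @ Q)) X
      + split_sum (\<lambda>C D. ?T D * ?T (X @ C @ Q)) Y"
      by (simp add: split_sum_append)
  qed
  also have "\<dots> = split_sum (\<lambda>Q Y. proper_split_sum (\<lambda>A B. ?T (B @ Y) * ?T (A @ Q)) X) Z
      + split_sum (\<lambda>W D. split_sum (\<lambda>Q C. ?T D * ?T (X @ C @ Q)) W) Z"
    by (simp add: split_sum_add split_sum_assoc[of "\<lambda>Q C D. ?T D * ?T (X @ C @ Q)"])
  finally show ?thesis by (simp add: attach_count_plus split_sum_mult_left)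
qed

text \<open>
  The recursion of \<open>attach_max\<close>, arranged like \<open>attach_count_at_min\<close> with all factors replaced by
  their bounds.
\<close>

lemma attach_max_split_sum:
  "attach_max (Suc (length X)) (Suc (length Z)) =
    split_sum (\<lambda>W D. cat (length D) * (attach_max (Suc (length X)) (length W) + cat (length X + length W))) Z +
    split_sum (\<lambda>Q Y. proper_split_sum (\<lambda>A B. cat (length B + length Y) * cat (length A + length Q)) X) Z"
proof -
  define k z where "k = length X" and "z = length Z"
  have 1: "split_sum (\<lambda>W D. cat (length D) * (attach_max (Suc (length X)) (length W) + cat (length X + length W))) Z
     = (\<Sum>i\<le>z. cat (z - i) * (attach_max (Suc k) i + cat (k + i)))"
    unfolding k_def z_def by (rule split_sum_length)
  have 2: "split_sum (\<lambda>Q Y. proper_split_sum (\<lambda>A B. cat (length B + length Y) * cat (length A + length Q)) X) Z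
     = (\<Sum>l\<le>z. \<Sum>i<k. cat (k - i + (z - l)) * cat (i + l))"
    unfolding k_def z_def
    by (subst proper_split_sum_length[where g = "\<lambda>a b. cat (b + length _) * cat (a + length _)"], rule split_sum_length)
  have "cat_rect (Suc k) (Suc z) = (\<Sum>i<Suc k. \<Sum>l\<le>z. cat (i + l) * cat (k + z - (i + l)))"
    by (simp add: cat_rect_def lessThan_Suc_atMost)
  also have "\<dots> = (\<Sum>i<k. \<Sum>l\<le>z. cat (k - i + (z - l)) * cat (i + l)) + (\<Sum>l\<le>z. cat (z - l) * cat (k + l))"
    by (simp, intro arg_cong2[where f = "(+)"] sum.cong refl) (auto simp: mult.commute algebra_simps)
  also have "(\<Sum>i<k. \<Sum>l\<le>z. cat (k - i + (z - l)) * cat (i + l)) = (\<Sum>l\<le>z. \<Sum>i<k. cat (k - i + (z - l)) * cat (i + l))"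
    by (rule sum.swap)
  finally have rect: "cat_rect (Suc k) (Suc z)
     = (\<Sum>l\<le>z. \<Sum>i<k. cat (k - i + (z - l)) * cat (i + l)) + (\<Sum>l\<le>z. cat (z - l) * cat (k + l))" .
  have "(\<Sum>t\<le>z. cat t * attach_max (Suc k) (z - t)) = (\<Sum>i\<le>z. cat (z - i) * attach_max (Suc k) i)"
    by (rule sum.reindex_bij_witness[of _ "\<lambda>i. z - i" "\<lambda>i. z - i"]) auto
  then show ?thesis
    unfolding 1 2 unfolding k_def[symmetric] z_def[symmetric] attach_max_Suc rect
    by (simp add: distrib_left sum.distrib)
qed

lemma rotate_Cons_cases: obtains A B where "X = A @ B" "rotate i (n # X) = B @ n # A"
proof -
  define j where "j = i mod Suc (length X)"
  have r: "rotate i (n # X) = drop j (n # X) @ take j (n # X)" by (simp add: rotate_drop_take j_def)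
  show thesis
  proof (cases j)
    case 0
    then show ?thesis using r that[of X "[]"] by simp
  next
    case (Suc j')
    then show ?thesis using r that[of "take j' X" "drop j' X"] by simp
  qed
qed

lemma ex_rotate_rotate: "(\<exists>i. P (rotate i (rotate k c))) \<longleftrightarrow> (\<exists>i. P (rotate i c))"
proof
  assume "\<exists>i. P (rotate i c)"
  then obtain i where i: "P (rotate i c)" ..
  \<comment> \<open>Rotating by \<open>(length c - 1) * k\<close> undoes the rotation by \<open>k\<close>.\<close>
  have "rotate (i + (length c - 1) * k) (rotate k c) = rotate (i + length c * k) c"
    by (cases c) (simp_all add: rotate_rotate algebra_simps)
  also have "\<dots> = rotate i c" by (metis mod_mult_self2 rotate_conv_mod)
  finally show "\<exists>i. P (rotate i (rotate k c))" using i by metis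
qed (auto simp: rotate_rotate)

text \<open>
  Split at the smallest element \<open>m\<close>. If \<open>m\<close> is in the cycle, which may then be rotated to \<open>m # Z\<close>,
  the recursion compares term by term with that of \<open>attach_max\<close>, and equality in the term for \<open>Z\<close>
  alone already forces \<open>X @ Z\<close> to be descending. If \<open>m\<close> is in the word, the recursion stays strictly
  below the bound by \<open>attach_max_strict\<close>; and indeed \<open>X\<close> followed by a rotation of \<open>c\<close> cannot be
  descending, because \<open>m\<close> is followed by larger elements.
\<close>

lemma attach_count_bound:
  assumes "distinct (X @ c)" "c \<noteq> []"
  shows "attach_count X c \<le> attach_max (Suc (length X)) (length c) \<and>
    (attach_count X c = attach_max (Suc (length X)) (length c) \<longleftrightarrow> (\<exists>i. descending (X @ rotate i c)))"
  using assms
proof (induction "length X + length c" arbitrary: X c rule: less_induct)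
  case less
  let ?T = rooted_count and ?F = attach_max
  define m where "m = Min (set (X @ c))"
  have m: "m \<in> set (X @ c)" "\<forall>x\<in>set (X @ c). m \<le> x"
    unfolding m_def using less.prems by (auto simp del: set_append intro: Min_in)
  show ?case
  proof (cases "m \<in> set c")
    case True
    then obtain P Q where c: "c = P @ m # Q" by (meson split_list)
    define Z where "Z = Q @ P"
    have rot: "rotate (length P) c = m # Z" by (simp add: c Z_def rotate_append)
    have len: "length c = Suc (length Z)" by (simp add: c Z_def)
    have dist: "distinct (X @ m # Z)" using less.prems by (auto simp: c Z_def)
    have lt: "\<forall>x\<in>set X \<union> set Z. m < x"
      using m dist by (auto simp: c Z_def order.strict_iff_order)
    have count: "attach_count X c = attach_count X (m # Z)"
      using attach_count_rotate[of X "length P" c] by (simp add: rot)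
    have desc: "(\<exists>i. descending (X @ rotate i c)) \<longleftrightarrow> descending (X @ Z)" (is "?L \<longleftrightarrow> ?R")
    proof
      assume ?L
      then obtain i where i: "descending (X @ rotate i (m # Z))"
        using ex_rotate_rotate[of "\<lambda>d. descending (X @ d)" "length P" c] by (auto simp: rot)
      obtain A B where AB: "Z = A @ B" "rotate i (m # Z) = B @ m # A" by (rule rotate_Cons_cases)
      then have "A = []" using i lt by (cases A) (auto simp: sorted_wrt_append)
      then show ?R using i AB by (simp add: sorted_wrt_append)
    next
      assume ?R
      then have "descending (X @ rotate 1 (m # Z))" using lt by (auto simp: sorted_wrt_append)
      then show ?L using ex_rotate_rotate[of "\<lambda>d. descending (X @ d)" "length P" c] unfolding rot by blast
    qed
    have IH: "attach_count X W \<le> ?F (Suc (length X)) (length W)"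
        "descending (X @ W) \<Longrightarrow> attach_count X W = ?F (Suc (length X)) (length W)"
      if "W @ D = Z" for W D
    proof -
      have "distinct (X @ W)" using that dist by auto
      moreover have "length W < length c" using that len by auto
      ultimately have "W \<noteq> [] \<Longrightarrow> attach_count X W \<le> ?F (Suc (length X)) (length W) \<and>
        (attach_count X W = ?F (Suc (length X)) (length W) \<longleftrightarrow> (\<exists>i. descending (X @ rotate i W)))"
        by (intro less.hyps) auto
      then show "attach_count X W \<le> ?F (Suc (length X)) (length W)"
        "descending (X @ W) \<Longrightarrow> attach_count X W = ?F (Suc (length X)) (length W)"
        by (cases "W = []"; force intro: exI[of _ 0])+
    qed
    have le1: "?T D * (attach_count X W + ?T (X @ W)) \<le> cat (length D) * (?F (Suc (length X)) (length W) + cat (length X + length W))"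
      if "W @ D = Z" for W D
      using rooted_count_le[of D] rooted_count_le[of "X @ W"] IH(1)[OF that] dist that
      by (intro mult_le_mono add_mono) (auto simp: Int_Un_distrib)
    have le2: "proper_split_sum (\<lambda>A B. ?T (B @ Y) * ?T (A @ Q)) X
        \<le> proper_split_sum (\<lambda>A B. cat (length B + length Y) * cat (length A + length Q)) X"
      if "Q @ Y = Z" for Q Y
    proof (intro proper_split_sum_mono mult_le_mono)
      fix A B assume "A @ B = X"
      then show "?T (B @ Y) \<le> cat (length B + length Y)" "?T (A @ Q) \<le> cat (length A + length Q)"
        using rooted_count_le[of "B @ Y"] rooted_count_le[of "A @ Q"] dist that by (auto simp: Int_Un_distrib Int_Un_distrib2)
    qed
    note rec = attach_count_at_min[OF dist lt] attach_max_split_sum[of X Z]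
    have "attach_count X c \<le> ?F (Suc (length X)) (length c)"
      unfolding count len rec by (intro add_mono split_sum_mono le1 le2)
    moreover have "attach_count X c = ?F (Suc (length X)) (length c)" if d: "descending (X @ Z)"
      unfolding count len rec
    proof (intro arg_cong2[where f = "(+)"] split_sum_cong proper_split_sum_cong)
      fix W D assume WD: "W @ D = Z"
      then have "descending D" "descending (X @ W)" using d by (auto simp: sorted_wrt_append)
      then show "?T D * (attach_count X W + ?T (X @ W)) = cat (length D) * (?F (Suc (length X)) (length W) + cat (length X + length W))"
        using rooted_count_eq_iff[of D] rooted_count_eq_iff[of "X @ W"] IH(2)[OF WD] dist WD by (auto simp: Int_Un_distrib)
    next
      fix Q Y A B assume QY: "Q @ Y = Z" and AB: "A @ B = X"
      then have "descending (B @ Y)" "descending (A @ Q)" using d by (auto simp: sorted_wrt_append)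
      then show "?T (B @ Y) * ?T (A @ Q) = cat (length B + length Y) * cat (length A + length Q)"
        using rooted_count_eq_iff[of "B @ Y"] rooted_count_eq_iff[of "A @ Q"] dist QY AB by (auto simp: Int_Un_distrib Int_Un_distrib2)
    qed
    moreover have "attach_count X c < ?F (Suc (length X)) (length c)" if d: "\<not> descending (X @ Z)"
      unfolding count len rec
    proof (intro add_less_le_mono split_sum_strict_mono split_sum_mono le1 le2)
      have "?T (X @ Z) < cat (length X + length Z)"
        using rooted_count_le[of "X @ Z"] rooted_count_eq_iff[of "X @ Z"] d dist by auto
      then show "?T [] * (attach_count X Z + ?T (X @ Z))
        < cat (length ([]::nat list)) * (?F (Suc (length X)) (length Z) + cat (length X + length Z))"
        using IH(1)[of Z "[]"] by simp
    qed
    ultimately show ?thesis unfolding desc by fastforce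
  next
    case False
    then have "m \<in> set X" using m by auto
    then obtain P Q where X: "X = P @ m # Q" by (meson split_list)
    have lt: "\<forall>x\<in>set P \<union> set Q \<union> set c. m < x"
      using m less.prems by (auto simp: X order.strict_iff_order)
    have "attach_count X c = (\<Sum>l<length c. split_sum (\<lambda>A B. ?T B * ?T (A @ Q @ rotate l c)) P)"
      unfolding attach_count_def
    proof (intro sum.cong refl)
      fix l
      have "?T (X @ rotate l c) = ?T (P @ m # (Q @ rotate l c))" by (simp add: X)
      also have "\<dots> = split_sum (\<lambda>A B. ?T B * ?T (A @ Q @ rotate l c)) P"
        by (rule rooted_count_at_min) (use lt less.prems in \<open>auto simp: X\<close>)
      finally show "?T (X @ rotate l c) = \<dots>" .
    qed
    also have "\<dots> = split_sum (\<lambda>A B. ?T B * attach_count (A @ Q) c) P"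
      unfolding split_sum_def attach_count_def sum_distrib_left by (subst sum.swap) simp
    also have "\<dots> \<le> split_sum (\<lambda>A B. cat (length B) * ?F (Suc (length A + length Q)) (length c)) P"
    proof (intro split_sum_mono mult_le_mono)
      fix A B assume AB: "A @ B = P"
      show "?T B \<le> cat (length B)" using rooted_count_le[of B] less.prems AB by (auto simp: X)
      have "attach_count (A @ Q) c \<le> ?F (Suc (length (A @ Q))) (length c)"
        using less.hyps[of "A @ Q" c] less.prems AB by (auto simp: X Int_Un_distrib Int_Un_distrib2)
      then show "attach_count (A @ Q) c \<le> ?F (Suc (length A + length Q)) (length c)" by simp
    qed
    also have "\<dots> = (\<Sum>i\<le>length P. cat (length P - i) * ?F (Suc (i + length Q)) (length c))"
      by (rule split_sum_length)
    also have "\<dots> = (\<Sum>i\<le>length P. cat i * ?F (length X - i) (length c))"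
      by (rule sum.reindex_bij_witness[of _ "\<lambda>i. length P - i" "\<lambda>i. length P - i"]) (auto simp: X algebra_simps Suc_diff_le)
    also have "\<dots> \<le> (\<Sum>i<length X. cat i * ?F (length X - i) (length c))"
      by (rule sum_mono2) (auto simp: X)
    also have "\<dots> < ?F (Suc (length X)) (length c)"
      by (rule attach_max_strict) (use less.prems in simp)
    finally have "attach_count X c < ?F (Suc (length X)) (length c)" .
    moreover have "\<not> descending (X @ rotate i c)" for i
    proof
      assume "descending (X @ rotate i c)"
      then have "\<forall>x\<in>set c. x < m" by (auto simp: X sorted_wrt_append)
      moreover obtain x where "x \<in> set c" using less.prems by (cases c) auto
      ultimately have "x < m" "m < x" using lt by auto
      then show False by simp
    qed
    ultimately show ?thesis by simp
  qed
qed

section \<open>Single cycles and linked pairs of cycles\<close>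

text \<open>
  \<open>cycle_count c\<close> is the number of ways to write the cycle \<open>c\<close> as a product of transpositions
  \<open>(x a\<^sub>x)\<close>, one for every \<open>x\<close> in \<open>c\<close>. Rotate \<open>c\<close> to \<open>n # X\<close> with \<open>n\<close> the largest element. The last
  factor cuts \<open>c\<close> into \<open>(n A)\<close>, where \<open>n\<close> is now inactive, and \<open>B\<close> with \<open>X = A @ B\<close>; the case
  \<open>B = []\<close> belongs to \<open>a\<^sub>n = n\<close>.
\<close>

function cycle_count :: "nat list \<Rightarrow> nat" where
  "cycle_count c = (if c = [] then 1 else
     (let X = right_of_max c @ left_of_max c in
       \<Sum>i\<in>{..length X}. rooted_count (take i X) * cycle_count (drop i X)))"
  by auto
termination
  by (relation "measure length") (use length_max_split in \<open>fastforce+\<close>)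

declare cycle_count.simps [simp del]

lemma cycle_count_Nil [simp]: "cycle_count [] = 1"
  by (simp add: cycle_count.simps)

lemma cycle_count_at_max:
  assumes "\<forall>x\<in>set P \<union> set Q. x < n"
  shows "cycle_count (P @ n # Q) = split_sum (\<lambda>A B. rooted_count A * cycle_count B) (Q @ P)"
  by (subst cycle_count.simps) (simp add: max_split_unique[OF assms] split_sum_def Let_def)

text \<open>
  Term by term below the Catalan recursion; equality in the term \<open>B = []\<close> forces the rest \<open>X\<close> of the
  cycle after its largest element to be descending.
\<close>

lemma cycle_count_bound:
  assumes "distinct c"
  shows "cycle_count c \<le> cat (length c) \<and> (cycle_count c = cat (length c) \<longleftrightarrow> (\<exists>i. descending (rotate i c)))"
  using assms
proof (induction "length c" arbitrary: c rule: less_induct)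
  case less
  show ?case
  proof (cases "c = []")
    case False
    define P n Q where "P = left_of_max c" and "n = Max (set c)" and "Q = right_of_max c"
    define X where "X = Q @ P"
    have c: "c = P @ n # Q" unfolding P_def n_def Q_def by (rule max_split[OF False])
    have "\<forall>x\<in>set c. x \<le> n" by (simp add: n_def)
    then have lt: "\<forall>x\<in>set P \<union> set Q. x < n" using less.prems unfolding c by (auto simp: order.strict_iff_order)
    have len: "length c = Suc (length X)" by (simp add: c X_def)
    have dist: "distinct X" using less.prems by (auto simp: c X_def)
    have ltX: "\<forall>x\<in>set X. x < n" using lt by (auto simp: X_def)
    have rot: "rotate (length P) c = n # X" by (simp add: c X_def rotate_append)
    have desc: "(\<exists>i. descending (rotate i c)) \<longleftrightarrow> descending X" (is "?L \<longleftrightarrow> ?R")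
    proof
      assume ?L
      then obtain i where i: "descending (rotate i (n # X))"
        using ex_rotate_rotate[of descending "length P" c] by (auto simp: rot)
      obtain A B where AB: "X = A @ B" "rotate i (n # X) = B @ n # A" by (rule rotate_Cons_cases)
      have "B = []"
      proof (rule ccontr)
        assume "B \<noteq> []"
        then obtain x where "x \<in> set B" by (cases B) auto
        then have "x < n" "n < x" using i AB ltX by (auto simp: sorted_wrt_append)
        then show False by simp
      qed
      then show ?R using i AB by simp
    next
      assume ?R
      then have "descending (rotate (length P) c)" using lt by (auto simp: rot X_def)
      then show ?L ..
    qed
    have rec: "cycle_count c = split_sum (\<lambda>A B. rooted_count A * cycle_count B) X"
      unfolding c X_def by (rule cycle_count_at_max[OF lt])
    have bound: "cat (length c) = split_sum (\<lambda>A B. cat (length A) * cat (length B)) X"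
      unfolding len cat.simps by (simp add: split_sum_length[where g = "\<lambda>a b. cat a * cat b"])
    have IH: "cycle_count B \<le> cat (length B)" "descending B \<Longrightarrow> cycle_count B = cat (length B)"
      if "A @ B = X" for A B
    proof -
      have "length B < length c" "distinct B" using that dist len by auto
      note hyp = less.hyps[OF this]
      show "cycle_count B \<le> cat (length B)" using hyp by blast
      show "cycle_count B = cat (length B)" if "descending B"
        using hyp that by (metis rotate0 id_apply)
    qed
    have le: "rooted_count A * cycle_count B \<le> cat (length A) * cat (length B)" if "A @ B = X" for A B
      using that dist by (intro mult_le_mono rooted_count_le IH[OF that]) auto
    have "cycle_count c \<le> cat (length c)" unfolding rec bound by (rule split_sum_mono[OF le])
    moreover have "cycle_count c = cat (length c)" if d: "descending X"
      unfolding rec bound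
    proof (rule split_sum_cong)
      fix A B assume AB: "A @ B = X"
      then have "descending A" "descending B" "distinct A" using d dist by (auto simp: sorted_wrt_append)
      then show "rooted_count A * cycle_count B = cat (length A) * cat (length B)"
        using IH(2)[OF AB] rooted_count_eq_iff by simp
    qed
    moreover have "cycle_count c < cat (length c)" if d: "\<not> descending X"
      unfolding rec bound
    proof (rule split_sum_strict_mono[OF le])
      have "rooted_count X < cat (length X)"
        using rooted_count_le[OF dist] rooted_count_eq_iff[OF dist] d by linarith
      then show "rooted_count X * cycle_count [] < cat (length X) * cat (length ([]::nat list))" by simp
    qed
    ultimately show ?thesis unfolding desc by fastforce
  qed simp
qed

text \<open>
  \<open>pair_count c d\<close> counts the factorizations of the product of the disjoint cycles \<open>c\<close> and \<open>d\<close> into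
  transpositions \<open>(x a\<^sub>x)\<close>, one for every element \<open>x\<close>, that link the two cycles. Let the largest
  element \<open>n\<close> be in \<open>c\<close>, rotated to \<open>n # X\<close>. Either the last factor merges \<open>c\<close> with \<open>d\<close>, or it
  cuts \<open>c\<close> into \<open>(n A)\<close> and a nonempty \<open>B\<close> that is still to be linked with \<open>d\<close>.
\<close>

function pair_count :: "nat list \<Rightarrow> nat list \<Rightarrow> nat" where
  "pair_count c d = (if c = [] \<or> d = [] then 0
     else if Max (set d) < Max (set c) then
       (let X = right_of_max c @ left_of_max c in
         attach_count X d + (\<Sum>i\<in>{..<length X}. rooted_count (take i X) * pair_count (drop i X) d))
     else
       (let X = right_of_max d @ left_of_max d in
         attach_count X c + (\<Sum>i\<in>{..<length X}. rooted_count (take i X) * pair_count c (drop i X))))"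
  by auto
termination
  by (relation "measure (\<lambda>(c, d). length c + length d)") (use length_max_split in \<open>fastforce+\<close>)

declare pair_count.simps [simp del]

lemma pair_count_Nil [simp]: "pair_count [] d = 0" "pair_count c [] = 0"
  by (subst pair_count.simps, simp)+

lemma pair_count_at_max:
  assumes "\<forall>x\<in>set P \<union> set Q \<union> set d. x < n" "d \<noteq> []"
  shows "pair_count (P @ n # Q) d = attach_count (Q @ P) d +
      proper_split_sum (\<lambda>A B. rooted_count A * pair_count B d) (Q @ P)" (is ?a)
    and "pair_count d (P @ n # Q) = attach_count (Q @ P) d +
      proper_split_sum (\<lambda>A B. rooted_count A * pair_count d B) (Q @ P)" (is ?b)
proof -
  have lt: "\<forall>x\<in>set P \<union> set Q. x < n" using assms by auto
  have M: "Max (set d) < n" using assms by auto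
  then have nM: "\<not> n < Max (set d)" by linarith
  show ?a using assms M nM
    by (subst pair_count.simps) (simp add: max_split_unique[OF lt] proper_split_sum_def Let_def
        del: set_append Max_less_iff Max_gr_iff)
  show ?b using assms M nM
    by (subst pair_count.simps) (simp add: max_split_unique[OF lt] proper_split_sum_def Let_def
        del: set_append Max_less_iff Max_gr_iff)
qed

lemma Max_cases_disjoint:
  fixes c d :: "nat list"
  assumes "distinct (c @ d)" "c \<noteq> []" "d \<noteq> []"
  obtains (left) P n Q where "c = P @ n # Q" "\<forall>x\<in>set P \<union> set Q \<union> set d. x < n"
  | (right) P n Q where "d = P @ n # Q" "\<forall>x\<in>set P \<union> set Q \<union> set c. x < n"
proof -
  define n where "n = Max (set (c @ d))"
  have n: "n \<in> set (c @ d)" "\<forall>x\<in>set (c @ d). x \<le> n"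
    unfolding n_def using assms by (auto simp del: set_append intro: Max_in)
  show thesis
  proof (cases "n \<in> set c")
    case True
    then obtain P Q where c: "c = P @ n # Q" by (meson split_list)
    show thesis by (rule left[OF c]) (use n assms in \<open>auto simp: c order.strict_iff_order\<close>)
  next
    case False
    then have "n \<in> set d" using n by auto
    then obtain P Q where d: "d = P @ n # Q" by (meson split_list)
    show thesis by (rule right[OF d]) (use n assms in \<open>auto simp: d order.strict_iff_order\<close>)
  qed
qed

lemma pair_count_commute:
  assumes "distinct (c @ d)"
  shows "pair_count c d = pair_count d c"
  using assms
proof (induction "length c + length d" arbitrary: c d rule: less_induct)
  case less
  show ?case
  proof (cases "c = [] \<or> d = []")
    case True
    then show ?thesis by auto
  next
    case False
    then have ne: "c \<noteq> []" "d \<noteq> []" by auto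
    from less.prems ne show ?thesis
    proof (cases rule: Max_cases_disjoint)
      case (left P n Q)
      have "proper_split_sum (\<lambda>A B. rooted_count A * pair_count B d) (Q @ P)
          = proper_split_sum (\<lambda>A B. rooted_count A * pair_count d B) (Q @ P)"
      proof (rule proper_split_sum_cong)
        fix A B assume AB: "A @ B = Q @ P"
        have "set (Q @ P) = set (A @ B)" "distinct (Q @ P) = distinct (A @ B)"
          "length (Q @ P) = length (A @ B)" by (simp_all only: AB)
        then have "pair_count B d = pair_count d B"
          by (intro less.hyps) (use less.prems left in auto)
        then show "rooted_count A * pair_count B d = rooted_count A * pair_count d B" by simp
      qed
      then show ?thesis unfolding left(1)
        using pair_count_at_max[OF left(2) ne(2)] by simp
    next
      case (right P n Q)
      have "proper_split_sum (\<lambda>A B. rooted_count A * pair_count c B) (Q @ P)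
          = proper_split_sum (\<lambda>A B. rooted_count A * pair_count B c) (Q @ P)"
      proof (rule proper_split_sum_cong)
        fix A B assume AB: "A @ B = Q @ P"
        have "set (Q @ P) = set (A @ B)" "distinct (Q @ P) = distinct (A @ B)"
          "length (Q @ P) = length (A @ B)" by (simp_all only: AB)
        then have "pair_count c B = pair_count B c"
          by (intro less.hyps) (use less.prems right in auto)
        then show "rooted_count A * pair_count c B = rooted_count A * pair_count B c" by simp
      qed
      then show ?thesis unfolding right(1)
        using pair_count_at_max[OF right(2) ne(1)] by simp
    qed
  qed
qed

definition stacked :: "nat list \<Rightarrow> nat list \<Rightarrow> bool" where
  "stacked c d \<longleftrightarrow> (\<exists>i j. descending (rotate i c @ rotate j d))"

text \<open>
  The recursion of \<open>pair_max\<close> is that of \<open>pair_count\<close> with all factors replaced by their bounds.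
  Equality forces equality for \<open>attach_count X d\<close>, and thereby already determines both cycles, since
  \<open>n\<close> exceeds all other elements.
\<close>

lemma pair_count_bound_left:
  assumes c: "c = P @ n # Q" and lt: "\<forall>x\<in>set P \<union> set Q \<union> set d. x < n" and d: "d \<noteq> []"
    and dist: "distinct (c @ d)"
    and IH: "\<And>b. length b < length c \<Longrightarrow> distinct (b @ d) \<Longrightarrow> b \<noteq> [] \<Longrightarrow>
       pair_count b d \<le> pair_max (length b) (length d) \<and>
       (pair_count b d = pair_max (length b) (length d) \<longleftrightarrow> stacked b d \<or> stacked d b)"
  shows "pair_count c d \<le> pair_max (length c) (length d) \<and>
       (pair_count c d = pair_max (length c) (length d) \<longleftrightarrow> stacked c d \<or> stacked d c)"
proof -
  define X where "X = Q @ P"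
  have len: "length c = Suc (length X)" by (simp add: c X_def)
  have distX: "distinct (X @ d)" using dist by (auto simp: c X_def)
  have ltX: "\<forall>x\<in>set X. x < n" using lt by (auto simp: X_def)
  have rot: "rotate (length P) c = n # X" by (simp add: c X_def rotate_append)
  have not_stacked: "\<not> stacked d c"
  proof
    assume "stacked d c"
    then obtain i j where "descending (rotate i d @ rotate j c)" by (auto simp: stacked_def)
    then have "\<forall>x\<in>set d. n < x" by (auto simp: sorted_wrt_append c)
    moreover obtain x where "x \<in> set d" using d by (cases d) auto
    ultimately have "n < x" "x < n" using lt by auto
    then show False by simp
  qed
  have stacked: "stacked c d \<longleftrightarrow> (\<exists>j. descending (X @ rotate j d))" (is "?L \<longleftrightarrow> ?R")
  proof
    assume ?L
    then obtain i j where i: "descending (rotate i (n # X) @ rotate j d)"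
      using ex_rotate_rotate[of "\<lambda>e. \<exists>j. descending (e @ rotate j d)" "length P" c]
      by (auto simp: rot stacked_def)
    obtain A B where AB: "X = A @ B" "rotate i (n # X) = B @ n # A" by (rule rotate_Cons_cases)
    have "B = []"
    proof (rule ccontr)
      assume "B \<noteq> []"
      then obtain x where "x \<in> set B" by (cases B) auto
      then have "x < n" "n < x" using i AB ltX by (auto simp: sorted_wrt_append)
      then show False by simp
    qed
    then show ?R using i AB by auto
  next
    assume ?R
    then obtain j where "descending (X @ rotate j d)" ..
    then have "descending (rotate (length P) c @ rotate j d)" using lt by (auto simp: rot X_def)
    then show ?L unfolding stacked_def by blast
  qed
  have rec: "pair_count c d = attach_count X d + proper_split_sum (\<lambda>A B. rooted_count A * pair_count B d) X"
    unfolding c X_def by (rule pair_count_at_max(1)[OF lt d])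
  have bound: "pair_max (length c) (length d) = attach_max (Suc (length X)) (length d) +
      proper_split_sum (\<lambda>A B. cat (length A) * pair_max (length B) (length d)) X"
    unfolding len pair_max_Suc
    by (simp add: proper_split_sum_length[where g = "\<lambda>a b. cat a * pair_max b (length d)"])
  have IH': "pair_count B d \<le> pair_max (length B) (length d)"
      "stacked B d \<Longrightarrow> pair_count B d = pair_max (length B) (length d)"
    if "A @ B = X" "B \<noteq> []" for A B
    using IH[of B] that distX len by (auto simp: Int_Un_distrib2)
  have le: "proper_split_sum (\<lambda>A B. rooted_count A * pair_count B d) X
      \<le> proper_split_sum (\<lambda>A B. cat (length A) * pair_max (length B) (length d)) X"
    using distX by (intro proper_split_sum_mono mult_le_mono rooted_count_le IH') auto
  note attach = attach_count_bound[OF distX d]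
  have "pair_count c d = pair_max (length c) (length d)" if sep: "stacked c d"
  proof -
    obtain j where j: "descending (X @ rotate j d)" using sep stacked by blast
    then have "attach_count X d = attach_max (Suc (length X)) (length d)" using attach by blast
    moreover have "proper_split_sum (\<lambda>A B. rooted_count A * pair_count B d) X
      = proper_split_sum (\<lambda>A B. cat (length A) * pair_max (length B) (length d)) X"
    proof (rule proper_split_sum_cong)
      fix A B assume AB: "A @ B = X" "B \<noteq> []"
      then have "descending A" "descending (rotate 0 B @ rotate j d)" "distinct A"
        using j distX by (auto simp: sorted_wrt_append)
      then show "rooted_count A * pair_count B d = cat (length A) * pair_max (length B) (length d)"
        using IH'(2)[OF AB] rooted_count_eq_iff unfolding stacked_def by metis
    qed
    ultimately show ?thesis unfolding rec bound by simp
  qed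
  moreover have "stacked c d" if "pair_count c d = pair_max (length c) (length d)"
  proof -
    have "attach_count X d = attach_max (Suc (length X)) (length d)"
      using that le attach unfolding rec bound by linarith
    then show ?thesis using attach stacked by blast
  qed
  moreover have "pair_count c d \<le> pair_max (length c) (length d)"
    unfolding rec bound using le attach by linarith
  ultimately show ?thesis using not_stacked by blast
qed

lemma pair_count_bound:
  assumes "distinct (c @ d)" "c \<noteq> []" "d \<noteq> []"
  shows "pair_count c d \<le> pair_max (length c) (length d) \<and>
       (pair_count c d = pair_max (length c) (length d) \<longleftrightarrow> stacked c d \<or> stacked d c)"
  using assms
proof (induction "length c + length d" arbitrary: c d rule: less_induct)
  case less
  from less.prems show ?case
  proof (cases rule: Max_cases_disjoint)
    case (left P n Q)
    show ?thesis
      by (rule pair_count_bound_left[OF left less.prems(3,1)]) (intro less.hyps, use less.prems in auto)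
  next
    case (right P n Q)
    have "pair_count d c \<le> pair_max (length d) (length c) \<and>
       (pair_count d c = pair_max (length d) (length c) \<longleftrightarrow> stacked d c \<or> stacked c d)"
    proof (rule pair_count_bound_left[OF right less.prems(2)])
      show "distinct (d @ c)" using less.prems by auto
      fix b assume b: "length b < length d" "distinct (b @ c)" "b \<noteq> []"
      then show "pair_count b c \<le> pair_max (length b) (length c) \<and>
          (pair_count b c = pair_max (length b) (length c) \<longleftrightarrow> stacked b c \<or> stacked c b)"
        by (intro less.hyps) (use less.prems in auto)
    qed
    then show ?thesis
      using pair_count_commute[OF less.prems(1)] pair_max_commute[of "length c" "length d"] by auto
  qed
qed

section \<open>Sums over involutions\<close>

text \<open>
  The sum over involutions is kept generic in its weights: with \<open>cycle_count\<close> and \<open>pair_count\<close> it is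
  a multiplicity, with the extremal values it is the bound.
\<close>

definition involution_sum :: "'a::linorder set \<Rightarrow> ('a \<Rightarrow> 'b) \<Rightarrow> ('a \<Rightarrow> 'a \<Rightarrow> 'b) \<Rightarrow> 'b::comm_semiring_1" where
  "involution_sum I f g = (\<Sum>\<chi>\<in>involutions I.
     (\<Prod>i\<in>{i\<in>I. \<chi> i = i}. f i) * (\<Prod>(i, j)\<in>{(i, j)\<in>I \<times> I. i < j \<and> \<chi> i = j}. g i j))"

lemma finite_involutions: "finite I \<Longrightarrow> finite (involutions I)"
  unfolding involutions_def by (rule finite_subset[OF _ finite_PiE[of I "\<lambda>_. I"]]) auto

lemma involution_sum_empty [simp]:
  fixes f :: "'a::linorder \<Rightarrow> 'b::comm_semiring_1"
  shows "involution_sum {} f g = 1"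
proof -
  have "involutions ({} :: 'a set) = {\<lambda>_. undefined}" by (auto simp: involutions_def)
  then show ?thesis by (simp add: involution_sum_def)
qed

lemma involution_sum_cong:
  assumes "\<And>i. i \<in> I \<Longrightarrow> f i = f' i" "\<And>i j. i \<in> I \<Longrightarrow> j \<in> I \<Longrightarrow> i \<noteq> j \<Longrightarrow> g i j = g' i j"
  shows "involution_sum I f g = involution_sum I f' g'"
  unfolding involution_sum_def
  by (intro sum.cong refl arg_cong2[where f = "(*)"] prod.cong) (use assms in auto)

text \<open>
  Sort the involutions by the image \<open>j\<close> of \<open>a\<close>. Symmetry of \<open>g\<close> makes it irrelevant which of \<open>a\<close>
  and \<open>j\<close> is the smaller one. The values of an involution outside its domain are \<open>undefined\<close>, so
  restricting it means resetting \<open>a\<close> and \<open>j\<close> to \<open>undefined\<close>.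
\<close>

lemma involution_sum_insert:
  fixes f :: "'a::linorder \<Rightarrow> 'b::comm_semiring_1"
  assumes I: "finite I" "a \<in> I" and sym: "\<And>i j. i \<in> I \<Longrightarrow> j \<in> I \<Longrightarrow> g i j = g j i"
  shows "involution_sum I f g = f a * involution_sum (I - {a}) f g
     + (\<Sum>j\<in>I - {a}. g a j * involution_sum (I - {a, j}) f g)"
proof -
  define F where "F J \<chi> = (\<Prod>i\<in>{i\<in>J. \<chi> i = i}. f i) * (\<Prod>(i, j)\<in>{(i, j)\<in>J \<times> J. i < j \<and> \<chi> i = j}. g i j)" for J \<chi>
  have Z: "involution_sum J f g = (\<Sum>\<chi>\<in>involutions J. F J \<chi>)" for J
    by (simp add: involution_sum_def F_def)
  have "involution_sum I f g = (\<Sum>j\<in>I. \<Sum>\<chi>\<in>{\<chi>\<in>involutions I. \<chi> a = j}. F I \<chi>)"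
    unfolding Z using I finite_involutions[OF I(1)]
    by (intro sum.group[symmetric]) (auto simp: involutions_def)
  also have "\<dots> = (\<Sum>\<chi>\<in>{\<chi>\<in>involutions I. \<chi> a = a}. F I \<chi>) + (\<Sum>j\<in>I-{a}. \<Sum>\<chi>\<in>{\<chi>\<in>involutions I. \<chi> a = j}. F I \<chi>)"
    by (rule sum.remove[OF I])
  also have "(\<Sum>\<chi>\<in>{\<chi>\<in>involutions I. \<chi> a = a}. F I \<chi>) = (\<Sum>\<chi>\<in>involutions (I - {a}). f a * F (I - {a}) \<chi>)"
  proof (rule sum.reindex_bij_witness[of _ "\<lambda>\<chi>. \<chi>(a := a)" "\<lambda>\<chi>. \<chi>(a := undefined)"])
    fix \<chi> assume "\<chi> \<in> {\<chi> \<in> involutions I. \<chi> a = a}"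
    then have \<chi>: "\<chi> \<in> I \<rightarrow>\<^sub>E I" "\<And>x. x \<in> I \<Longrightarrow> \<chi> (\<chi> x) = x" "\<chi> a = a" by (auto simp: involutions_def)
    have ne: "\<chi> x \<noteq> a" if "x \<in> I" "x \<noteq> a" for x using \<chi>(2)[OF that(1)] \<chi>(3) that(2) by metis
    show "(\<chi>(a := undefined))(a := a) = \<chi>" using \<chi> by auto
    show "\<chi>(a := undefined) \<in> involutions (I - {a})"
      unfolding involutions_def using \<chi> ne by (auto simp: PiE_iff extensional_def)
    have "{i \<in> I. \<chi> i = i} = insert a {i \<in> I - {a}. (\<chi>(a := undefined)) i = i}" using \<chi> I by auto
    moreover have "{(i, j) \<in> I \<times> I. i < j \<and> \<chi> i = j}
       = {(i, j) \<in> (I - {a}) \<times> (I - {a}). i < j \<and> (\<chi>(a := undefined)) i = j}" using \<chi> ne by auto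
    ultimately show "f a * F (I - {a}) (\<chi>(a := undefined)) = F I \<chi>"
      unfolding F_def using I by (simp add: mult_ac)
  next
    fix \<chi> assume "\<chi> \<in> involutions (I - {a})"
    then have \<chi>: "\<chi> \<in> (I - {a}) \<rightarrow>\<^sub>E (I - {a})" "\<And>x. x \<in> I - {a} \<Longrightarrow> \<chi> (\<chi> x) = x" by (auto simp: involutions_def)
    show "(\<chi>(a := a))(a := undefined) = \<chi>" using \<chi>(1) by (auto simp: PiE_iff extensional_def)
    show "\<chi>(a := a) \<in> {\<chi> \<in> involutions I. \<chi> a = a}"
      unfolding involutions_def using \<chi> I by (auto simp: PiE_iff extensional_def)
  qed
  also have "\<dots> = f a * involution_sum (I - {a}) f g" by (simp add: Z sum_distrib_left)
  also have "(\<Sum>j\<in>I-{a}. \<Sum>\<chi>\<in>{\<chi>\<in>involutions I. \<chi> a = j}. F I \<chi>) = (\<Sum>j\<in>I - {a}. g a j * involution_sum (I - {a, j}) f g)"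
  proof (rule sum.cong[OF refl])
    fix b assume b: "b \<in> I - {a}"
    have "(\<Sum>\<chi>\<in>{\<chi>\<in>involutions I. \<chi> a = b}. F I \<chi>) = (\<Sum>\<chi>\<in>involutions (I - {a, b}). g a b * F (I - {a, b}) \<chi>)"
    proof (rule sum.reindex_bij_witness[of _ "\<lambda>\<chi>. \<chi>(a := b, b := a)" "\<lambda>\<chi>. \<chi>(a := undefined, b := undefined)"])
      fix \<chi> assume "\<chi> \<in> {\<chi> \<in> involutions I. \<chi> a = b}"
      then have \<chi>: "\<chi> \<in> I \<rightarrow>\<^sub>E I" "\<And>x. x \<in> I \<Longrightarrow> \<chi> (\<chi> x) = x" "\<chi> a = b" by (auto simp: involutions_def)
      have ba: "\<chi> b = a" using \<chi> I by metis
      have ne: "\<chi> x \<noteq> a" "\<chi> x \<noteq> b" if "x \<in> I" "x \<noteq> a" "x \<noteq> b" for x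
        using \<chi>(2)[OF that(1)] \<chi>(3) ba that by metis+
      define \<psi> where "\<psi> = \<chi>(a := undefined, b := undefined)"
      have \<psi>: "\<psi> x = \<chi> x" if "x \<noteq> a" "x \<noteq> b" for x using that by (simp add: \<psi>_def)
      show "(\<chi>(a := undefined, b := undefined))(a := b, b := a) = \<chi>" using \<chi> ba by auto
      show "\<chi>(a := undefined, b := undefined) \<in> involutions (I - {a, b})"
        unfolding involutions_def using \<chi> ne by (auto simp: PiE_iff extensional_def)
      have fixed: "{i \<in> I. \<chi> i = i} = {i \<in> I - {a, b}. \<psi> i = i}"
      proof (rule set_eqI)
        fix i
        have "\<chi> a \<noteq> a" "\<chi> b \<noteq> b" using \<chi>(3) ba b by auto
        then show "i \<in> {i \<in> I. \<chi> i = i} \<longleftrightarrow> i \<in> {i \<in> I - {a, b}. \<psi> i = i}"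
          by (cases "i = a \<or> i = b") (auto simp: \<psi>)
      qed
      define S where "S = {(i, j) \<in> (I - {a, b}) \<times> (I - {a, b}). i < j \<and> \<psi> i = j}"
      have pairs: "{(i, j) \<in> I \<times> I. i < j \<and> \<chi> i = j} = insert (min a b, max a b) S"
      proof (intro set_eqI)
        fix p :: "'a \<times> 'a"
        obtain i j where p: "p = (i, j)" by fastforce
        show "p \<in> {(i, j) \<in> I \<times> I. i < j \<and> \<chi> i = j} \<longleftrightarrow> p \<in> insert (min a b, max a b) S"
          unfolding p S_def using \<chi>(1,3) ba b I ne[of i] \<psi>[of i] \<psi>[of j]
          by (cases "i = a"; cases "i = b"; auto simp: min_def max_def PiE_iff)
      qed
      have "(min a b, max a b) \<notin> S" "finite S"
        using finite_subset[of S "I \<times> I"] I by (auto simp: S_def min_def)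
      then have "(\<Prod>(i, j)\<in>insert (min a b, max a b) S. g i j) = g a b * (\<Prod>(i, j)\<in>S. g i j)"
        using sym[of a b] b I by (auto simp: min_def max_def)
      then have "F I \<chi> = g a b * F (I - {a, b}) \<psi>"
        unfolding F_def pairs fixed S_def[symmetric] by (simp add: mult_ac)
      then show "g a b * F (I - {a, b}) (\<chi>(a := undefined, b := undefined)) = F I \<chi>" by (simp add: \<psi>_def)
    next
      fix \<chi> assume "\<chi> \<in> involutions (I - {a, b})"
      then have \<chi>: "\<chi> \<in> (I - {a, b}) \<rightarrow>\<^sub>E (I - {a, b})" "\<And>x. x \<in> I - {a, b} \<Longrightarrow> \<chi> (\<chi> x) = x" by (auto simp: involutions_def)
      have out: "\<chi> a = undefined" "\<chi> b = undefined" using \<chi>(1) by (auto simp: PiE_iff extensional_def)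
      show "(\<chi>(a := b, b := a))(a := undefined, b := undefined) = \<chi>" using out by auto
      have "\<chi> x \<noteq> a \<and> \<chi> x \<noteq> b \<and> \<chi> x \<in> I" if "x \<in> I" "x \<noteq> a" "x \<noteq> b" for x
        using \<chi>(1) that by (auto simp: PiE_iff)
      then show "\<chi>(a := b, b := a) \<in> {\<chi> \<in> involutions I. \<chi> a = b}"
        unfolding involutions_def using \<chi> I b by (auto simp: PiE_iff extensional_def)
    qed
    then show "(\<Sum>\<chi>\<in>{\<chi>\<in>involutions I. \<chi> a = b}. F I \<chi>) = g a b * involution_sum (I - {a, b}) f g"
      by (simp add: Z sum_distrib_left)
  qed
  finally show ?thesis .
qed

lemma of_nat_involution_sum:
  "of_nat (involution_sum I f g) = involution_sum I (\<lambda>i. of_nat (f i)) (\<lambda>i j. of_nat (g i j))"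
  unfolding involution_sum_def by (simp add: case_prod_unfold)

lemma involution_sum_mono:
  fixes f f' :: "'a::linorder \<Rightarrow> nat"
  assumes "finite I" "\<And>i. i \<in> I \<Longrightarrow> f i \<le> f' i" "\<And>i j. i \<in> I \<Longrightarrow> j \<in> I \<Longrightarrow> i \<noteq> j \<Longrightarrow> g i j \<le> g' i j"
  shows "involution_sum I f g \<le> involution_sum I f' g'"
  unfolding involution_sum_def
proof (intro sum_mono mult_le_mono prod_mono)
  fix \<chi> p assume "p \<in> {(i, j) \<in> I \<times> I. i < j \<and> \<chi> i = j}"
  then show "0 \<le> (case p of (i, j) \<Rightarrow> g i j) \<and> (case p of (i, j) \<Rightarrow> g i j) \<le> (case p of (i, j) \<Rightarrow> g' i j)"
    using assms by auto
qed (use assms in auto)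

lemma involution_sum_pos:
  fixes f :: "'a::linorder \<Rightarrow> nat"
  assumes "finite I" "\<And>i. i \<in> I \<Longrightarrow> 0 < f i"
  shows "0 < involution_sum I f g"
proof -
  let ?id = "\<lambda>i. if i \<in> I then i else undefined"
  let ?F = "\<lambda>\<chi>. (\<Prod>i\<in>{i\<in>I. \<chi> i = i}. f i) * (\<Prod>(i, j)\<in>{(i, j)\<in>I \<times> I. i < j \<and> \<chi> i = j}. g i j)"
  have id: "?id \<in> involutions I" by (auto simp: involutions_def)
  have empty: "{(i, j)\<in>I \<times> I. i < j \<and> ?id i = j} = {}" by auto
  have "0 < ?F ?id" unfolding empty using assms by (simp add: prod_pos)
  also have "\<dots> \<le> involution_sum I f g"
    unfolding involution_sum_def
    by (rule member_le_sum[OF id, of ?F]) (use finite_involutions[OF assms(1)] in auto)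
  finally show ?thesis .
qed

text \<open>
  By \<open>involution_sum_insert\<close> every single weight occurs in the sum with a coefficient that is positive
  for the larger weights, so a strict inequality in one weight cannot be compensated.
\<close>

lemma involution_sum_eq_bound:
  fixes f f' :: "'a::linorder \<Rightarrow> nat"
  assumes I: "finite I"
    and f: "\<And>i. i \<in> I \<Longrightarrow> f i \<le> f' i" and g: "\<And>i j. i \<in> I \<Longrightarrow> j \<in> I \<Longrightarrow> i \<noteq> j \<Longrightarrow> g i j \<le> g' i j"
    and pos: "\<And>i. i \<in> I \<Longrightarrow> 0 < f' i"
    and sym: "\<And>i j. i \<in> I \<Longrightarrow> j \<in> I \<Longrightarrow> g i j = g j i" "\<And>i j. i \<in> I \<Longrightarrow> j \<in> I \<Longrightarrow> g' i j = g' j i"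
    and eq: "involution_sum I f g = involution_sum I f' g'"
  shows "i \<in> I \<Longrightarrow> f i = f' i" "i \<in> I \<Longrightarrow> j \<in> I \<Longrightarrow> i \<noteq> j \<Longrightarrow> g i j = g' i j"
proof -
  let ?Z = "\<lambda>J. involution_sum J f g" and ?Z' = "\<lambda>J. involution_sum J f' g'"
  have le: "?Z J \<le> ?Z' J" if "J \<subseteq> I" for J
    using that by (intro involution_sum_mono finite_subset[OF that I] f g) auto
  have pos': "0 < ?Z' J" if "J \<subseteq> I" for J
    using that by (intro involution_sum_pos finite_subset[OF that I] pos) auto
  have rest: "(\<Sum>j\<in>I - {i}. g i j * ?Z (I - {i, j})) \<le> (\<Sum>j\<in>I - {i}. g' i j * ?Z' (I - {i, j}))" if "i \<in> I" for i
    using that by (intro sum_mono mult_le_mono g le) auto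
  have first: "f i * ?Z (I - {i}) \<le> f' i * ?Z' (I - {i})" if "i \<in> I" for i
    using that by (intro mult_le_mono f le) auto
  have eq': "f i * ?Z (I - {i}) + (\<Sum>j\<in>I - {i}. g i j * ?Z (I - {i, j}))
      = f' i * ?Z' (I - {i}) + (\<Sum>j\<in>I - {i}. g' i j * ?Z' (I - {i, j}))" if "i \<in> I" for i
    using eq involution_sum_insert[of I i g f] involution_sum_insert[of I i g' f'] I that sym by simp
  show "f i = f' i" if i: "i \<in> I"
  proof (rule ccontr)
    assume "f i \<noteq> f' i"
    then have "f i < f' i" using f[OF i] by simp
    then have "f i * ?Z' (I - {i}) < f' i * ?Z' (I - {i})" using pos'[of "I - {i}"] by auto
    moreover have "f i * ?Z (I - {i}) \<le> f i * ?Z' (I - {i})" using le[of "I - {i}"] by auto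
    ultimately have "f i * ?Z (I - {i}) < f' i * ?Z' (I - {i})" by linarith
    then show False using eq'[OF i] rest[OF i] by linarith
  qed
  show "g i j = g' i j" if i: "i \<in> I" and j: "j \<in> I" "i \<noteq> j"
  proof (rule ccontr)
    assume "g i j \<noteq> g' i j"
    then have "g i j < g' i j" using g[OF i j] by simp
    then have "g i j * ?Z' (I - {i, j}) < g' i j * ?Z' (I - {i, j})" using pos'[of "I - {i, j}"] by auto
    moreover have "g i j * ?Z (I - {i, j}) \<le> g i j * ?Z' (I - {i, j})" using le[of "I - {i, j}"] by auto
    ultimately have "g i j * ?Z (I - {i, j}) < g' i j * ?Z' (I - {i, j})" by linarith
    then have "(\<Sum>j\<in>I - {i}. g i j * ?Z (I - {i, j})) < (\<Sum>j\<in>I - {i}. g' i j * ?Z' (I - {i, j}))"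
      using i j I by (intro sum_strict_mono_ex1) (auto intro!: mult_le_mono g le bexI[of _ j])
    then show False using eq'[OF i] first[OF i] by linarith
  qed
qed

section \<open>Removing the last transposition\<close>

text \<open>
  The sequences of length \<open>k\<close> still take their values in all of \<open>{1..n}\<close>: after the transpositions of
  \<open>k + 1, \<dots>, n\<close> have been removed, these elements are inactive.
\<close>

definition factorization_count :: "nat \<Rightarrow> nat \<Rightarrow> (nat \<Rightarrow> nat) \<Rightarrow> nat" where
  "factorization_count n k \<pi> = card {a \<in> {1..k} \<rightarrow>\<^sub>E {1..n}. \<pi> = swap_product a k}"

lemma swap_product_cong: "(\<And>i. i \<in> {1..k} \<Longrightarrow> a i = a' i) \<Longrightarrow> swap_product a k = swap_product a' k"
  by (induction k) auto

lemma factorization_count_Suc: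
  "factorization_count n (Suc k) \<pi> = (\<Sum>b\<in>{1..n}. factorization_count n k (transpose (Suc k) b \<circ> \<pi>))"
proof -
  let ?y = "Suc k"
  define S where "S b = {a \<in> {1..k} \<rightarrow>\<^sub>E {1..n}. transpose ?y b \<circ> \<pi> = swap_product a k}" for b
  define R where "R b = {a \<in> {1..Suc k} \<rightarrow>\<^sub>E {1..n}. \<pi> = swap_product a (Suc k) \<and> a ?y = b}" for b
  have "{a \<in> {1..Suc k} \<rightarrow>\<^sub>E {1..n}. \<pi> = swap_product a (Suc k)} = (\<Union>b\<in>{1..n}. R b)"
    by (auto simp: R_def PiE_iff)
  moreover have "finite (R b)" for b
    unfolding R_def by (rule finite_subset[OF _ finite_PiE[of "{1..Suc k}" "\<lambda>_. {1..n}"]]) auto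
  ultimately have "factorization_count n (Suc k) \<pi> = (\<Sum>b\<in>{1..n}. card (R b))"
    unfolding factorization_count_def by (simp only:) (rule card_UN_disjoint, auto simp: R_def)
  also have "\<dots> = (\<Sum>b\<in>{1..n}. card (S b))"
  proof (intro sum.cong refl)
    fix b assume b: "b \<in> {1..n}"
    have swap: "\<pi> = transpose ?y b \<circ> \<sigma> \<longleftrightarrow> transpose ?y b \<circ> \<pi> = \<sigma>" for \<sigma>
      by (metis comp_assoc id_comp transpose_comp_involutory)
    have "bij_betw (\<lambda>a. a(?y := b)) (S b) (R b)"
    proof (rule bij_betw_byWitness[where f' = "\<lambda>a. a(?y := undefined)"])
      show "\<forall>a\<in>S b. (a(?y := b))(?y := undefined) = a"
        by (auto simp: S_def PiE_iff extensional_def fun_eq_iff)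
      show "\<forall>a\<in>R b. (a(?y := undefined))(?y := b) = a" by (auto simp: R_def)
      show "(\<lambda>a. a(?y := b)) ` S b \<subseteq> R b"
      proof
        fix a' assume "a' \<in> (\<lambda>a. a(?y := b)) ` S b"
        then obtain a where a: "a \<in> S b" "a' = a(?y := b)" by auto
        have "swap_product a' k = swap_product a k" unfolding a by (rule swap_product_cong) auto
        then show "a' \<in> R b" using a b swap[of "swap_product a k"]
          by (auto simp: S_def R_def PiE_iff extensional_def)
      qed
      show "(\<lambda>a. a(?y := undefined)) ` R b \<subseteq> S b"
      proof
        fix a' assume "a' \<in> (\<lambda>a. a(?y := undefined)) ` R b"
        then obtain a where a: "a \<in> R b" "a' = a(?y := undefined)" by auto
        have "swap_product a' k = swap_product a k" unfolding a by (rule swap_product_cong) auto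
        then show "a' \<in> S b" using a b swap[of "swap_product a k"]
          by (auto simp: S_def R_def PiE_iff extensional_def)
      qed
    qed
    then show "card (R b) = card (S b)" by (simp add: bij_betw_same_card)
  qed
  finally show ?thesis by (simp add: S_def factorization_count_def)
qed

section \<open>Cycles of a permutation as lists\<close>

text \<open>
  \<open>c\<close> lists a cycle of \<open>\<pi>\<close>, starting anywhere. Saying this by applying \<open>\<pi>\<close> to the whole list makes
  cutting and merging cycles a computation with lists.
\<close>

definition orbit_list :: "(nat \<Rightarrow> nat) \<Rightarrow> nat list \<Rightarrow> bool" where
  "orbit_list \<pi> c \<longleftrightarrow> c \<noteq> [] \<and> distinct c \<and> map \<pi> c = rotate1 c"

lemma orbit_list_rotate: "orbit_list \<pi> c \<Longrightarrow> orbit_list \<pi> (rotate k c)"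
  unfolding orbit_list_def by (simp add: rotate_map[symmetric] rotate1_rotate_swap)

lemma orbit_list_append_commute: "orbit_list \<pi> (xs @ ys) \<Longrightarrow> orbit_list \<pi> (ys @ xs)"
  using orbit_list_rotate[of \<pi> "xs @ ys" "length xs"] by (simp add: rotate_append)

lemma orbit_list_step: "orbit_list \<pi> c \<Longrightarrow> i < length c \<Longrightarrow> \<pi> (c ! i) = c ! (Suc i mod length c)"
  unfolding orbit_list_def by (metis nth_map nth_rotate1)

lemma orbit_list_closed: "orbit_list \<pi> c \<Longrightarrow> x \<in> set c \<Longrightarrow> \<pi> x \<in> set c"
  unfolding orbit_list_def by (metis imageI set_map set_rotate1)

lemma orbit_list_nth: "orbit_list \<pi> c \<Longrightarrow> j < length c \<Longrightarrow> c ! j = (\<pi> ^^ j) (c ! 0)"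
proof (induction j)
  case (Suc j)
  then have "\<pi> (c ! j) = c ! Suc j" using orbit_list_step[of \<pi> c j] by simp
  then show ?case using Suc by simp
qed simp

lemma orbit_list_start:
  assumes "orbit_list \<pi> c" "x \<in> set c"
  obtains C k where "orbit_list \<pi> (x # C)" "set (x # C) = set c" "rotate k c = x # C"
proof -
  obtain P Q where c: "c = P @ x # Q" using assms by (meson split_list)
  have "rotate (length P) c = x # (Q @ P)" by (simp add: c rotate_append)
  then show thesis using that orbit_list_rotate[OF assms(1)] by (metis set_rotate)
qed

lemma orbit_list_disjoint:
  assumes "orbit_list \<pi> c" "orbit_list \<pi> d" "x \<in> set d" "x \<notin> set c"
  shows "set c \<inter> set d = {}"
proof (rule ccontr)
  assume "set c \<inter> set d \<noteq> {}"
  then obtain u where u: "u \<in> set c" "u \<in> set d" by auto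
  obtain D where D: "orbit_list \<pi> (u # D)" "set (u # D) = set d"
    using orbit_list_start[OF assms(2) u(2)] by metis
  obtain j where "j < length (u # D)" "x = (u # D) ! j" using assms(3) D(2) by (metis in_set_conv_nth)
  then have "x = (\<pi> ^^ j) u" using orbit_list_nth[OF D(1)] by simp
  moreover have "(\<pi> ^^ i) u \<in> set c" for i
    by (induction i) (use u orbit_list_closed[OF assms(1)] in auto)
  ultimately show False using assms(4) by simp
qed

text \<open>
  Multiplying by \<open>(y b)\<close> from the left cuts a cycle that contains both \<open>y\<close> and \<open>b\<close>, and merges the
  two cycles if \<open>y\<close> and \<open>b\<close> lie in different ones.
\<close>

lemma orbit_list_split:
  assumes "orbit_list \<pi> (y # A @ b # B)"
  shows "orbit_list (transpose y b \<circ> \<pi>) (y # A)" "orbit_list (transpose y b \<circ> \<pi>) (b # B)"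
proof -
  have d: "distinct (y # A @ b # B)" and m: "map \<pi> (y # A) @ map \<pi> (b # B) = (A @ [b]) @ (B @ [y])"
    using assms by (simp_all add: orbit_list_def)
  then have "map \<pi> (y # A) = A @ [b]" "map \<pi> (b # B) = B @ [y]"
    by (subst (asm) append_eq_append_conv; simp)+
  moreover have "map (transpose y b) A = A" "map (transpose y b) B = B"
    by (rule map_idI, use d in \<open>auto simp: transpose_def\<close>)+
  ultimately have "map (transpose y b \<circ> \<pi>) (y # A) = A @ [y]" "map (transpose y b \<circ> \<pi>) (b # B) = B @ [b]"
    by (simp_all only: map_map[symmetric] map_append) simp_all
  then show "orbit_list (transpose y b \<circ> \<pi>) (y # A)" "orbit_list (transpose y b \<circ> \<pi>) (b # B)"
    using d by (auto simp: orbit_list_def)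
qed

lemma orbit_list_merge:
  assumes "orbit_list \<pi> (y # A)" "orbit_list \<pi> (b # B)" "distinct (y # A @ b # B)"
  shows "orbit_list (transpose y b \<circ> \<pi>) (y # A @ b # B)"
proof -
  have "map \<pi> (y # A) = A @ [y]" "map \<pi> (b # B) = B @ [b]" using assms by (simp_all add: orbit_list_def)
  moreover have "map (transpose y b) A = A" "map (transpose y b) B = B"
    by (rule map_idI, use assms(3) in \<open>auto simp: transpose_def\<close>)+
  ultimately have "map (transpose y b \<circ> \<pi>) (y # A) = A @ [b]" "map (transpose y b \<circ> \<pi>) (b # B) = B @ [y]"
    by (simp_all only: map_map[symmetric] map_append) simp_all
  then show ?thesis using assms(3) by (simp add: orbit_list_def)
qed

lemma orbit_list_other:
  assumes "orbit_list \<pi> c" "y \<notin> set c" "b \<notin> set c"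
  shows "orbit_list (transpose y b \<circ> \<pi>) c"
proof -
  have "map (transpose y b) (rotate1 c) = rotate1 c"
    by (rule map_idI) (use assms in \<open>auto simp: transpose_def\<close>)
  then show ?thesis using assms by (simp add: orbit_list_def flip: map_map)
qed

section \<open>Counting the factorizations\<close>

text \<open>
  The label of \<open>x\<close> is its component in the graph with the edges from \<open>i\<close> to \<open>a\<^sub>i\<close> for \<open>i \<le> k\<close>. Each
  edge is owned by one of the elements up to \<open>k\<close>, and adding the edge of \<open>k + 1\<close> merges the component
  of \<open>k + 1\<close> into another one; so two elements above \<open>k\<close> never get into the same component.
\<close>

lemma swap_product_label:
  "\<exists>l. (\<forall>x. l (swap_product a k x) = l x) \<and> inj_on (l :: nat \<Rightarrow> nat) {x. k < x}"
proof (induction k)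
  case 0
  show ?case by (intro exI[of _ id]) auto
next
  case (Suc k)
  then obtain l where l: "\<And>x. l (swap_product a k x) = l x" "inj_on (l :: nat \<Rightarrow> nat) {x. k < x}" by auto
  define l' where "l' x = (if l x = l (Suc k) then l (a (Suc k)) else l x)" for x
  have "l' (swap_product a (Suc k) x) = l' x" for x
  proof -
    have "l' (transpose (Suc k) (a (Suc k)) z) = l' z" for z
      by (simp add: l'_def transpose_def)
    then show ?thesis by (simp add: l'_def l)
  qed
  moreover have "inj_on l' {x. Suc k < x}"
  proof (rule inj_onI)
    fix x z assume xz: "x \<in> {x. Suc k < x}" "z \<in> {x. Suc k < x}" "l' x = l' z"
    have "l x \<noteq> l (Suc k)" "l z \<noteq> l (Suc k)" using xz l(2) by (auto dest!: inj_onD)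
    then show "x = z" using xz l(2) by (auto simp: l'_def dest!: inj_onD)
  qed
  ultimately show ?case by blast
qed

lemma factorization_count_eq_0:
  assumes "orbit_list \<pi> c" "x \<in> set c" "z \<in> set c" "x \<noteq> z" "k < x" "k < z"
  shows "factorization_count n k \<pi> = 0"
proof -
  have False if \<pi>: "\<pi> = swap_product a k" for a
  proof -
    obtain l where l: "\<And>u. l (\<pi> u) = l u" "inj_on (l :: nat \<Rightarrow> nat) {x. k < x}"
      using swap_product_label[of a k] unfolding \<pi>[symmetric] by auto
    obtain C where C: "orbit_list \<pi> (x # C)" "set (x # C) = set c"
      using orbit_list_start[OF assms(1,2)] by metis
    obtain j where "j < length (x # C)" "z = (x # C) ! j" using assms(3) C(2) by (metis in_set_conv_nth)
    then have "z = (\<pi> ^^ j) x" using orbit_list_nth[OF C(1)] by simp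
    moreover have "l ((\<pi> ^^ i) x) = l x" for i by (induction i) (simp_all add: l)
    ultimately have "l z = l x" by simp
    then show False using inj_onD[OF l(2)] assms by auto
  qed
  then have "{a \<in> {1..k} \<rightarrow>\<^sub>E {1..n}. \<pi> = swap_product a k} = {}" by blast
  then show ?thesis by (simp only: factorization_count_def card.empty)
qed

text \<open>
  The situation after the transpositions of all elements above \<open>k\<close> have been removed, as long as no
  cycle has two inactive elements: every inactive \<open>r\<close> is in a cycle \<open>r # w r\<close> of its own, and the
  other cycles, \<open>cyc i\<close> for \<open>i \<in> I\<close>, consist of active elements. The words \<open>w r\<close> are automatically
  disjoint from each other and from the lists \<open>cyc i\<close>, since different cycles of \<open>\<pi>\<close> are disjoint.
\<close>

definition cycle_state :: "nat \<Rightarrow> nat \<Rightarrow> (nat \<Rightarrow> nat) \<Rightarrow> (nat \<Rightarrow> nat list) \<Rightarrow> nat set \<Rightarrow> (nat \<Rightarrow> nat list) \<Rightarrow> bool" where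
  "cycle_state n k \<pi> w I cyc \<longleftrightarrow> k \<le> n \<and> \<pi> permutes {1..n} \<and> finite I \<and>
     (\<forall>r. k < r \<and> r \<le> n \<longrightarrow> orbit_list \<pi> (r # w r) \<and> set (w r) \<subseteq> {1..k}) \<and>
     (\<forall>i\<in>I. orbit_list \<pi> (cyc i) \<and> set (cyc i) \<subseteq> {1..k}) \<and>
     (\<forall>i\<in>I. \<forall>j\<in>I. i \<noteq> j \<longrightarrow> set (cyc i) \<inter> set (cyc j) = {}) \<and>
     {1..k} \<subseteq> (\<Union>r\<in>{k<..n}. set (w r)) \<union> (\<Union>i\<in>I. set (cyc i))"

text \<open>
  What the last remaining transposition, that of \<open>k + 1\<close>, does to such a state.
\<close>

context
  fixes n k :: nat and \<pi> :: "nat \<Rightarrow> nat" and w :: "nat \<Rightarrow> nat list" and I :: "nat set" and cyc :: "nat \<Rightarrow> nat list"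
  assumes state: "cycle_state n (Suc k) \<pi> w I cyc"
begin

lemma state_facts:
  shows "Suc k \<le> n" "\<pi> permutes {1..n}" "finite I"
    "\<And>r. Suc k < r \<Longrightarrow> r \<le> n \<Longrightarrow> orbit_list \<pi> (r # w r)"
    "\<And>r. Suc k < r \<Longrightarrow> r \<le> n \<Longrightarrow> set (w r) \<subseteq> {1..Suc k}"
    "\<And>i. i \<in> I \<Longrightarrow> orbit_list \<pi> (cyc i)"
    "\<And>i. i \<in> I \<Longrightarrow> set (cyc i) \<subseteq> {1..Suc k}"
    "\<And>i j. i \<in> I \<Longrightarrow> j \<in> I \<Longrightarrow> i \<noteq> j \<Longrightarrow> set (cyc i) \<inter> set (cyc j) = {}"
    "{1..Suc k} \<subseteq> (\<Union>r\<in>{Suc k<..n}. set (w r)) \<union> (\<Union>i\<in>I. set (cyc i))"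
  using state unfolding cycle_state_def by blast+

lemma state_disjoint:
  "\<And>r s. Suc k < r \<Longrightarrow> r \<le> n \<Longrightarrow> Suc k < s \<Longrightarrow> s \<le> n \<Longrightarrow> r \<noteq> s \<Longrightarrow> set (r # w r) \<inter> set (s # w s) = {}"
  "\<And>r i. Suc k < r \<Longrightarrow> r \<le> n \<Longrightarrow> i \<in> I \<Longrightarrow> set (r # w r) \<inter> set (cyc i) = {}"
proof -
  show "set (r # w r) \<inter> set (s # w s) = {}"
    if "Suc k < r" "r \<le> n" "Suc k < s" "s \<le> n" "r \<noteq> s" for r s
    by (rule orbit_list_disjoint[where x = s]) (use that state_facts(4) state_facts(5)[of r] in auto)
  show "set (r # w r) \<inter> set (cyc i) = {}" if "Suc k < r" "r \<le> n" "i \<in> I" for r i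
  proof -
    have "set (cyc i) \<inter> set (r # w r) = {}"
      by (rule orbit_list_disjoint[where x = r]) (use that state_facts(4,6) state_facts(7)[of i] in auto)
    then show ?thesis by blast
  qed
qed

lemma state_orbit:
  assumes "b \<in> {1..n}" obtains d where "orbit_list \<pi> d" "b \<in> set d"
proof (cases "b \<le> Suc k")
  case True
  then have "b \<in> (\<Union>r\<in>{Suc k<..n}. set (w r)) \<union> (\<Union>i\<in>I. set (cyc i))" using assms state_facts(9) by auto
  then show thesis using that state_facts(4,6) by force
next
  case False
  then show thesis using that[of "b # w b"] state_facts(4)[of b] assms by auto
qed

lemma state_transpose_permutes: "b \<in> {1..n} \<Longrightarrow> transpose (Suc k) b \<circ> \<pi> permutes {1..n}"
  using state_facts(1,2) by (intro permutes_compose permutes_swap_id) auto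

text \<open>
  If \<open>k + 1\<close> shares its cycle with an inactive \<open>r\<close>, only a cut that separates the two leaves a cycle
  structure with any factorizations; going around the cycle from \<open>k + 1\<close>, such a \<open>b\<close> is met no
  later than \<open>r\<close>.
\<close>

lemma rooted_vanish:
  assumes r: "Suc k < r" "r \<le> n" and w: "w r = Y @ Suc k # X" and b: "b \<in> {1..n}" "b \<notin> set (X @ [r])"
  shows "factorization_count n k (transpose (Suc k) b \<circ> \<pi>) = 0"
proof -
  let ?y = "Suc k"
  have c: "orbit_list \<pi> (?y # X @ r # Y)"
    using orbit_list_append_commute[of \<pi> "r # Y" "?y # X"] state_facts(4)[OF r] by (simp add: w)
  show ?thesis
  proof (cases "b \<in> set (?y # X @ r # Y)")
    case True
    then consider "b = ?y" | "b \<in> set Y" using b by auto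
    then show ?thesis
    proof cases
      case 1
      then show ?thesis using factorization_count_eq_0[OF c, of ?y r k n] r by simp
    next
      case 2
      then obtain Y1 Y2 where "Y = Y1 @ b # Y2" by (meson split_list)
      then have "orbit_list (transpose ?y b \<circ> \<pi>) (?y # (X @ r # Y1))"
        using c by (intro orbit_list_split(1)[where B = Y2]) simp
      from factorization_count_eq_0[OF this, of ?y r k n] show ?thesis using r by simp
    qed
  next
    case False
    obtain d where d: "orbit_list \<pi> d" "b \<in> set d" using state_orbit[OF b(1)] .
    have disj: "set (?y # X @ r # Y) \<inter> set d = {}" by (rule orbit_list_disjoint[OF c d False])
    obtain D where D: "orbit_list \<pi> (b # D)" "set (b # D) = set d"
      using orbit_list_start[OF d] by metis
    have "distinct (?y # (X @ r # Y) @ b # D)"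
      using disj c D unfolding orbit_list_def by (auto simp flip: D(2))
    from orbit_list_merge[OF c D(1) this] show ?thesis
      using factorization_count_eq_0[of _ _ ?y r k n] r by simp
  qed
qed

lemma rooted_split_state:
  assumes r: "Suc k < r" "r \<le> n" and w: "w r = Y @ Suc k # A @ D" and b: "D @ [r] = b # B"
  shows "cycle_state n k (transpose (Suc k) b \<circ> \<pi>) (w(Suc k := A, r := Y @ D)) I cyc"
proof -
  let ?y = "Suc k" and ?\<sigma> = "transpose (Suc k) b \<circ> \<pi>"
  have c: "orbit_list \<pi> (?y # A @ D @ r # Y)"
    using orbit_list_append_commute[of \<pi> "r # Y" "?y # A @ D"] state_facts(4)[OF r] by (simp add: w)
  have eq: "D @ r # Y = b # B @ Y" using b by (metis append.assoc append_Cons append_Nil)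
  have "orbit_list \<pi> (?y # A @ b # B @ Y)" using c unfolding eq .
  note sp = orbit_list_split[OF this]
  have D: "orbit_list ?\<sigma> (r # Y @ D)"
    using orbit_list_append_commute[of ?\<sigma> D "r # Y"] sp(2) unfolding eq[symmetric] by simp
  have dist: "distinct (r # w r)" using state_facts(4)[OF r] by (simp add: orbit_list_def)
  have bin: "b \<in> set (r # w r)" using arg_cong[OF b, of set] by (auto simp: w)
  have yin: "?y \<in> set (r # w r)" by (simp add: w)
  have bn: "b \<in> {1..n}" using bin r state_facts(5)[OF r] state_facts(1) by auto
  have wr: "set (w r) \<subseteq> {1..?y}" by (rule state_facts(5)[OF r])
  have others: "orbit_list ?\<sigma> (s # w s)" "set (w s) \<subseteq> {1..k}" if "?y < s" "s \<le> n" "s \<noteq> r" for s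
  proof -
    have disj: "set (r # w r) \<inter> set (s # w s) = {}" using state_disjoint(1) r that by metis
    then have "?y \<notin> set (s # w s)" "b \<notin> set (s # w s)" using yin bin by blast+
    then show "orbit_list ?\<sigma> (s # w s)" by (intro orbit_list_other state_facts(4) that)
    show "set (w s) \<subseteq> {1..k}"
      using state_facts(5)[OF that(1,2)] \<open>?y \<notin> set (s # w s)\<close> by (force simp: le_Suc_eq)
  qed
  have active: "orbit_list ?\<sigma> (cyc i)" "set (cyc i) \<subseteq> {1..k}" if "i \<in> I" for i
  proof -
    have disj: "set (r # w r) \<inter> set (cyc i) = {}" using state_disjoint(2) r that by metis
    then have "?y \<notin> set (cyc i)" "b \<notin> set (cyc i)" using yin bin by blast+
    then show "orbit_list ?\<sigma> (cyc i)" by (intro orbit_list_other state_facts(6) that)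
    show "set (cyc i) \<subseteq> {1..k}"
      using state_facts(7)[OF that] \<open>?y \<notin> set (cyc i)\<close> by (force simp: le_Suc_eq)
  qed
  have sub: "set A \<subseteq> {1..k}" "set (Y @ D) \<subseteq> {1..k}"
    using wr dist unfolding w by (force simp: le_Suc_eq)+
  let ?w = "w(?y := A, r := Y @ D)"
  have roots: "orbit_list ?\<sigma> (s # ?w s) \<and> set (?w s) \<subseteq> {1..k}" if "k < s" "s \<le> n" for s
    using that r sp(1) D sub others[of s] by (cases "s = r"; cases "s = ?y") auto
  have cover: "{1..k} \<subseteq> (\<Union>s\<in>{k<..n}. set (?w s)) \<union> (\<Union>i\<in>I. set (cyc i))"
  proof
    fix x assume x: "x \<in> {1..k}"
    then have "x \<in> (\<Union>s\<in>{?y<..n}. set (w s)) \<union> (\<Union>i\<in>I. set (cyc i))"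
      by (intro subsetD[OF state_facts(9)]) auto
    then consider i where "i \<in> I" "x \<in> set (cyc i)" | s where "s \<in> {?y<..n}" "x \<in> set (w s)" by auto
    then show "x \<in> (\<Union>s\<in>{k<..n}. set (?w s)) \<union> (\<Union>i\<in>I. set (cyc i))"
    proof cases
      case 2
      show ?thesis
      proof (cases "s = r")
        case True
        then have "x \<in> set (?w ?y) \<or> x \<in> set (?w r)" using 2 x r by (auto simp: w)
        then show ?thesis using r state_facts(1) by (auto intro: bexI[of _ ?y] bexI[of _ r])
      next
        case False
        then have "x \<in> set (?w s)" "s \<in> {k<..n}" using 2 by auto
        then show ?thesis by blast
      qed
    qed auto
  qed
  show ?thesis
    unfolding cycle_state_def
    using state_transpose_permutes[OF bn] state_facts(1,3,8) roots active cover by auto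
qed

lemma active_vanish:
  assumes i: "i \<in> I" "Suc k \<in> set (cyc i)" and r: "Suc k < r" "r \<le> n" and b: "b \<in> set (r # w r)"
  shows "factorization_count n k (transpose (Suc k) b \<circ> \<pi>) = 0"
proof -
  let ?y = "Suc k"
  obtain C where C: "orbit_list \<pi> (?y # C)" "set (?y # C) = set (cyc i)"
    using orbit_list_start[OF state_facts(6)[OF i(1)] i(2)] by metis
  obtain D where D: "orbit_list \<pi> (b # D)" "set (b # D) = set (r # w r)"
    using orbit_list_start[OF state_facts(4)[OF r] b] by metis
  have "set (?y # C) \<inter> set (b # D) = {}"
    using state_disjoint(2)[OF r i(1)] unfolding C D by blast
  moreover have "distinct (?y # C)" "distinct (b # D)" using C(1) D(1) by (simp_all add: orbit_list_def)
  ultimately have "distinct (?y # C @ b # D)" by auto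
  from orbit_list_merge[OF C(1) D(1) this]
  have "orbit_list (transpose ?y b \<circ> \<pi>) (?y # C @ b # D)" .
  moreover have "r \<in> set (?y # C @ b # D)" using D(2) by auto
  ultimately show ?thesis using factorization_count_eq_0[of _ _ ?y r k n] r by simp
qed

text \<open>
  Common form of the three ways in which \<open>k + 1\<close> can become inactive in an active cycle \<open>cyc i\<close>: the
  cycles with index in \<open>T\<close> are replaced by the rooted cycle of \<open>k + 1\<close> and at most one active cycle,
  which gets the index \<open>i\<close>.
\<close>

lemma active_update:
  assumes i: "i \<in> T" "Suc k \<in> set (cyc i)" and T: "T \<subseteq> I" and b: "b \<in> (\<Union>j\<in>T. set (cyc j))"
    and \<sigma>: "\<sigma> = transpose (Suc k) b \<circ> \<pi>"
    and A: "orbit_list \<sigma> (Suc k # A)" "set A \<subseteq> (\<Union>j\<in>T. set (cyc j))"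
    and J: "J = I - T \<or> J = insert i (I - T)"
    and cyc': "\<And>j. j \<in> I - T \<Longrightarrow> cyc' j = cyc j"
      "i \<in> J \<Longrightarrow> orbit_list \<sigma> (cyc' i)" "i \<in> J \<Longrightarrow> set (cyc' i) \<subseteq> (\<Union>j\<in>T. set (cyc j)) - {Suc k}"
    and cover: "(\<Union>j\<in>T. set (cyc j)) \<subseteq> insert (Suc k) (set A) \<union> (\<Union>j\<in>J. set (cyc' j))"
  shows "cycle_state n k \<sigma> (w(Suc k := A)) J cyc'"
proof -
  let ?y = "Suc k"
  define U where "U = (\<Union>j\<in>T. set (cyc j))"
  have yU: "?y \<in> U" using i by (auto simp: U_def)
  have bU: "b \<in> U" using b by (simp add: U_def)
  have U: "U \<subseteq> {1..?y}" using state_facts(7) T by (auto simp: U_def)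
  have dA: "?y \<notin> set A" using A(1) by (simp add: orbit_list_def)
  have sub: "X \<subseteq> {1..k}" if "X \<subseteq> {1..?y}" "?y \<notin> X" for X
    using that by (force simp: le_Suc_eq)
  have bn: "b \<in> {1..n}" using bU U state_facts(1) by auto
  have others: "orbit_list \<sigma> (s # w s)" "set (w s) \<subseteq> {1..k}" if "?y < s" "s \<le> n" for s
  proof -
    have "set (s # w s) \<inter> U = {}" using state_disjoint(2)[OF that] T unfolding U_def by blast
    then have y: "?y \<notin> set (s # w s)" and "b \<notin> set (s # w s)" using yU bU by blast+
    then show "orbit_list \<sigma> (s # w s)" unfolding \<sigma> by (intro orbit_list_other state_facts(4) that)
    show "set (w s) \<subseteq> {1..k}" using state_facts(5)[OF that] y by (intro sub) auto
  qed
  have rest: "orbit_list \<sigma> (cyc j)" "set (cyc j) \<subseteq> {1..k}" "set (cyc j) \<inter> U = {}" if "j \<in> I - T" for j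
  proof -
    show d: "set (cyc j) \<inter> U = {}" using state_facts(8)[of j] that T unfolding U_def by blast
    then have y: "?y \<notin> set (cyc j)" and "b \<notin> set (cyc j)" using yU bU by blast+
    then show "orbit_list \<sigma> (cyc j)" unfolding \<sigma> using that by (intro orbit_list_other state_facts(6)) auto
    show "set (cyc j) \<subseteq> {1..k}" using state_facts(7)[of j] that y by (intro sub) auto
  qed
  have new: "orbit_list \<sigma> (cyc' i)" "set (cyc' i) \<subseteq> {1..k}" "set (cyc' i) \<subseteq> U" if "i \<in> J"
    using cyc'(2,3)[OF that] U sub[of "set (cyc' i)"] by (auto simp: U_def)
  have "\<sigma> permutes {1..n}" unfolding \<sigma> by (rule state_transpose_permutes[OF bn])
  moreover have "finite J" using J state_facts(3) by auto
  moreover have "orbit_list \<sigma> (s # (w(?y := A)) s) \<and> set ((w(?y := A)) s) \<subseteq> {1..k}" if "k < s" "s \<le> n" for s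
    using that others[of s] A(1) sub[of "set A"] A(2) U dA by (cases "s = ?y") (auto simp: U_def)
  moreover have "orbit_list \<sigma> (cyc' j) \<and> set (cyc' j) \<subseteq> {1..k}" if "j \<in> J" for j
  proof (cases "j \<in> I - T")
    case True
    then show ?thesis using rest(1,2)[of j] cyc'(1)[of j] by simp
  next
    case False
    then have "j = i" using that J by auto
    then show ?thesis using new(1,2) that by simp
  qed
  moreover have "set (cyc' j) \<inter> set (cyc' l) = {}" if jl: "j \<in> J" "l \<in> J" "j \<noteq> l" for j l
  proof -
    have "i \<notin> I - T" using i by simp
    then consider "j \<in> I - T" "l \<in> I - T" | "j = i" "l \<in> I - T" | "l = i" "j \<in> I - T" using jl J by auto
    then show ?thesis
    proof cases
      case 1
      then show ?thesis using state_facts(8)[of j l] cyc'(1) jl(3) by simp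
    next
      case 2
      then have "set (cyc' j) \<subseteq> U" "set (cyc' l) \<inter> U = {}" using new(3) rest(3)[of l] cyc'(1) jl by auto
      then show ?thesis by blast
    next
      case 3
      then have "set (cyc' l) \<subseteq> U" "set (cyc' j) \<inter> U = {}" using new(3) rest(3)[of j] cyc'(1) jl by auto
      then show ?thesis by blast
    qed
  qed
  moreover have "{1..k} \<subseteq> (\<Union>s\<in>{k<..n}. set ((w(?y := A)) s)) \<union> (\<Union>j\<in>J. set (cyc' j))"
  proof
    fix x assume x: "x \<in> {1..k}"
    then have "x \<in> (\<Union>s\<in>{?y<..n}. set (w s)) \<union> (\<Union>i\<in>I. set (cyc i))"
      by (intro subsetD[OF state_facts(9)]) auto
    then consider s where "s \<in> {?y<..n}" "x \<in> set (w s)" | "x \<in> U" | j where "j \<in> I - T" "x \<in> set (cyc j)"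
      by (auto simp: U_def)
    then show "x \<in> (\<Union>s\<in>{k<..n}. set ((w(?y := A)) s)) \<union> (\<Union>j\<in>J. set (cyc' j))"
    proof cases
      case 1
      then have "x \<in> set ((w(?y := A)) s)" "s \<in> {k<..n}" by auto
      then show ?thesis by blast
    next
      case 2
      then have "x \<in> insert ?y (set A) \<union> (\<Union>j\<in>J. set (cyc' j))" using cover unfolding U_def by blast
      then have "x \<in> set A \<or> x \<in> (\<Union>j\<in>J. set (cyc' j))" using x by auto
      moreover have "x \<in> set A \<Longrightarrow> x \<in> set ((w(?y := A)) ?y)" "?y \<in> {k<..n}"
        using state_facts(1) by auto
      ultimately show ?thesis by blast
    next
      case 3
      then have "x \<in> set (cyc' j)" "j \<in> J" using cyc'(1) J by auto
      then show ?thesis by blast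
    qed
  qed
  ultimately show ?thesis using state_facts(1) unfolding cycle_state_def by auto
qed

lemma active_root_state:
  assumes "i \<in> I" "orbit_list \<pi> (Suc k # X)" "set (Suc k # X) = set (cyc i)"
  shows "cycle_state n k (transpose (Suc k) (Suc k) \<circ> \<pi>) (w(Suc k := X)) (I - {i}) cyc"
  by (rule active_update[where T = "{i}" and b = "Suc k" and i = i]) (use assms in auto)

lemma active_split_state:
  assumes i: "i \<in> I" and c: "orbit_list \<pi> (Suc k # A @ b # B)" "set (Suc k # A @ b # B) = set (cyc i)"
  shows "cycle_state n k (transpose (Suc k) b \<circ> \<pi>) (w(Suc k := A)) I (cyc(i := b # B))"
proof (rule active_update[where T = "{i}" and b = b and i = i])
  show "orbit_list (transpose (Suc k) b \<circ> \<pi>) (Suc k # A)" by (rule orbit_list_split(1)[OF c(1)])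
  show "orbit_list (transpose (Suc k) b \<circ> \<pi>) ((cyc(i := b # B)) i)"
    using orbit_list_split(2)[OF c(1)] by simp
  have "Suc k \<notin> set (b # B)" using c(1) by (auto simp: orbit_list_def)
  then show "set ((cyc(i := b # B)) i) \<subseteq> (\<Union>j\<in>{i}. set (cyc j)) - {Suc k}"
    using c(2) by auto
  show "(\<Union>j\<in>{i}. set (cyc j)) \<subseteq> insert (Suc k) (set A) \<union> (\<Union>j\<in>I. set ((cyc(i := b # B)) j))"
    using i by (auto simp flip: c(2))
  show "Suc k \<in> set (cyc i)" "b \<in> (\<Union>j\<in>{i}. set (cyc j))" "set A \<subseteq> (\<Union>j\<in>{i}. set (cyc j))"
    by (auto simp flip: c(2))
  show "I = I - {i} \<or> I = insert i (I - {i})" using i by auto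
qed (use i in auto)

lemma active_merge_state:
  assumes ij: "i \<in> I" "j \<in> I" "i \<noteq> j"
    and c: "orbit_list \<pi> (Suc k # X)" "set (Suc k # X) = set (cyc i)"
    and d: "orbit_list \<pi> (b # B)" "set (b # B) = set (cyc j)"
  shows "cycle_state n k (transpose (Suc k) b \<circ> \<pi>) (w(Suc k := X @ b # B)) (I - {i, j}) cyc"
proof (rule active_update[where T = "{i, j}" and b = b and i = i])
  have "set (Suc k # X) \<inter> set (b # B) = {}" unfolding c d using state_facts(8)[OF ij] .
  moreover have "distinct (Suc k # X)" "distinct (b # B)" using c d by (simp_all add: orbit_list_def)
  ultimately have "distinct (Suc k # X @ b # B)" by auto
  then show "orbit_list (transpose (Suc k) b \<circ> \<pi>) (Suc k # X @ b # B)"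
    by (rule orbit_list_merge[OF c(1) d(1)])
  show "Suc k \<in> set (cyc i)" "b \<in> (\<Union>l\<in>{i, j}. set (cyc l))" "set (X @ b # B) \<subseteq> (\<Union>l\<in>{i, j}. set (cyc l))"
    "(\<Union>l\<in>{i, j}. set (cyc l)) \<subseteq> insert (Suc k) (set (X @ b # B)) \<union> (\<Union>l\<in>I - {i, j}. set (cyc l))"
    by (auto simp flip: c(2) d(2))
qed (use ij in auto)

end

lemma sum_set_nth: "distinct xs \<Longrightarrow> (\<Sum>x\<in>set xs. f x) = (\<Sum>i<length xs. f (xs ! i))"
  by (subst sum_list_distinct_conv_sum_set[symmetric]) (simp_all add: sum_list_sum_nth atLeast0LessThan)

lemma prod_greaterThan_insert:
  fixes f :: "nat \<Rightarrow> nat"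
  assumes "Suc k \<le> n" shows "(\<Prod>r\<in>{k<..n}. f r) = f (Suc k) * (\<Prod>r\<in>{Suc k<..n}. f r)"
proof -
  have "{k<..n} = insert (Suc k) {Suc k<..n}" using assms by auto
  then show ?thesis by simp
qed

text \<open>
  Sum over the partner \<open>b\<close> of \<open>k + 1\<close>. Every \<open>b\<close> that does not produce a cycle with two inactive
  elements leads to a smaller state, and the resulting sums are the recursions of \<open>rooted_count\<close>,
  \<open>cycle_count\<close> and \<open>pair_count\<close> at the largest active element \<open>k + 1\<close>.
\<close>

theorem factorization_count_eq:
  assumes "cycle_state n k \<pi> w I cyc"
  shows "factorization_count n k \<pi> = (\<Prod>r\<in>{k<..n}. rooted_count (w r)) *
    involution_sum I (\<lambda>i. cycle_count (cyc i)) (\<lambda>i j. pair_count (cyc i) (cyc j))"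
  using assms
proof (induction k arbitrary: \<pi> w I cyc)
  case 0
  then have s: "\<pi> permutes {1..n}" "\<And>r. 0 < r \<Longrightarrow> r \<le> n \<Longrightarrow> orbit_list \<pi> (r # w r)"
      "\<And>r. 0 < r \<Longrightarrow> r \<le> n \<Longrightarrow> w r = []" "\<And>i. i \<in> I \<Longrightarrow> orbit_list \<pi> (cyc i)" "\<And>i. i \<in> I \<Longrightarrow> cyc i = []"
    by (auto simp: cycle_state_def)
  have I: "I = {}" using s(4,5) by (auto simp: orbit_list_def)
  have "\<pi> x = x" for x
  proof (cases "x \<in> {1..n}")
    case True
    then show ?thesis using s(2,3)[of x] by (simp add: orbit_list_def)
  next
    case False
    then show ?thesis using s(1) by (simp add: permutes_not_in)
  qed
  then have "\<pi> = id" by auto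
  then have "factorization_count n 0 \<pi> = 1" by (simp add: factorization_count_def)
  then show ?case using I s(3) by simp
next
  case (Suc k)
  let ?y = "Suc k" and ?T = rooted_count
  let ?f = "\<lambda>i. cycle_count (cyc i)" and ?g = "\<lambda>i j. pair_count (cyc i) (cyc j)"
  define C where "C b = factorization_count n k (transpose ?y b \<circ> \<pi>)" for b
  note state = Suc.prems
  note facts = state_facts[OF state]
  define R where "R = (\<Prod>r\<in>{?y<..n}. ?T (w r))"
  have count: "factorization_count n (Suc k) \<pi> = (\<Sum>b\<in>{1..n}. C b)"
    by (simp add: C_def factorization_count_Suc)
  have "?y \<in> (\<Union>r\<in>{?y<..n}. set (w r)) \<union> (\<Union>i\<in>I. set (cyc i))"
    by (rule subsetD[OF facts(9)]) simp
  then consider (rooted) r where "?y < r" "r \<le> n" "?y \<in> set (w r)" | (active) i where "i \<in> I" "?y \<in> set (cyc i)" by auto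
  then show ?case
  proof cases
    case rooted
    then obtain Y X where w: "w r = Y @ ?y # X" by (meson split_list)
    have dist: "distinct (r # w r)" using facts(4)[OF rooted(1,2)] by (simp add: orbit_list_def)
    have sub: "set (r # w r) \<subseteq> {1..n}" using facts(1) facts(5)[OF rooted(1,2)] rooted by auto
    define R' where "R' = (\<Prod>s\<in>{?y<..n} - {r}. ?T (w s))"
    define Z where "Z = involution_sum I ?f ?g"
    have R: "R = ?T (w r) * R'" unfolding R_def R'_def using rooted by (subst prod.remove[of _ r]) auto
    have Cb: "C ((X @ [r]) ! i) = ?T (take i X) * ?T (Y @ drop i X) * (R' * Z)" if i: "i \<le> length X" for i
    proof -
      define b where "b = (X @ [r]) ! i"
      obtain B where B: "drop i X @ [r] = b # B"
      proof -
        have "drop i (X @ [r]) = b # drop (Suc i) (X @ [r])"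
          unfolding b_def by (rule Cons_nth_drop_Suc[symmetric]) (use i in simp)
        then show thesis using that[of "drop (Suc i) (X @ [r])"] i by simp
      qed
      have st: "cycle_state n k (transpose ?y b \<circ> \<pi>) (w(?y := take i X, r := Y @ drop i X)) I cyc"
        by (rule rooted_split_state[OF state rooted(1,2) _ B]) (simp add: w)
      have "C b = (\<Prod>s\<in>{k<..n}. ?T ((w(?y := take i X, r := Y @ drop i X)) s)) * Z"
        unfolding C_def Z_def by (rule Suc.IH[OF st])
      also have "(\<Prod>s\<in>{k<..n}. ?T ((w(?y := take i X, r := Y @ drop i X)) s))
          = ?T (take i X) * (\<Prod>s\<in>{?y<..n}. ?T ((w(?y := take i X, r := Y @ drop i X)) s))"
        by (subst prod_greaterThan_insert[OF facts(1)]) (use rooted in simp)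
      also have "(\<Prod>s\<in>{?y<..n}. ?T ((w(?y := take i X, r := Y @ drop i X)) s)) = ?T (Y @ drop i X) * R'"
        unfolding R'_def by (subst prod.remove[of _ r]) (use rooted in \<open>auto intro!: prod.cong\<close>)
      finally show ?thesis by (simp add: b_def mult_ac)
    qed
    \<comment> \<open>Any other partner leaves \<open>k + 1\<close> and \<open>r\<close>, both inactive, in one cycle.\<close>
    have "(\<Sum>b\<in>{1..n}. C b) = (\<Sum>b\<in>set (X @ [r]). C b)"
    proof (rule sum.mono_neutral_right)
      show "set (X @ [r]) \<subseteq> {1..n}" using sub by (auto simp: w)
      show "\<forall>b\<in>{1..n} - set (X @ [r]). C b = 0"
        unfolding C_def using rooted_vanish[OF state rooted(1,2) w] by blast
    qed simp
    also have "\<dots> = (\<Sum>i<length (X @ [r]). C ((X @ [r]) ! i))"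
      by (rule sum_set_nth) (use dist in \<open>auto simp: w\<close>)
    also have "\<dots> = (\<Sum>i\<le>length X. C ((X @ [r]) ! i))" by (simp add: lessThan_Suc_atMost)
    also have "\<dots> = (\<Sum>i\<le>length X. ?T (take i X) * ?T (Y @ drop i X) * (R' * Z))"
      by (intro sum.cong refl Cb) simp
    also have "\<dots> = split_sum (\<lambda>A B. ?T A * ?T (Y @ B)) X * (R' * Z)"
      by (simp add: split_sum_def sum_distrib_right)
    also have "split_sum (\<lambda>A B. ?T A * ?T (Y @ B)) X = ?T (w r)"
      unfolding w
    proof (rule rooted_count_at_max[symmetric], rule ballI)
      fix x assume "x \<in> set Y \<union> set X"
      then have "x \<in> set (w r)" "x \<noteq> ?y" using dist by (auto simp: w)
      then show "x < ?y" using subsetD[OF facts(5)[OF rooted(1,2)], of x] by simp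
    qed
    finally show ?thesis unfolding count using R by (simp add: R_def[symmetric] Z_def)
  next
    case active
    obtain P Q where c: "cyc i = P @ ?y # Q" using active by (meson split_list)
    define X where "X = Q @ P"
    have oX: "orbit_list \<pi> (?y # X)"
      using orbit_list_append_commute[of \<pi> P "?y # Q"] facts(6)[OF active(1)] by (simp add: c X_def)
    have setX: "set (?y # X) = set (cyc i)" by (auto simp: c X_def)
    have dist: "distinct (?y # X)" using oX by (simp add: orbit_list_def)
    have cn: "set (cyc j) \<subseteq> {1..n}" if "j \<in> I" for j using facts(1) facts(7)[OF that] by auto
    have lt: "\<forall>x\<in>set P \<union> set Q. x < ?y"
    proof
      fix x assume "x \<in> set P \<union> set Q"
      then have "x \<in> set (cyc i)" "x \<noteq> ?y" using dist by (auto simp: c X_def)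
      then show "x < ?y" using subsetD[OF facts(7)[OF active(1)], of x] by simp
    qed
    have disj: "set (cyc i) \<inter> set (cyc j) = {}" if "j \<in> I - {i}" for j
      using facts(8)[of i j] active that by auto
    define Z1 where "Z1 = involution_sum (I - {i}) ?f ?g"
    define Z2 where "Z2 j = involution_sum (I - {i, j}) ?f ?g" for j
    have prodw: "(\<Prod>s\<in>{k<..n}. ?T ((w(?y := A)) s)) = ?T A * R" for A
      unfolding R_def by (subst prod_greaterThan_insert[OF facts(1)]) (auto intro!: prod.cong)
    have sym: "?g j l = ?g l j" if "j \<in> I" "l \<in> I" for j l
    proof (cases "j = l")
      case False
      then have "distinct (cyc j @ cyc l)"
        using facts(6)[OF that(1)] facts(6)[OF that(2)] facts(8)[OF that False] by (auto simp: orbit_list_def)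
      then show ?thesis by (rule pair_count_commute)
    qed simp
    \<comment> \<open>The partner \<open>k + 1\<close> itself: the cycle stays as it is, with \<open>k + 1\<close> inactive.\<close>
    have Cy: "C ?y = ?T X * (R * Z1)"
      unfolding C_def Suc.IH[OF active_root_state[OF state active(1) oX setX]] prodw Z1_def
      by (simp add: mult_ac)
    \<comment> \<open>A partner in the same cycle: the cut-off part stays active and keeps the index \<open>i\<close>.\<close>
    have CX: "C (X ! l) = ?T (take l X) * cycle_count (drop l X) * (R * Z1)
        + (\<Sum>j\<in>I - {i}. ?T (take l X) * pair_count (drop l X) (cyc j) * (R * Z2 j))" if l: "l < length X" for l
    proof -
      define A b B where "A = take l X" and "b = X ! l" and "B = drop (Suc l) X"
      have bB: "b # B = drop l X" unfolding b_def B_def by (rule Cons_nth_drop_Suc[OF l])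
      have split: "?y # A @ b # B = ?y # X" unfolding bB A_def by simp
      let ?c = "cyc(i := b # B)"
      have st: "cycle_state n k (transpose ?y b \<circ> \<pi>) (w(?y := A)) I ?c"
        by (rule active_split_state[OF state active(1)]) (simp_all only: split oX setX)
      have "C b = ?T A * R * involution_sum I (\<lambda>j. cycle_count (?c j)) (\<lambda>j l. pair_count (?c j) (?c l))"
        unfolding C_def by (subst Suc.IH[OF st]) (simp only: prodw)
      also have "involution_sum I (\<lambda>j. cycle_count (?c j)) (\<lambda>j l. pair_count (?c j) (?c l))
          = cycle_count (?c i) * involution_sum (I - {i}) (\<lambda>j. cycle_count (?c j)) (\<lambda>j l. pair_count (?c j) (?c l))
          + (\<Sum>j\<in>I - {i}. pair_count (?c i) (?c j) * involution_sum (I - {i, j}) (\<lambda>j. cycle_count (?c j)) (\<lambda>j l. pair_count (?c j) (?c l)))"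
      proof (rule involution_sum_insert[OF facts(3) active(1)])
        fix j l assume jl: "j \<in> I" "l \<in> I"
        have bX: "set (b # B) \<subseteq> set (cyc i)" "distinct (b # B)"
          unfolding bB using setX dist by (auto dest: in_set_dropD)
        show "pair_count (?c j) (?c l) = pair_count (?c l) (?c j)"
        proof (cases "j = l")
          case False
          have "distinct (?c j @ ?c l)"
            using facts(6)[OF jl(1)] facts(6)[OF jl(2)] facts(8)[OF jl False] bX disj[of j] disj[of l] jl False
            by (auto simp: orbit_list_def)
          then show ?thesis by (rule pair_count_commute)
        qed simp
      qed
      also have "involution_sum (I - {i}) (\<lambda>j. cycle_count (?c j)) (\<lambda>j l. pair_count (?c j) (?c l)) = Z1"
        unfolding Z1_def by (rule involution_sum_cong) auto
      also have "(\<Sum>j\<in>I - {i}. pair_count (?c i) (?c j) * involution_sum (I - {i, j}) (\<lambda>j. cycle_count (?c j)) (\<lambda>j l. pair_count (?c j) (?c l)))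
          = (\<Sum>j\<in>I - {i}. pair_count (b # B) (cyc j) * Z2 j)"
        unfolding Z2_def by (intro sum.cong refl arg_cong2[where f = "(*)"] involution_sum_cong) auto
      finally show ?thesis
        by (simp add: b_def[symmetric] bB A_def distrib_left sum_distrib_left mult_ac)
    qed
    \<comment> \<open>A partner in another active cycle: the two cycles merge.\<close>
    have Cc: "(\<Sum>b\<in>set (cyc j). C b) = attach_count X (cyc j) * (R * Z2 j)" if j: "j \<in> I - {i}" for j
    proof -
      have "C (cyc j ! l) = ?T (X @ rotate l (cyc j)) * (R * Z2 j)" if l: "l < length (cyc j)" for l
      proof -
        define b where "b = cyc j ! l"
        define B where "B = tl (rotate l (cyc j))"
        have ne: "cyc j \<noteq> []" using l by auto
        have bB: "rotate l (cyc j) = b # B"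
          unfolding b_def B_def using hd_rotate_conv_nth[OF ne, of l] l ne by (metis list.collapse mod_less rotate_is_Nil_conv)
        have "orbit_list \<pi> (b # B)" unfolding bB[symmetric] using facts(6) j by (intro orbit_list_rotate) auto
        moreover have "set (b # B) = set (cyc j)" unfolding bB[symmetric] by simp
        ultimately have st: "cycle_state n k (transpose ?y b \<circ> \<pi>) (w(?y := X @ b # B)) (I - {i, j}) cyc"
          using j by (intro active_merge_state[OF state active(1) _ _ oX setX]) auto
        show ?thesis
          unfolding b_def[symmetric] C_def Suc.IH[OF st] prodw bB Z2_def by (simp add: mult_ac)
      qed
      then have "(\<Sum>l<length (cyc j). C (cyc j ! l)) = (\<Sum>l<length (cyc j). ?T (X @ rotate l (cyc j)) * (R * Z2 j))"
        by (intro sum.cong) auto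
      moreover have "distinct (cyc j)" using facts(6)[of j] j by (simp add: orbit_list_def)
      ultimately show ?thesis by (simp add: sum_set_nth attach_count_def sum_distrib_right)
    qed
    \<comment> \<open>A partner in a rooted cycle would join its root to \<open>k + 1\<close>.\<close>
    have "(\<Sum>b\<in>{1..n}. C b) = (\<Sum>b\<in>(\<Union>j\<in>I. set (cyc j)). C b)"
    proof (rule sum.mono_neutral_right)
      show "(\<Union>j\<in>I. set (cyc j)) \<subseteq> {1..n}" using cn by blast
      show "\<forall>b\<in>{1..n} - (\<Union>j\<in>I. set (cyc j)). C b = 0"
      proof
        fix b assume b: "b \<in> {1..n} - (\<Union>j\<in>I. set (cyc j))"
        have "\<exists>r. ?y < r \<and> r \<le> n \<and> b \<in> set (r # w r)"
        proof (cases "b \<le> ?y")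
          case True
          then have "b \<in> (\<Union>r\<in>{?y<..n}. set (w r)) \<union> (\<Union>i\<in>I. set (cyc i))"
            using b by (intro subsetD[OF facts(9)]) auto
          then show ?thesis using b by auto
        next
          case False
          then show ?thesis using b by (intro exI[of _ b]) auto
        qed
        then obtain r where r: "?y < r" "r \<le> n" "b \<in> set (r # w r)" by blast
        show "C b = 0" unfolding C_def by (rule active_vanish[OF state active r])
      qed
    qed simp
    also have "\<dots> = (\<Sum>j\<in>I. \<Sum>b\<in>set (cyc j). C b)"
      by (rule sum.UNION_disjoint) (use facts(3,8) in auto)
    also have "\<dots> = (\<Sum>b\<in>set (cyc i). C b) + (\<Sum>j\<in>I - {i}. \<Sum>b\<in>set (cyc j). C b)"
      by (rule sum.remove[OF facts(3) active(1)])
    also have "(\<Sum>j\<in>I - {i}. \<Sum>b\<in>set (cyc j). C b) = (\<Sum>j\<in>I - {i}. attach_count X (cyc j) * (R * Z2 j))"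
      by (intro sum.cong refl Cc)
    also have "(\<Sum>b\<in>set (cyc i). C b) = C ?y + (\<Sum>l<length X. C (X ! l))"
      using dist by (simp add: setX[symmetric] sum_set_nth)
    also have "(\<Sum>l<length X. C (X ! l)) = (\<Sum>l<length X. ?T (take l X) * cycle_count (drop l X) * (R * Z1)
        + (\<Sum>j\<in>I - {i}. ?T (take l X) * pair_count (drop l X) (cyc j) * (R * Z2 j)))"
      by (intro sum.cong refl CX) simp
    also have "\<dots> = proper_split_sum (\<lambda>A B. ?T A * cycle_count B) X * (R * Z1)
        + (\<Sum>j\<in>I - {i}. proper_split_sum (\<lambda>A B. ?T A * pair_count B (cyc j)) X * (R * Z2 j))"
      unfolding sum.distrib by (subst sum.swap) (simp add: proper_split_sum_def sum_distrib_right)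
    finally have "factorization_count n (Suc k) \<pi>
        = (?T X + proper_split_sum (\<lambda>A B. ?T A * cycle_count B) X) * (R * Z1)
        + (\<Sum>j\<in>I - {i}. (attach_count X (cyc j) + proper_split_sum (\<lambda>A B. ?T A * pair_count B (cyc j)) X) * (R * Z2 j))"
      unfolding count Cy by (simp add: distrib_right sum.distrib)
    also have "?T X + proper_split_sum (\<lambda>A B. ?T A * cycle_count B) X = ?f i"
      unfolding c by (subst cycle_count_at_max[OF lt]) (simp add: split_sum_eq_proper X_def)
    also have "(\<Sum>j\<in>I - {i}. (attach_count X (cyc j) + proper_split_sum (\<lambda>A B. ?T A * pair_count B (cyc j)) X) * (R * Z2 j))
        = (\<Sum>j\<in>I - {i}. ?g i j * (R * Z2 j))"
    proof (intro sum.cong refl)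
      fix j assume j: "j \<in> I - {i}"
      have "x < ?y" if "x \<in> set (cyc j)" for x
      proof -
        have "x \<noteq> ?y" using that disj[OF j] active(2) by blast
        then show ?thesis using subsetD[OF facts(7)[of j], of x] j that by simp
      qed
      then have "\<forall>x\<in>set P \<union> set Q \<union> set (cyc j). x < ?y" using lt by blast
      moreover have "cyc j \<noteq> []" using facts(6)[of j] j by (auto simp: orbit_list_def)
      ultimately show "(attach_count X (cyc j) + proper_split_sum (\<lambda>A B. ?T A * pair_count B (cyc j)) X) * (R * Z2 j) = ?g i j * (R * Z2 j)"
        unfolding c X_def by (subst pair_count_at_max(1)) auto
    qed
    also have "?f i * (R * Z1) + (\<Sum>j\<in>I - {i}. ?g i j * (R * Z2 j)) = R * involution_sum I ?f ?g"
      by (subst involution_sum_insert[OF facts(3) active(1) sym])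
         (auto simp: Z1_def Z2_def distrib_left sum_distrib_left mult_ac)
    finally show ?thesis by (simp add: R_def)
  qed
qed

section \<open>Cycle representations\<close>


lemma foldr_comp_Cons: "foldr (\<circ>) (f # fs) id = f \<circ> foldr (\<circ>) fs id"
  by simp

lemma foldr_cycles_outside:
  "x \<notin> set (concat cs) \<Longrightarrow> foldr (\<circ>) (map cycle_of_list cs) id x = x"
  by (induction cs) (simp_all add: id_outside_supp)

lemma foldr_cycles_inside:
  assumes "distinct (concat cs)" "c \<in> set cs" "x \<in> set c"
  shows "foldr (\<circ>) (map cycle_of_list cs) id x = cycle_of_list c x"
  using assms
proof (induction cs)
  case (Cons d cs)
  show ?case
  proof (cases "c \<in> set cs")
    case True
    have "cycle_of_list c x \<in> set c" using Cons.prems(3) cycle_permutes by (metis permutes_in_image)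
    then have "cycle_of_list c x \<notin> set d" using Cons.prems True by auto
    then show ?thesis using Cons True by (simp add: id_outside_supp)
  next
    case False
    then have "c = d" using Cons.prems by simp
    then have "x \<notin> set (concat cs)" using Cons.prems by auto
    then have outside: "foldr (\<circ>) (map cycle_of_list cs) id x = x" by (rule foldr_cycles_outside)
    show ?thesis unfolding \<open>c = d\<close> list.map foldr_comp_Cons
      using arg_cong[OF outside, of "cycle_of_list d"] by (rule trans[OF o_apply])
  qed
qed simp

lemma foldr_cycles_permutes:
  fixes cs :: "'a list list"
  shows "foldr (\<circ>) (map cycle_of_list cs) id permutes set (concat cs)"
proof (induction cs)
  case Nil
  have "foldr (\<circ>) (map cycle_of_list ([] :: 'a list list)) id = id" by simp
  then show ?case using permutes_id[of "set (concat ([] :: 'a list list))"] by metis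
next
  case (Cons c cs)
  have "cycle_of_list c permutes set c \<union> set (concat cs)"
    by (rule permutes_subset[OF cycle_permutes]) auto
  moreover have "foldr (\<circ>) (map cycle_of_list cs) id permutes set c \<union> set (concat cs)"
    by (rule permutes_subset[OF Cons.IH]) auto
  ultimately have "cycle_of_list c \<circ> foldr (\<circ>) (map cycle_of_list cs) id permutes set c \<union> set (concat cs)"
    by (intro permutes_compose)
  then show ?case unfolding list.map foldr_comp_Cons concat.simps set_append .
qed

lemma disjoint_cycle_rep_orbit_list:
  assumes "disjoint_cycle_rep n \<pi> cs" "c \<in> set cs"
  shows "orbit_list \<pi> c"
proof -
  have d: "distinct (concat cs)" and ne: "c \<noteq> []" and \<pi>: "\<pi> = foldr (\<circ>) (map cycle_of_list cs) id"
    using assms by (auto simp: disjoint_cycle_rep_def)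
  have dc: "distinct c" using d assms(2) by (metis distinct_concat_iff)
  have "map \<pi> c = map (cycle_of_list c) c"
    unfolding \<pi> using foldr_cycles_inside[OF d assms(2)] by simp
  also have "\<dots> = rotate1 c" using cyclic_rotation[OF dc, of 1] by simp
  finally show ?thesis using ne dc by (simp add: orbit_list_def)
qed

lemma distinct_concat_disjoint:
  assumes "distinct (concat cs)" "i < length cs" "j < length cs" "i \<noteq> j"
  shows "set (cs ! i) \<inter> set (cs ! j) = {}"
proof -
  have "set (cs ! i) \<inter> set (cs ! j) = {}" if "i < j" "j < length cs" for i j
  proof -
    have "cs = take i cs @ cs ! i # drop (Suc i) cs" using that by (intro id_take_nth_drop) auto
    then have "distinct (concat (take i cs @ cs ! i # drop (Suc i) cs))" using assms(1) by simp
    moreover have "cs ! j = drop (Suc i) cs ! (j - Suc i)" using that by simp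
    then have "cs ! j \<in> set (drop (Suc i) cs)" using that by (metis in_set_conv_nth length_drop diff_less_mono Suc_leI)
    ultimately show ?thesis by auto
  qed
  then show ?thesis using assms(2,3,4) by (metis Int_commute linorder_neqE_nat)
qed

lemma multiplicity_eq_involution_sum:
  assumes rep: "disjoint_cycle_rep n \<pi> cs" and \<pi>: "\<pi> permutes {1..n}"
  shows "multiplicity n \<pi> = involution_sum {1..length cs} (\<lambda>i. cycle_count (cs ! (i - 1)))
     (\<lambda>i j. pair_count (cs ! (i - 1)) (cs ! (j - 1)))"
proof -
  have d: "distinct (concat cs)" and cov: "set (concat cs) = {1..n}"
    using rep by (auto simp: disjoint_cycle_rep_def)
  have mem: "cs ! (i - 1) \<in> set cs" if "i \<in> {1..length cs}" for i using that by auto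
  have "cycle_state n n \<pi> (\<lambda>_. []) {1..length cs} (\<lambda>i. cs ! (i - 1))"
    unfolding cycle_state_def
  proof (intro conjI ballI allI impI)
    fix i assume i: "i \<in> {1..length cs}"
    show "orbit_list \<pi> (cs ! (i - 1))" by (rule disjoint_cycle_rep_orbit_list[OF rep mem[OF i]])
    show "set (cs ! (i - 1)) \<subseteq> {1..n}" using cov mem[OF i] by auto
    fix j assume "j \<in> {1..length cs}" "i \<noteq> j"
    then show "set (cs ! (i - 1)) \<inter> set (cs ! (j - 1)) = {}"
      using i by (intro distinct_concat_disjoint[OF d]) auto
  next
    show "{1..n} \<subseteq> (\<Union>r\<in>{n<..n}. set []) \<union> (\<Union>i\<in>{1..length cs}. set (cs ! (i - 1)))"
    proof
      fix x assume "x \<in> {1..n}"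
      then have "x \<in> set (concat cs)" using cov by simp
      then obtain c where "c \<in> set cs" "x \<in> set c" by auto
      then obtain j where "j < length cs" "x \<in> set (cs ! j)" by (metis in_set_conv_nth)
      then show "x \<in> (\<Union>r\<in>{n<..n}. set []) \<union> (\<Union>i\<in>{1..length cs}. set (cs ! (i - 1)))"
        by (auto intro!: bexI[of _ "Suc j"])
    qed
  qed (use \<pi> in auto)
  from factorization_count_eq[OF this] show ?thesis
    by (simp add: Defs.multiplicity_def factorization_count_def)
qed

definition stacked_cycles :: "nat list list \<Rightarrow> bool" where
  "stacked_cycles cs \<longleftrightarrow> (\<forall>c\<in>set cs. \<exists>i. descending (rotate i c)) \<and>
     (\<forall>i<length cs. \<forall>j<length cs. i \<noteq> j \<longrightarrow> stacked (cs ! i) (cs ! j) \<or> stacked (cs ! j) (cs ! i))"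

text \<open>
  With all elements active, the multiplicity is an involution sum whose weights are bounded by the
  extremal ones; it reaches the bound only if all weights do.
\<close>

lemma multiplicity_bound:
  assumes rep: "disjoint_cycle_rep n \<pi> cs" and \<pi>: "\<pi> permutes {1..n}"
  defines "bound \<equiv> involution_sum {1..length cs} (\<lambda>i. cat (length (cs ! (i - 1))))
     (\<lambda>i j. pair_max (length (cs ! (i - 1))) (length (cs ! (j - 1))))"
  shows "multiplicity n \<pi> \<le> bound" "multiplicity n \<pi> = bound \<longleftrightarrow> stacked_cycles cs"
proof -
  let ?I = "{1..length cs}" and ?c = "\<lambda>i. cs ! (i - 1)"
  have d: "distinct (concat cs)" and ne: "[] \<notin> set cs" using rep by (auto simp: disjoint_cycle_rep_def)
  have mem: "?c i \<in> set cs" if "i \<in> ?I" for i using that by auto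
  have dist: "distinct (?c i)" if "i \<in> ?I" for i
    using disjoint_cycle_rep_orbit_list[OF rep mem[OF that]] by (simp add: orbit_list_def)
  have distp: "distinct (?c i @ ?c j)" if "i \<in> ?I" "j \<in> ?I" "i \<noteq> j" for i j
  proof -
    have "i - 1 < length cs" "j - 1 < length cs" "i - 1 \<noteq> j - 1" using that by auto
    from distinct_concat_disjoint[OF d this] show ?thesis using dist[OF that(1)] dist[OF that(2)] by simp
  qed
  have nonempty: "?c i \<noteq> []" if "i \<in> ?I" for i using mem[OF that] ne by auto
  have f: "cycle_count (?c i) \<le> cat (length (?c i))"
    "cycle_count (?c i) = cat (length (?c i)) \<longleftrightarrow> (\<exists>k. descending (rotate k (?c i)))" if "i \<in> ?I" for i
    using cycle_count_bound[OF dist[OF that]] by auto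
  have g: "pair_count (?c i) (?c j) \<le> pair_max (length (?c i)) (length (?c j))"
    "pair_count (?c i) (?c j) = pair_max (length (?c i)) (length (?c j)) \<longleftrightarrow> stacked (?c i) (?c j) \<or> stacked (?c j) (?c i)"
    if "i \<in> ?I" "j \<in> ?I" "i \<noteq> j" for i j
    using pair_count_bound[OF distp[OF that] nonempty[OF that(1)] nonempty[OF that(2)]] by auto
  have sym: "pair_count (?c i) (?c j) = pair_count (?c j) (?c i)" if "i \<in> ?I" "j \<in> ?I" for i j
    using pair_count_commute[OF distp[OF that]] by (cases "i = j") auto
  note mult = multiplicity_eq_involution_sum[OF rep \<pi>]
  show "multiplicity n \<pi> \<le> bound"
    unfolding mult bound_def by (intro involution_sum_mono f g) auto
  show "multiplicity n \<pi> = bound \<longleftrightarrow> stacked_cycles cs"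
  proof
    assume eq: "multiplicity n \<pi> = bound"
    note eqs = involution_sum_eq_bound[OF _ f(1) g(1) _ sym _ eq[unfolded mult bound_def]]
    have feq: "cycle_count (?c i) = cat (length (?c i))" if "i \<in> ?I" for i
      by (rule eqs(1)) (use that in \<open>auto simp: pair_max_commute\<close>)
    have geq: "pair_count (?c i) (?c j) = pair_max (length (?c i)) (length (?c j))"
      if "i \<in> ?I" "j \<in> ?I" "i \<noteq> j" for i j
      by (rule eqs(2)) (use that in \<open>auto simp: pair_max_commute\<close>)
    show "stacked_cycles cs"
      unfolding stacked_cycles_def
    proof (intro conjI ballI allI impI)
      fix c assume "c \<in> set cs"
      then obtain i where "i < length cs" "c = cs ! i" by (metis in_set_conv_nth)
      then show "\<exists>i. descending (rotate i c)" using feq[of "Suc i"] f(2)[of "Suc i"] by auto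
    next
      fix i j assume "i < length cs" "j < length cs" "i \<noteq> j"
      then show "stacked (cs ! i) (cs ! j) \<or> stacked (cs ! j) (cs ! i)"
        using geq[of "Suc i" "Suc j"] g(2)[of "Suc i" "Suc j"] by auto
    qed
  next
    assume st: "stacked_cycles cs"
    show "multiplicity n \<pi> = bound"
      unfolding mult bound_def
    proof (rule involution_sum_cong)
      fix i assume i: "i \<in> ?I"
      then show "cycle_count (?c i) = cat (length (?c i))"
        using st mem[OF i] f(2)[OF i] unfolding stacked_cycles_def by blast
      fix j assume j: "j \<in> ?I" "i \<noteq> j"
      then have "i - 1 < length cs" "j - 1 < length cs" "i - 1 \<noteq> j - 1" using i by auto
      then show "pair_count (?c i) (?c j) = pair_max (length (?c i)) (length (?c j))"
        using st g(2)[OF i j] unfolding stacked_cycles_def by blast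
    qed
  qed
qed

text \<open>
  Rotated so that both start with \<open>x\<close>, the two lists are the orbit of \<open>x\<close> under \<open>\<pi>\<close>, and neither can
  go around before the other does.
\<close>

lemma orbit_list_rotate_eq:
  assumes c: "orbit_list \<pi> c" and d: "orbit_list \<pi> d" and x: "x \<in> set c" "x \<in> set d"
  shows "\<exists>l. d = rotate l c"
proof -
  obtain C k where C: "orbit_list \<pi> (x # C)" "rotate k c = x # C" using orbit_list_start[OF c x(1)] by metis
  obtain D m where D: "orbit_list \<pi> (x # D)" "rotate m d = x # D" using orbit_list_start[OF d x(2)] by metis
  have close: "(\<pi> ^^ length e) (e ! 0) = e ! 0" if "orbit_list \<pi> e" for e
  proof -
    have "e \<noteq> []" using that by (simp add: orbit_list_def)
    then obtain l where l: "length e = Suc l" by (cases e) auto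
    have "(\<pi> ^^ Suc l) (e ! 0) = \<pi> (e ! l)" using orbit_list_nth[OF that, of l] l by simp
    also have "\<dots> = e ! 0" using orbit_list_step[OF that, of l] l by simp
    finally show ?thesis by (simp add: l)
  qed
  have not_shorter: "\<not> length e < length e'" if "orbit_list \<pi> e" "orbit_list \<pi> e'" "e ! 0 = e' ! 0" for e e'
  proof
    assume less: "length e < length e'"
    then have "e' ! length e = e' ! 0" using orbit_list_nth[OF that(2) less] close[OF that(1)] that(3) by simp
    then show False using that less unfolding orbit_list_def
      by (metis length_greater_0_conv nth_eq_iff_index_eq less_trans neq0_conv)
  qed
  have "length (x # C) = length (x # D)"
    using not_shorter[OF C(1) D(1)] not_shorter[OF D(1) C(1)] by simp
  then have "x # C = x # D"
  proof (rule nth_equalityI)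
    fix i assume "i < length (x # C)"
    moreover then have "i < length (x # D)" using \<open>length (x # C) = length (x # D)\<close> by simp
    ultimately show "(x # C) ! i = (x # D) ! i"
      using orbit_list_nth[OF C(1), of i] orbit_list_nth[OF D(1), of i] by simp
  qed
  then have "rotate m d = rotate k c" using C D by simp
  moreover obtain i where "rotate i (rotate m d) = d"
    using ex_rotate_rotate[of "\<lambda>e. e = d" m d] by (metis rotate0 id_apply)
  ultimately show ?thesis by (metis rotate_rotate)
qed

lemma descending_interval_list:
  assumes "descending c" "c \<noteq> []" "\<forall>x\<in>set c. 1 \<le> x"
    and convex: "\<And>x y z. x \<in> set c \<Longrightarrow> z \<in> set c \<Longrightarrow> x < y \<Longrightarrow> y < z \<Longrightarrow> y \<in> set c"
  shows "\<exists>s. c = rev [s + 1..<s + length c + 1]"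
proof -
  define a b where "a = Min (set c)" and "b = Max (set c)"
  have ab: "a \<in> set c" "b \<in> set c" "\<forall>x\<in>set c. a \<le> x \<and> x \<le> b"
    using assms(2) Min_in[of "set c"] Max_in[of "set c"] Min_le[of "set c"] Max_ge[of "set c"]
    unfolding a_def b_def by blast+
  have set: "set c = {a..b}"
  proof
    show "{a..b} \<subseteq> set c"
    proof
      fix y assume y: "y \<in> {a..b}"
      then consider "y = a" | "y = b" | "a < y" "y < b" by force
      then show "y \<in> set c" by cases (simp_all add: ab convex[OF ab(1,2)])
    qed
  qed (use ab in auto)
  have "sorted_wrt (<) (rev c)" using assms(1) by (simp add: sorted_wrt_rev)
  then have s: "sorted (rev c)" "distinct (rev c)" by (simp_all add: strict_sorted_iff)
  have len: "length c = Suc b - a" using distinct_card[of c] s set by simp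
  have "a \<le> b" using ab by auto
  moreover have "1 \<le> a" using assms(3) ab by auto
  ultimately have ends: "a - 1 + 1 = a" "a - 1 + length c + 1 = Suc b" using len by auto
  have "rev c = [a..<Suc b]"
  proof (rule sorted_distinct_set_unique)
    show "sorted (rev c)" "distinct (rev c)" by (fact s)+
    show "sorted [a..<Suc b]" "distinct [a..<Suc b]" by (rule sorted_upt distinct_upt)+
    show "set (rev c) = set [a..<Suc b]"
      unfolding set_rev set set_upt by (rule atLeastLessThanSuc_atLeastAtMost[symmetric])
  qed
  then have "c = rev [a..<Suc b]" by (metis rev_rev_ident)
  then have "c = rev [a - 1 + 1..<a - 1 + length c + 1]" unfolding ends .
  then show ?thesis ..
qed

lemma distinct_concat_map:
  assumes "\<And>c. c \<in> set cs \<Longrightarrow> set (f c) = set c \<and> distinct (f c) = distinct c"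
  shows "set (concat (map f cs)) = set (concat cs)" "distinct (concat (map f cs)) = distinct (concat cs)"
proof -
  show "set (concat (map f cs)) = set (concat cs)" using assms by simp
  show "distinct (concat (map f cs)) = distinct (concat cs)"
    using assms by (induction cs) auto
qed

lemma foldr_cycles_rotate:
  assumes "\<And>c. c \<in> set cs \<Longrightarrow> distinct c"
  shows "foldr (\<circ>) (map cycle_of_list (map (\<lambda>c. rotate (g c) c) cs)) id = foldr (\<circ>) (map cycle_of_list cs) id"
proof -
  have "map cycle_of_list (map (\<lambda>c. rotate (g c) c) cs) = map cycle_of_list cs"
    using cycle_of_list_rotate_independent[OF assms] by auto
  then show ?thesis by (simp only:)
qed

lemma descending_rev_upt: "descending (rev [i..<j])"
  by (simp add: sorted_wrt_rev)

text \<open>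
  If all pairs of cycles are stacked, no element of one cycle lies between two elements of another,
  so every cycle fills an interval. Conversely, any other representation of \<open>\<pi>\<close> has the same cycles
  up to rotation, and disjoint intervals are comparable.
\<close>

lemma stacked_cycles_iff_descending_interval_cycles:
  assumes rep: "disjoint_cycle_rep n \<pi> cs"
  shows "stacked_cycles cs \<longleftrightarrow> descending_interval_cycles n \<pi>"
proof
  have d: "distinct (concat cs)" and ne: "[] \<notin> set cs" and cov: "set (concat cs) = {1..n}"
    and \<pi>: "\<pi> = foldr (\<circ>) (map cycle_of_list cs) id"
    using rep by (auto simp: disjoint_cycle_rep_def)
  have dist: "distinct c" if "c \<in> set cs" for c
    using disjoint_cycle_rep_orbit_list[OF rep that] by (simp add: orbit_list_def)
  {
    assume st: "stacked_cycles cs"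
    then have "\<forall>c\<in>set cs. \<exists>i. descending (rotate i c)" by (simp add: stacked_cycles_def)
    then obtain g where g: "\<forall>c\<in>set cs. descending (rotate (g c) c)" by (rule bchoice[THEN exE])
    let ?cs = "map (\<lambda>c. rotate (g c) c) cs"
    have "disjoint_cycle_rep n \<pi> ?cs"
      unfolding disjoint_cycle_rep_def
    proof (intro conjI)
      show "[] \<notin> set ?cs"
      proof
        assume "[] \<in> set ?cs"
        then have "[] \<in> (\<lambda>c. rotate (g c) c) ` set cs" by simp
        then obtain c where "[] = rotate (g c) c" "c \<in> set cs" by (rule imageE)
        then show False using ne by (metis rotate_is_Nil_conv)
      qed
      show "distinct (concat ?cs)" "set (concat ?cs) = {1..n}"
        using distinct_concat_map[of cs "\<lambda>c. rotate (g c) c"] d cov by auto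
      show "\<pi> = foldr (\<circ>) (map cycle_of_list ?cs) id"
        using foldr_cycles_rotate[of cs g] dist \<pi> by simp
    qed
    moreover have "\<exists>s. c' = rev [s + 1..<s + length c' + 1]" if c': "c' \<in> set ?cs" for c'
    proof -
      obtain c where c: "c \<in> set cs" "c' = rotate (g c) c" using c' by auto
      obtain i where i: "i < length cs" "c = cs ! i" using c(1) by (metis in_set_conv_nth)
      have sc: "set c' = set c" by (simp add: c)
      show ?thesis
      proof (rule descending_interval_list)
        show "descending c'" using g c by simp
        show "c' \<noteq> []" using ne c by auto
        have "set c \<subseteq> {1..n}" using c(1) cov by auto
        then show "\<forall>x\<in>set c'. 1 \<le> x" using sc by auto
        fix x y z assume xyz: "x \<in> set c'" "z \<in> set c'" "x < y" "y < z"
        then have "y \<in> {1..n}" using \<open>set c \<subseteq> {1..n}\<close> sc by auto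
        then have "y \<in> set (concat cs)" using cov by simp
        then obtain e where "e \<in> set cs" "y \<in> set e" by auto
        then obtain j where j: "j < length cs" "y \<in> set (cs ! j)" by (metis in_set_conv_nth)
        show "y \<in> set c'"
        proof (cases "i = j")
          case True
          then show ?thesis using sc i j by simp
        next
          case False
          then have "stacked c (cs ! j) \<or> stacked (cs ! j) c"
            using st i j unfolding stacked_cycles_def by blast
          then have "y < x \<or> z < y"
            using xyz(1,2) j(2) unfolding sc by (auto simp: stacked_def sorted_wrt_append)
          then show ?thesis using xyz by auto
        qed
      qed
    qed
    ultimately show "descending_interval_cycles n \<pi>"
      unfolding descending_interval_cycles_def by blast
  next
    assume "descending_interval_cycles n \<pi>"
    then obtain ds where ds: "disjoint_cycle_rep n \<pi> ds"
        "\<And>c. c \<in> set ds \<Longrightarrow> \<exists>s. c = rev [s + 1..<s + length c + 1]"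
      unfolding descending_interval_cycles_def by blast
    have form: "\<exists>l s. rotate l c = rev [s + 1..<s + length c + 1]" if c: "c \<in> set cs" for c
    proof -
      have "c \<noteq> []" using c ne by auto
      then obtain x where x: "x \<in> set c" using hd_in_set by blast
      then have "x \<in> set (concat cs)" using c by auto
      then have "x \<in> set (concat ds)" using cov ds(1) by (simp only: disjoint_cycle_rep_def)
      then obtain e where e: "e \<in> set ds" "x \<in> set e" by auto
      obtain l where "e = rotate l c"
        using orbit_list_rotate_eq[OF disjoint_cycle_rep_orbit_list[OF rep c]
          disjoint_cycle_rep_orbit_list[OF ds(1) e(1)] x e(2)] by blast
      then show ?thesis using ds(2)[OF e(1)] by (metis length_rotate)
    qed
    show "stacked_cycles cs"
      unfolding stacked_cycles_def
    proof (intro conjI ballI allI impI)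
      fix c assume "c \<in> set cs"
      then show "\<exists>i. descending (rotate i c)" using form descending_rev_upt by metis
    next
      fix i j assume ij: "i < length cs" "j < length cs" "i \<noteq> j"
      obtain l s where l: "rotate l (cs ! i) = rev [s + 1..<s + length (cs ! i) + 1]" using form ij by force
      obtain m t where m: "rotate m (cs ! j) = rev [t + 1..<t + length (cs ! j) + 1]" using form ij by force
      have sets: "set (cs ! i) = {s + 1..<s + length (cs ! i) + 1}" "set (cs ! j) = {t + 1..<t + length (cs ! j) + 1}"
        using arg_cong[OF l, of set] arg_cong[OF m, of set] by (simp_all del: upt_Suc)
      have pos: "0 < length (cs ! i)" "0 < length (cs ! j)" using ij ne by (metis length_greater_0_conv nth_mem)+
      have "{s + 1..<s + length (cs ! i) + 1} \<inter> {t + 1..<t + length (cs ! j) + 1} = {}"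
        using distinct_concat_disjoint[OF d ij] unfolding sets by (simp add: sets)
      \<comment> \<open>The larger of the two lower ends would be a common element.\<close>
      then have "max s t + 1 \<notin> {s + 1..<s + length (cs ! i) + 1} \<inter> {t + 1..<t + length (cs ! j) + 1}" by blast
      then consider "s + length (cs ! i) \<le> t" | "t + length (cs ! j) \<le> s" using pos by (auto simp: max_def split: if_splits)
      then show "stacked (cs ! i) (cs ! j) \<or> stacked (cs ! j) (cs ! i)"
      proof cases
        case 1
        then have "descending (rotate m (cs ! j) @ rotate l (cs ! i))"
          unfolding l m by (auto simp: sorted_wrt_append descending_rev_upt)
        then show ?thesis unfolding stacked_def by blast
      next
        case 2
        then have "descending (rotate l (cs ! i) @ rotate m (cs ! j))"
          unfolding l m by (auto simp: sorted_wrt_append descending_rev_upt)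
        then show ?thesis unfolding stacked_def by blast
      qed
    qed
  }
qed

text \<open>
  The maximum is a statement about the class as a whole, so the class has to contain an extremal
  permutation: place consecutive descending intervals of the prescribed lengths.
\<close>

primrec interval_cycles :: "nat \<Rightarrow> nat list \<Rightarrow> nat list list" where
  "interval_cycles s [] = []"
| "interval_cycles s (l # ls) = rev [s + 1..<s + l + 1] # interval_cycles (s + l) ls"

lemma interval_cycles_facts:
  "map length (interval_cycles s ls) = ls"
  "set (concat (interval_cycles s ls)) = {s + 1..s + sum_list ls}"
  "distinct (concat (interval_cycles s ls))"
  "c \<in> set (interval_cycles s ls) \<Longrightarrow> \<exists>t. c = rev [t + 1..<t + length c + 1]"
proof (induction ls arbitrary: s)
  case (Cons l ls)
  { case 1 show ?case using Cons.IH(1) by (simp del: upt_Suc) }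
  { case 2 show ?case using Cons.IH(2)[of "s + l"] by auto }
  { case 3 show ?case using Cons.IH(2,3)[of "s + l"] by auto }
  { case 4 then show ?case using Cons.IH(4)[of "s + l"] by (auto simp del: upt_Suc intro: exI[of _ s]) }
qed simp_all

lemma ex_descending_interval_cycles:
  assumes "\<forall>l\<in>set Ls. 1 \<le> l" "sum_list Ls = n"
  shows "\<exists>\<pi>\<in>cycle_type_class n Ls. descending_interval_cycles n \<pi>"
proof -
  define cs where "cs = interval_cycles 0 Ls"
  define \<pi> where "\<pi> = foldr (\<circ>) (map cycle_of_list cs) id"
  have len: "map length cs = Ls" and set: "set (concat cs) = {1..n}"
    using interval_cycles_facts(1,2)[of 0 Ls] assms(2) by (simp_all add: cs_def)
  have "[] \<notin> set cs"
  proof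
    assume "[] \<in> set cs"
    then have "0 \<in> set (map length cs)" by force
    then show False using assms(1) len by force
  qed
  then have rep: "disjoint_cycle_rep n \<pi> cs"
    using set interval_cycles_facts(3)[of 0 Ls] by (simp add: disjoint_cycle_rep_def \<pi>_def cs_def)
  have "\<pi> permutes {1..n}" unfolding \<pi>_def set[symmetric] by (rule foldr_cycles_permutes)
  then have "\<pi> \<in> cycle_type_class n Ls" using rep len by (auto simp: cycle_type_class_def)
  moreover have "descending_interval_cycles n \<pi>"
    unfolding descending_interval_cycles_def using rep interval_cycles_facts(4)[of _ 0 Ls] unfolding cs_def by blast
  ultimately show ?thesis by blast
qed

section \<open>The maximum over a conjugacy class\<close>

theorem corollary15:
  fixes n q :: nat and L :: "nat \<Rightarrow> nat" and K :: "(nat \<Rightarrow> nat) set"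
  assumes L_pos: "\<And>i. i \<in> {1..q} \<Longrightarrow> L i \<ge> 1"
    and L_sum: "(\<Sum>i = 1..q. L i) = n"
  defines "K \<equiv> cycle_type_class n (map L [1..<q + 1])"
  shows "{\<pi> \<in> K. \<forall>\<sigma> \<in> K. multiplicity n \<sigma> \<le> multiplicity n \<pi>}
           = {\<pi> \<in> K. descending_interval_cycles n \<pi>} \<and>
         (\<forall>\<pi> \<in> K. (\<forall>\<sigma> \<in> K. multiplicity n \<sigma> \<le> multiplicity n \<pi>) \<longrightarrow>
           real (multiplicity n \<pi>) =
             (\<Sum>\<chi> \<in> involutions {1..q}.
                (\<Prod>i \<in> {i \<in> {1..q}. \<chi> i = i}. catalan (L i)) *
                (\<Prod>(i, j) \<in> {(i, j) \<in> {1..q} \<times> {1..q}. i < j \<and> \<chi> i = j}. G (L i) (L j))))"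
proof -
  define bound where "bound = involution_sum {1..q} (\<lambda>i. cat (L i)) (\<lambda>i j. pair_max (L i) (L j))"
  have K: "multiplicity n \<pi> \<le> bound \<and> (multiplicity n \<pi> = bound \<longleftrightarrow> descending_interval_cycles n \<pi>)"
    if "\<pi> \<in> K" for \<pi>
  proof -
    obtain cs where \<pi>: "\<pi> permutes {1..n}" and rep: "disjoint_cycle_rep n \<pi> cs"
        and len: "map length cs = map L [1..<q + 1]"
      using \<open>\<pi> \<in> K\<close> by (auto simp: K_def cycle_type_class_def)
    have q: "length cs = q" using arg_cong[OF len, of length] by simp
    have L: "length (cs ! (i - 1)) = L i" if "i \<in> {1..q}" for i
    proof -
      have "length (cs ! (i - 1)) = map length cs ! (i - 1)" using that q by auto
      also have "\<dots> = L i" unfolding len using that by (auto simp del: upt_Suc)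
      finally show ?thesis .
    qed
    have "bound = involution_sum {1..length cs} (\<lambda>i. cat (length (cs ! (i - 1))))
      (\<lambda>i j. pair_max (length (cs ! (i - 1))) (length (cs ! (j - 1))))"
      unfolding bound_def q by (rule involution_sum_cong) (simp_all only: L)
    then show ?thesis
      using multiplicity_bound[OF rep \<pi>] stacked_cycles_iff_descending_interval_cycles[OF rep] by simp
  qed
  have "sum_list (map L [1..<q + 1]) = n"
    using L_sum by (simp add: interv_sum_list_conv_sum_set_nat atLeastLessThanSuc_atLeastAtMost del: upt_Suc)
  moreover have "\<forall>l\<in>set (map L [1..<q + 1]). 1 \<le> l" using L_pos by (auto simp del: upt_Suc)
  ultimately obtain \<rho> where "\<rho> \<in> K" "descending_interval_cycles n \<rho>"
    using ex_descending_interval_cycles unfolding K_def by blast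
  then have \<rho>: "\<rho> \<in> K" "multiplicity n \<rho> = bound" using K by auto
  have max_iff: "(\<forall>\<sigma>\<in>K. multiplicity n \<sigma> \<le> multiplicity n \<pi>) \<longleftrightarrow> multiplicity n \<pi> = bound" if "\<pi> \<in> K" for \<pi>
    using K[OF that] K \<rho> by (metis order_antisym)
  have "real bound = involution_sum {1..q} (\<lambda>i. catalan (L i)) (\<lambda>i j. G (L i) (L j))"
    unfolding bound_def of_nat_involution_sum cat_eq_catalan pair_max_eq_G ..
  then have "real bound = (\<Sum>\<chi> \<in> involutions {1..q}.
                (\<Prod>i \<in> {i \<in> {1..q}. \<chi> i = i}. catalan (L i)) *
                (\<Prod>(i, j) \<in> {(i, j) \<in> {1..q} \<times> {1..q}. i < j \<and> \<chi> i = j}. G (L i) (L j)))"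
    unfolding involution_sum_def .
  then show ?thesis using max_iff K by (auto cong: conj_cong)
qed

end
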